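(* Let $F$ be a finite field and let $r$ be an integer with $1\le r<2n$. Let $\rho_1$ and $\rho_2$ be finite dimensional representations of $G_r$ and $G_{2n-r}$ respectively, and put $\pi=\mathrm{Ind}_{P_{r,2n-r}}^{G_{2n}}(\rho_1\otimes\rho_2)$. Then, as $\Delta G_n$-modules, $$\pi_{N,\psi}=\bigoplus_{\max\{0,r-n\}\le k\le\lfloor\frac r2\rfloor}\mathrm{Ind}_{\Delta P_{k,r-2k,n-r+k}}^{\Delta G_n}(\tau_k),$$ where, for $p=\begin{pmatrix} a&d&e\\0&b&f\\0&0&c\end{pmatrix}\in P_{k,r-2k,n-r+k}$, $$\tau_k\begin{pmatrix}p&0\\0&p\end{pmatrix}=(\rho_1)_{N(k,1),\psi_{k,1}}\begin{pmatrix}a&0&0\\0&a&d\\0&0&b\end{pmatrix}\otimes(\rho_2)_{N(k,2),\psi_{k,2}}\begin{pmatrix}b&f&0\\0&c&0\\0&0&c\end{pmatrix}.$$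
   Context: $F$ is a finite field, $\mathcal M_{m,n}$ is the space of $m\times n$ matrices over $F$, $\mathcal M_n=\mathcal M_{n,n}$, $G_n=GL_n(F)$; representations are complex; blocks of size $0$ are omitted. $P_{n_1,\dots,n_k}$ is the standard block upper triangular parabolic subgroup; representations of its block diagonal Levi subgroup are extended trivially on the unipotent radical. $\psi_0$ is a fixed non-trivial additive character of $F$; $N=\left\{\begin{pmatrix} I_n&x\\0&I_n\end{pmatrix}:x\in\mathcal M_n\right\}\subset G_{2n}$ and $\psi\begin{pmatrix} I_n&x\\0&I_n\end{pmatrix}=\psi_0(\mathrm{tr}(x))$. For $H\le G_n$, $\Delta H=\left\{\begin{pmatrix}g&0\\0&g\end{pmatrix}:g\in H\right\}$. For each $k$, $$N(k,1)=\left\{\begin{pmatrix} I_k&x&y\\0&I_k&0\\0&0&I_{r-2k}\end{pmatrix}:x\in\mathcal M_k,\ y\in\mathcal M_{k,r-2k}\right\}\subset G_r,\qquad N(k,2)=\left\{\begin{pmatrix} I_{r-2k}&0&w\\0&I_{n-r+k}&z\\0&0&I_{n-r+k}\end{pmatrix}:w\in\mathcal M_{r-2k,n-r+k},\ z\in\mathcal M_{n-r+k}\right\}\subset G_{2n-r},$$ with characters $\psi_{k,1}=\psi_0(\mathrm{tr}(x))$ and $\psi_{k,2}=\psi_0(\mathrm{tr}(z))$ on these elements. For a representation $(\pi,V)$ of a group $G$, a subgroup $U$ and a character $\theta$ of $U$, $\pi_{U,\theta}$ is the natural representation of any subgroup normalizing $U$ and $\theta$ on $V/\langle\pi(u)v-\theta(u)v:u\in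 U,v\in V\rangle$. *)

theory Defs
  imports
    Complex_Main
    "HOL-Algebra.AbelCoset"
    "HOL-Library.Poly_Mapping"
    "Jordan_Normal_Form.VS_Connect"
begin

section \<open>Complex representations\<close>

text \<open>A representation is a HOL-Algebra module over the complex numbers together with an action;
  the group is supplied separately, so that restricting to a subgroup leaves the record unchanged.
  The ring fields \<open>mult\<close> and \<open>one\<close> inherited from the record \<open>module\<close> play no role
  for modules and are left \<open>undefined\<close> in the constructions below.\<close>

record ('v, 'g) rep = "(complex, 'v) module" +
  act :: "'g \<Rightarrow> 'v \<Rightarrow> 'v"

locale representation =
  G?: group G + V?: vectorspace "class_ring :: complex ring" V
  for G :: "('g, 'x) monoid_scheme" and V :: "('v, 'g) rep" +
  assumes act_linear: "g \<in> carrier G \<Longrightarrow> act V g \<in> LinearCombinations.module_hom class_ring V V"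
    and act_one: "v \<in> carrier V \<Longrightarrow> act V \<one>\<^bsub>G\<^esub> v = v"
    and act_mult: "g \<in> carrier G \<Longrightarrow> h \<in> carrier G \<Longrightarrow> v \<in> carrier V \<Longrightarrow>
      act V (g \<otimes>\<^bsub>G\<^esub> h) v = act V g (act V h v)"

locale fin_dim_representation = representation +
  assumes fin_dim: "vectorspace.fin_dim class_ring V"

definition rep_iso :: "('g, 'x) monoid_scheme \<Rightarrow> ('v, 'g) rep \<Rightarrow> ('w, 'g) rep \<Rightarrow> bool" where
  "rep_iso G V W \<longleftrightarrow> representation G V \<and> representation G W \<and>
     (\<exists>T. linear_map class_ring V W T \<and> bij_betw T (carrier V) (carrier W) \<and>
          (\<forall>g\<in>carrier G. \<forall>v\<in>carrier V. T (act V g v) = act W g (T v)))"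

definition pullback :: "('h \<Rightarrow> 'g) \<Rightarrow> ('v, 'g) rep \<Rightarrow> ('v, 'h) rep" where
  "pullback \<phi> V =
     \<lparr>carrier = carrier V, monoid.mult = undefined, one = undefined, zero = \<zero>\<^bsub>V\<^esub>, add = add V,
      smult = smult V, act = (\<lambda>h. act V (\<phi> h))\<rparr>"

text \<open>The quotient by a subspace \<open>W\<close>; its vectors are the cosets of \<open>W\<close>. Adding \<open>W\<close> in \<open>smult\<close>
  handles the scalar 0. The action is meaningful only for those \<open>g\<close> that preserve \<open>W\<close>.\<close>

definition quotient_rep :: "('v, 'g) rep \<Rightarrow> 'v set \<Rightarrow> ('v set, 'g) rep" where
  "quotient_rep V W =
     \<lparr>carrier = a_rcosets\<^bsub>V\<^esub> W, monoid.mult = undefined, one = undefined, zero = W, add = set_add V,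
      smult = (\<lambda>c X. W <+>\<^bsub>V\<^esub> (smult V c ` X)), act = (\<lambda>g X. W <+>\<^bsub>V\<^esub> (act V g ` X))\<rparr>"

definition twisted_coinvariants ::
    "('v, 'g) rep \<Rightarrow> 'g set \<Rightarrow> ('g \<Rightarrow> complex) \<Rightarrow> ('v set, 'g) rep" where
  "twisted_coinvariants V U \<theta> =
     quotient_rep V (LinearCombinations.module.span class_ring V
       {act V u v \<ominus>\<^bsub>V\<^esub> (\<theta> u \<odot>\<^bsub>V\<^esub> v) | u v. u \<in> U \<and> v \<in> carrier V})"

text \<open>Functions that transform on the left under the subgroup \<open>H\<close>, with \<open>G\<close> acting by right
  translation. Outside \<open>carrier G\<close> the functions are \<open>undefined\<close>.\<close>

definition induced_rep ::
    "('g, 'x) monoid_scheme \<Rightarrow> 'g set \<Rightarrow> ('v, 'g) rep \<Rightarrow> ('g \<Rightarrow> 'v, 'g) rep" where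
  "induced_rep G H V =
     \<lparr>carrier = {f \<in> carrier G \<rightarrow>\<^sub>E carrier V.
        \<forall>h\<in>H. \<forall>x\<in>carrier G. f (h \<otimes>\<^bsub>G\<^esub> x) = act V h (f x)},
      monoid.mult = undefined, one = undefined,
      zero = (\<lambda>x\<in>carrier G. \<zero>\<^bsub>V\<^esub>),
      add = (\<lambda>f f'. \<lambda>x\<in>carrier G. f x \<oplus>\<^bsub>V\<^esub> f' x),
      smult = (\<lambda>c f. \<lambda>x\<in>carrier G. c \<odot>\<^bsub>V\<^esub> f x),
      act = (\<lambda>g f. \<lambda>x\<in>carrier G. f (x \<otimes>\<^bsub>G\<^esub> g))\<rparr>"

text \<open>For finite index sets \<open>K\<close>, the only case in which it is used, this is the direct sum.\<close>

definition direct_sum_rep :: "'k set \<Rightarrow> ('k \<Rightarrow> ('v, 'g) rep) \<Rightarrow> ('k \<Rightarrow> 'v, 'g) rep" where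
  "direct_sum_rep K V =
     \<lparr>carrier = (\<Pi>\<^sub>E k\<in>K. carrier (V k)), monoid.mult = undefined, one = undefined,
      zero = (\<lambda>k\<in>K. \<zero>\<^bsub>V k\<^esub>),
      add = (\<lambda>f f'. \<lambda>k\<in>K. f k \<oplus>\<^bsub>V k\<^esub> f' k),
      smult = (\<lambda>c f. \<lambda>k\<in>K. c \<odot>\<^bsub>V k\<^esub> f k),
      act = (\<lambda>g f. \<lambda>k\<in>K. act (V k) g (f k))\<rparr>"

text \<open>The tensor product of a representation of \<open>G\<close> and one of \<open>H\<close>, as a representation of
  \<open>G \<times> H\<close>: the complex vector space with basis \<open>carrier V \<times> carrier W\<close>, modulo the bilinearity
  relations.\<close>

definition free_rep ::
    "('v, 'g) rep \<Rightarrow> ('w, 'h) rep \<Rightarrow> ('v \<times> 'w \<Rightarrow>\<^sub>0 complex, 'g \<times> 'h) rep" where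
  "free_rep V W =
     \<lparr>carrier = {f. Poly_Mapping.keys f \<subseteq> carrier V \<times> carrier W},
      monoid.mult = undefined, one = undefined, zero = 0, add = (+),
      smult = (\<lambda>c. Poly_Mapping.map ((*) c)),
      act = (\<lambda>(g, h) f. \<Sum>(v, w)\<in>Poly_Mapping.keys f.
        Poly_Mapping.single (act V g v, act W h w) (Poly_Mapping.lookup f (v, w)))\<rparr>"

abbreviation basis_elt :: "'v \<Rightarrow> 'w \<Rightarrow> 'v \<times> 'w \<Rightarrow>\<^sub>0 complex" where
  "basis_elt v w \<equiv> Poly_Mapping.single (v, w) 1"

definition bilinearity_relations ::
    "('v, 'g) rep \<Rightarrow> ('w, 'h) rep \<Rightarrow> ('v \<times> 'w \<Rightarrow>\<^sub>0 complex) set" where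
  "bilinearity_relations V W =
     {basis_elt (v \<oplus>\<^bsub>V\<^esub> v') w - basis_elt v w - basis_elt v' w | v v' w.
        v \<in> carrier V \<and> v' \<in> carrier V \<and> w \<in> carrier W} \<union>
     {basis_elt v (w \<oplus>\<^bsub>W\<^esub> w') - basis_elt v w - basis_elt v w' | v w w'.
        v \<in> carrier V \<and> w \<in> carrier W \<and> w' \<in> carrier W} \<union>
     {basis_elt (c \<odot>\<^bsub>V\<^esub> v) w - Poly_Mapping.single (v, w) c | c v w.
        v \<in> carrier V \<and> w \<in> carrier W} \<union>
     {basis_elt v (c \<odot>\<^bsub>W\<^esub> w) - Poly_Mapping.single (v, w) c | c v w.
        v \<in> carrier V \<and> w \<in> carrier W}"

definition tensor_rep ::
    "('v, 'g) rep \<Rightarrow> ('w, 'h) rep \<Rightarrow> (('v \<times> 'w \<Rightarrow>\<^sub>0 complex) set, 'g \<times> 'h) rep" where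
  "tensor_rep V W =
     quotient_rep (free_rep V W)
       (LinearCombinations.module.span class_ring (free_rep V W) (bilinearity_relations V W))"

section \<open>Matrix groups\<close>

definition GL :: "nat \<Rightarrow> 'f::field mat monoid" where
  "GL n = units_of (ring_mat TYPE('f) n ())"

definition mat_trace :: "'f::comm_monoid_add mat \<Rightarrow> 'f" where
  "mat_trace A = (\<Sum>i<dim_row A. A $$ (i, i))"

text \<open>The block in block row \<open>i\<close> and block column \<open>j\<close> (counted from 0) of a square matrix
  partitioned according to the list \<open>ns\<close> of block sizes.\<close>

definition get_block :: "nat list \<Rightarrow> nat \<Rightarrow> nat \<Rightarrow> 'f mat \<Rightarrow> 'f mat" where
  "get_block ns i j A = mat (ns ! i) (ns ! j)
     (\<lambda>(x, y). A $$ (sum_list (take i ns) + x, sum_list (take j ns) + y))"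

definition parabolic :: "nat list \<Rightarrow> 'f::field mat set" where
  "parabolic ns = {A \<in> carrier (GL (sum_list ns)).
     \<forall>i<length ns. \<forall>j<i. get_block ns i j A = 0\<^sub>m (ns ! i) (ns ! j)}"

definition append_cols :: "'f::zero mat \<Rightarrow> 'f mat \<Rightarrow> 'f mat" where
  "append_cols A B = four_block_mat A B (0\<^sub>m 0 (dim_col A)) (0\<^sub>m 0 (dim_col B))"

definition nine_block_mat :: "'f::zero mat \<Rightarrow> 'f mat \<Rightarrow> 'f mat \<Rightarrow> 'f mat \<Rightarrow> 'f mat \<Rightarrow> 'f mat \<Rightarrow>
    'f mat \<Rightarrow> 'f mat \<Rightarrow> 'f mat \<Rightarrow> 'f mat" where
  "nine_block_mat
       A B C
       D E F
       G H K = four_block_mat A (append_cols B C) (D @\<^sub>r G) (four_block_mat E F H K)"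

definition diag_embed :: "nat \<Rightarrow> 'f::zero mat \<Rightarrow> 'f mat" where
  "diag_embed n g = four_block_mat g (0\<^sub>m n n) (0\<^sub>m n n) g"

definition Delta_GL :: "nat \<Rightarrow> 'f::field mat monoid" where
  "Delta_GL n = (GL (2 * n)) \<lparr>carrier := diag_embed n ` carrier (GL n)\<rparr>"

section \<open>Unipotent subgroups and their characters\<close>

definition nontrivial_additive_character :: "('f::ring_1 \<Rightarrow> complex) \<Rightarrow> bool" where
  "nontrivial_additive_character \<psi>0 \<longleftrightarrow>
     \<psi>0 0 = 1 \<and> (\<forall>x y. \<psi>0 (x + y) = \<psi>0 x * \<psi>0 y) \<and> (\<exists>x. \<psi>0 x \<noteq> 1)"

definition N_unip :: "nat \<Rightarrow> 'f::field mat set" where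
  "N_unip n = {four_block_mat (1\<^sub>m n) x (0\<^sub>m n n) (1\<^sub>m n) | x. x \<in> carrier_mat n n}"

definition \<psi>N :: "('f::field \<Rightarrow> complex) \<Rightarrow> nat \<Rightarrow> 'f mat \<Rightarrow> complex" where
  "\<psi>N \<psi>0 n u = \<psi>0 (mat_trace (get_block [n, n] 0 1 u))"

text \<open>The sizes of the diagonal blocks of \<open>P\<^bsub>k,r-2k,n-r+k\<^esub>\<close>. Subtraction on natural numbers
  truncates, so \<open>n - r + k\<close> is written \<open>n + k - r\<close>; for \<open>max {0, r - n} \<le> k \<le> r / 2\<close>
  no truncation occurs here or below.\<close>

definition P_sizes :: "nat \<Rightarrow> nat \<Rightarrow> nat \<Rightarrow> nat list" where
  "P_sizes n r k = [k, r - 2 * k, n + k - r]"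

definition N1 :: "nat \<Rightarrow> nat \<Rightarrow> 'f::field mat set" where
  "N1 r k = {nine_block_mat
       (1\<^sub>m k)               x                   y
       (0\<^sub>m k k)             (1\<^sub>m k)             (0\<^sub>m k (r - 2 * k))
       (0\<^sub>m (r - 2 * k) k)   (0\<^sub>m (r - 2 * k) k) (1\<^sub>m (r - 2 * k))
     | x y. x \<in> carrier_mat k k \<and> y \<in> carrier_mat k (r - 2 * k)}"

definition \<psi>1 :: "('f::field \<Rightarrow> complex) \<Rightarrow> nat \<Rightarrow> nat \<Rightarrow> 'f mat \<Rightarrow> complex" where
  "\<psi>1 \<psi>0 r k u = \<psi>0 (mat_trace (get_block [k, k, r - 2 * k] 0 1 u))"

definition N2 :: "nat \<Rightarrow> nat \<Rightarrow> nat \<Rightarrow> 'f::field mat set" where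
  "N2 n r k = {nine_block_mat
       (1\<^sub>m (r - 2 * k))               (0\<^sub>m (r - 2 * k) (n + k - r))   w
       (0\<^sub>m (n + k - r) (r - 2 * k))   (1\<^sub>m (n + k - r))               z
       (0\<^sub>m (n + k - r) (r - 2 * k))   (0\<^sub>m (n + k - r) (n + k - r))   (1\<^sub>m (n + k - r))
     | w z. w \<in> carrier_mat (r - 2 * k) (n + k - r) \<and> z \<in> carrier_mat (n + k - r) (n + k - r)}"

definition \<psi>2 :: "('f::field \<Rightarrow> complex) \<Rightarrow> nat \<Rightarrow> nat \<Rightarrow> nat \<Rightarrow> 'f mat \<Rightarrow> complex" where
  "\<psi>2 \<psi>0 n r k u = \<psi>0 (mat_trace (get_block [r - 2 * k, n + k - r, n + k - r] 1 2 u))"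

section \<open>The representations in the statement\<close>

definition parabolic_induction :: "nat \<Rightarrow> nat \<Rightarrow>
    ('v, 'f::field mat) rep \<Rightarrow> ('w, 'f mat) rep \<Rightarrow>
    ('f mat \<Rightarrow> ('v \<times> 'w \<Rightarrow>\<^sub>0 complex) set, 'f mat) rep" where
  "parabolic_induction r s \<rho>1 \<rho>2 =
     induced_rep (GL (r + s)) (parabolic [r, s])
       (pullback (\<lambda>p. (get_block [r, s] 0 0 p, get_block [r, s] 1 1 p)) (tensor_rep \<rho>1 \<rho>2))"

definition \<tau>_arg1 :: "nat \<Rightarrow> nat \<Rightarrow> nat \<Rightarrow> 'f::field mat \<Rightarrow> 'f mat" where
  "\<tau>_arg1 n r k p =
     (let a = get_block (P_sizes n r k) 0 0 p;
          d = get_block (P_sizes n r k) 0 1 p;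
          b = get_block (P_sizes n r k) 1 1 p
      in nine_block_mat
           a                     (0\<^sub>m k k)             (0\<^sub>m k (r - 2 * k))
           (0\<^sub>m k k)             a                     d
           (0\<^sub>m (r - 2 * k) k)   (0\<^sub>m (r - 2 * k) k)   b)"

definition \<tau>_arg2 :: "nat \<Rightarrow> nat \<Rightarrow> nat \<Rightarrow> 'f::field mat \<Rightarrow> 'f mat" where
  "\<tau>_arg2 n r k p =
     (let b = get_block (P_sizes n r k) 1 1 p;
          f = get_block (P_sizes n r k) 1 2 p;
          c = get_block (P_sizes n r k) 2 2 p
      in nine_block_mat
           b                               f                               (0\<^sub>m (r - 2 * k) (n + k - r))
           (0\<^sub>m (n + k - r) (r - 2 * k))   c                               (0\<^sub>m (n + k - r) (n + k - r))
           (0\<^sub>m (n + k - r) (r - 2 * k))   (0\<^sub>m (n + k - r) (n + k - r))   c)"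

text \<open>The element of \<open>\<Delta>P\<close> is \<open>q = diag(p, p)\<close>, and \<open>p\<close> is recovered as its upper left block.\<close>

definition \<tau> :: "('f::field \<Rightarrow> complex) \<Rightarrow> nat \<Rightarrow> nat \<Rightarrow>
    ('v, 'f mat) rep \<Rightarrow> ('w, 'f mat) rep \<Rightarrow> nat \<Rightarrow>
    (('v set \<times> 'w set \<Rightarrow>\<^sub>0 complex) set, 'f mat) rep" where
  "\<tau> \<psi>0 n r \<rho>1 \<rho>2 k =
     pullback (\<lambda>q. let p = get_block [n, n] 0 0 q in (\<tau>_arg1 n r k p, \<tau>_arg2 n r k p))
       (tensor_rep
         (twisted_coinvariants \<rho>1 (N1 r k) (\<psi>1 \<psi>0 r k))
         (twisted_coinvariants \<rho>2 (N2 n r k) (\<psi>2 \<psi>0 n r k)))"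

end

theory Submission
  imports Defs
begin

text \<open>
  The proof is Mackey theory for the subgroup \<open>\<Delta>G\<^sub>n N\<close> of \<open>G\<^bsub>2n\<^esub>\<close>. Put \<open>s = 2 n - r\<close> and \<open>P = P\<^bsub>r,s\<^esub>\<close>. The
  representation \<open>\<pi>\<close> consists of functions on \<open>G\<^bsub>2n\<^esub>\<close>, and a coset \<open>P x\<close> is the same thing as an
  \<open>s\<close>-dimensional space \<open>S\<close> of row vectors, spanned by the last \<open>s\<close> rows of \<open>x\<close>. Let \<open>A\<close> be the projection
  of \<open>S\<close> to the first \<open>n\<close> coordinates and \<open>B\<close> the space of all \<open>v\<close> with \<open>(0, v) \<in> S\<close>. The group \<open>N\<close> acts
  transitively on the spaces \<open>S\<close> with given \<open>A\<close> and \<open>B\<close>, whose dimensions add up to \<open>s\<close>.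

  Since \<open>N\<close> is finite, averaging identifies \<open>\<pi>\<^bsub>N,\<psi>\<^esub>\<close> with the functions \<open>f\<close> in \<open>\<pi>\<close> that satisfy
  \<open>f (x u) = \<psi>(u) f x\<close> for all \<open>u \<in> N\<close> (\<open>twist_span_iff\<close>). If \<open>B\<close> is not contained in \<open>A\<close>, some \<open>u \<in> N\<close>
  with \<open>\<psi>(u) \<noteq> 1\<close> acts trivially on \<open>S\<close> and modulo \<open>S\<close>, so that \<open>x u x\<inverse>\<close> lies in the unipotent radical of
  \<open>P\<close> and \<open>f x = \<psi>(u) f x = 0\<close> (\<open>trivial_conjugate\<close>). If \<open>B \<subseteq> A\<close>, the flag is determined up to \<open>\<Delta>G\<^sub>n\<close> by
  \<open>k = n - dim A\<close>, and its stabilizer is \<open>\<Delta>P\<^bsub>k,r-2k,n-r+k\<^esub>\<close> (\<open>double_coset_cover\<close>, \<open>conj_disjoint\<close>). For a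
  suitable representative \<open>w\<^sub>k\<close> the Levi blocks of \<open>w\<^sub>k p w\<^sub>k\<inverse>\<close>, for \<open>p\<close> in this stabilizer, are the two
  matrices in the definition of \<open>\<tau>\<^sub>k\<close>, and the part of \<open>N\<close> that \<open>w\<^sub>k\<close> conjugates into \<open>P\<close> maps onto
  \<open>N(k,1) \<times> N(k,2)\<close> with \<open>\<psi>\<close> corresponding to \<open>\<psi>\<^bsub>k,1\<^esub> \<otimes> \<psi>\<^bsub>k,2\<^esub>\<close> (\<open>conj_diag_embed\<close>, \<open>conj_N_blocks\<close>).

  The isomorphism sends the class of \<open>f\<close> to the family of functions \<open>h \<mapsto> q\<^sub>k (f' (w\<^sub>k h))\<close> on \<open>\<Delta>G\<^sub>n\<close>, where
  \<open>f'\<close> is the average of \<open>f\<close> and \<open>q\<^sub>k\<close> the quotient map from the tensor product of \<open>\<rho>\<^sub>1\<close> and \<open>\<rho>\<^sub>2\<close> to the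
  tensor product of their coinvariants. The value \<open>f' (w\<^sub>k h)\<close> is equivariant under \<open>N(k,1) \<times> N(k,2)\<close>, and
  \<open>q\<^sub>k\<close> is bijective on such vectors (\<open>tensor_coinvariants\<close>, again by averaging), which gives injectivity.
  For surjectivity, the only possible preimage is written down on each double coset and is seen to be well
  defined (\<open>transport_eq\<close>). The locale \<open>twisted_mackey\<close> carries out this argument for an abstract group.
\<close>

section \<open>Complex vector spaces and linear maps\<close>

abbreviation cspace :: "('v, 'g) rep \<Rightarrow> bool" where
  "cspace V \<equiv> vectorspace (class_ring :: complex ring) V"

abbreviation lin :: "('v, 'g) rep \<Rightarrow> ('w, 'h) rep \<Rightarrow> ('v \<Rightarrow> 'w) set" where
  "lin V W \<equiv> LinearCombinations.module_hom (class_ring :: complex ring) V W"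

text \<open>Multiplication by \<open>-1\<close> supplies the negatives, so the equation \<open>0 x = 0\<close> takes the place of an axiom
  on inverses.\<close>

lemma cspaceI:
  fixes V :: "('v, 'g) rep"
  assumes "\<And>x y. x \<in> carrier V \<Longrightarrow> y \<in> carrier V \<Longrightarrow> x \<oplus>\<^bsub>V\<^esub> y \<in> carrier V"
    and "\<zero>\<^bsub>V\<^esub> \<in> carrier V"
    and "\<And>c x. x \<in> carrier V \<Longrightarrow> c \<odot>\<^bsub>V\<^esub> x \<in> carrier V"
    and "\<And>x y z. x \<in> carrier V \<Longrightarrow> y \<in> carrier V \<Longrightarrow> z \<in> carrier V \<Longrightarrow>
      (x \<oplus>\<^bsub>V\<^esub> y) \<oplus>\<^bsub>V\<^esub> z = x \<oplus>\<^bsub>V\<^esub> (y \<oplus>\<^bsub>V\<^esub> z)"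
    and "\<And>x y. x \<in> carrier V \<Longrightarrow> y \<in> carrier V \<Longrightarrow> x \<oplus>\<^bsub>V\<^esub> y = y \<oplus>\<^bsub>V\<^esub> x"
    and "\<And>x. x \<in> carrier V \<Longrightarrow> \<zero>\<^bsub>V\<^esub> \<oplus>\<^bsub>V\<^esub> x = x"
    and "\<And>c d x. x \<in> carrier V \<Longrightarrow> (c + d) \<odot>\<^bsub>V\<^esub> x = c \<odot>\<^bsub>V\<^esub> x \<oplus>\<^bsub>V\<^esub> d \<odot>\<^bsub>V\<^esub> x"
    and "\<And>c x y. x \<in> carrier V \<Longrightarrow> y \<in> carrier V \<Longrightarrow>
      c \<odot>\<^bsub>V\<^esub> (x \<oplus>\<^bsub>V\<^esub> y) = c \<odot>\<^bsub>V\<^esub> x \<oplus>\<^bsub>V\<^esub> c \<odot>\<^bsub>V\<^esub> y"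
    and "\<And>c d x. x \<in> carrier V \<Longrightarrow> (c * d) \<odot>\<^bsub>V\<^esub> x = c \<odot>\<^bsub>V\<^esub> (d \<odot>\<^bsub>V\<^esub> x)"
    and "\<And>x. x \<in> carrier V \<Longrightarrow> 1 \<odot>\<^bsub>V\<^esub> x = x"
    and "\<And>x. x \<in> carrier V \<Longrightarrow> 0 \<odot>\<^bsub>V\<^esub> x = \<zero>\<^bsub>V\<^esub>"
  shows "cspace V"
proof -
  have "\<exists>y\<in>carrier V. y \<oplus>\<^bsub>V\<^esub> x = \<zero>\<^bsub>V\<^esub>" if x: "x \<in> carrier V" for x
  proof
    show "(-1) \<odot>\<^bsub>V\<^esub> x \<in> carrier V" by (rule assms(3)[OF x])
    show "(-1) \<odot>\<^bsub>V\<^esub> x \<oplus>\<^bsub>V\<^esub> x = \<zero>\<^bsub>V\<^esub>"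
      using assms(7)[OF x, of "-1" 1] assms(10)[OF x] assms(11)[OF x] by simp
  qed
  then have "abelian_group V"
    by (intro abelian_groupI) (use assms in auto)
  then show ?thesis
    unfolding vectorspace_def Module.module_def module_axioms_def
    using assms class_field[where ?'a = complex] by (auto simp: Ring.field_def domain_def)
qed

lemma cspace_add_closed: "cspace V \<Longrightarrow> x \<in> carrier V \<Longrightarrow> y \<in> carrier V \<Longrightarrow> x \<oplus>\<^bsub>V\<^esub> y \<in> carrier V"
  and cspace_zero_closed: "cspace V \<Longrightarrow> \<zero>\<^bsub>V\<^esub> \<in> carrier V"
  and cspace_smult_closed: "cspace V \<Longrightarrow> x \<in> carrier V \<Longrightarrow> c \<odot>\<^bsub>V\<^esub> x \<in> carrier V"
  and cspace_minus_closed: "cspace V \<Longrightarrow> x \<in> carrier V \<Longrightarrow> y \<in> carrier V \<Longrightarrow> x \<ominus>\<^bsub>V\<^esub> y \<in> carrier V"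
  and cspace_assoc: "cspace V \<Longrightarrow> x \<in> carrier V \<Longrightarrow> y \<in> carrier V \<Longrightarrow> z \<in> carrier V \<Longrightarrow>
      (x \<oplus>\<^bsub>V\<^esub> y) \<oplus>\<^bsub>V\<^esub> z = x \<oplus>\<^bsub>V\<^esub> (y \<oplus>\<^bsub>V\<^esub> z)"
  and cspace_comm: "cspace V \<Longrightarrow> x \<in> carrier V \<Longrightarrow> y \<in> carrier V \<Longrightarrow> x \<oplus>\<^bsub>V\<^esub> y = y \<oplus>\<^bsub>V\<^esub> x"
  and cspace_zero_left: "cspace V \<Longrightarrow> x \<in> carrier V \<Longrightarrow> \<zero>\<^bsub>V\<^esub> \<oplus>\<^bsub>V\<^esub> x = x"
  and cspace_smult_l_distr: "cspace V \<Longrightarrow> x \<in> carrier V \<Longrightarrow>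
      (c + d) \<odot>\<^bsub>V\<^esub> x = c \<odot>\<^bsub>V\<^esub> x \<oplus>\<^bsub>V\<^esub> d \<odot>\<^bsub>V\<^esub> x"
  and cspace_smult_r_distr: "cspace V \<Longrightarrow> x \<in> carrier V \<Longrightarrow> y \<in> carrier V \<Longrightarrow>
      c \<odot>\<^bsub>V\<^esub> (x \<oplus>\<^bsub>V\<^esub> y) = c \<odot>\<^bsub>V\<^esub> x \<oplus>\<^bsub>V\<^esub> c \<odot>\<^bsub>V\<^esub> y"
  and cspace_smult_assoc: "cspace V \<Longrightarrow> x \<in> carrier V \<Longrightarrow> (c * d) \<odot>\<^bsub>V\<^esub> x = c \<odot>\<^bsub>V\<^esub> (d \<odot>\<^bsub>V\<^esub> x)"
  and cspace_smult_one: "cspace V \<Longrightarrow> x \<in> carrier V \<Longrightarrow> 1 \<odot>\<^bsub>V\<^esub> x = x"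
  and cspace_smult_zero: "cspace V \<Longrightarrow> x \<in> carrier V \<Longrightarrow> 0 \<odot>\<^bsub>V\<^esub> x = \<zero>\<^bsub>V\<^esub>"
  and cspace_smult_zero_right: "cspace V \<Longrightarrow> c \<odot>\<^bsub>V\<^esub> \<zero>\<^bsub>V\<^esub> = \<zero>\<^bsub>V\<^esub>"
  and cspace_minus: "cspace V \<Longrightarrow> x \<in> carrier V \<Longrightarrow> y \<in> carrier V \<Longrightarrow>
      x \<ominus>\<^bsub>V\<^esub> y = x \<oplus>\<^bsub>V\<^esub> (-1) \<odot>\<^bsub>V\<^esub> y"
  for V :: "('v, 'g) rep" and c d :: complex
proof -
  assume V: "cspace V"
  then interpret V: vectorspace "class_ring :: complex ring" V .
  {
    assume "x \<in> carrier V" "y \<in> carrier V"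
    then show "x \<oplus>\<^bsub>V\<^esub> y \<in> carrier V" "x \<ominus>\<^bsub>V\<^esub> y \<in> carrier V" "x \<oplus>\<^bsub>V\<^esub> y = y \<oplus>\<^bsub>V\<^esub> x"
      "c \<odot>\<^bsub>V\<^esub> (x \<oplus>\<^bsub>V\<^esub> y) = c \<odot>\<^bsub>V\<^esub> x \<oplus>\<^bsub>V\<^esub> c \<odot>\<^bsub>V\<^esub> y"
      using V.smult_r_distr[of c x y] by (auto simp: V.a_comm)
    assume "z \<in> carrier V"
    with \<open>x \<in> carrier V\<close> \<open>y \<in> carrier V\<close>
    show "(x \<oplus>\<^bsub>V\<^esub> y) \<oplus>\<^bsub>V\<^esub> z = x \<oplus>\<^bsub>V\<^esub> (y \<oplus>\<^bsub>V\<^esub> z)" by (simp add: V.a_assoc)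
  }
  {
    assume x: "x \<in> carrier V"
    then show "c \<odot>\<^bsub>V\<^esub> x \<in> carrier V" "\<zero>\<^bsub>V\<^esub> \<oplus>\<^bsub>V\<^esub> x = x" "1 \<odot>\<^bsub>V\<^esub> x = x"
      "(c + d) \<odot>\<^bsub>V\<^esub> x = c \<odot>\<^bsub>V\<^esub> x \<oplus>\<^bsub>V\<^esub> d \<odot>\<^bsub>V\<^esub> x"
      "(c * d) \<odot>\<^bsub>V\<^esub> x = c \<odot>\<^bsub>V\<^esub> (d \<odot>\<^bsub>V\<^esub> x)"
      using V.smult_closed[of c x] V.smult_one[of x] V.smult_l_distr[of c d x]
        V.smult_assoc1[of c d x]
      by auto
    show "0 \<odot>\<^bsub>V\<^esub> x = \<zero>\<^bsub>V\<^esub>" using V.smult_l_null[OF x] by simp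
  }
  show "\<zero>\<^bsub>V\<^esub> \<in> carrier V" by simp
  show "c \<odot>\<^bsub>V\<^esub> \<zero>\<^bsub>V\<^esub> = \<zero>\<^bsub>V\<^esub>" using V.smult_r_null[of c] by simp
  assume x: "x \<in> carrier V" and y: "y \<in> carrier V"
  have "\<ominus>\<^bsub>V\<^esub> y = (-1) \<odot>\<^bsub>V\<^esub> y"
    using V.smult_minus_1[OF y] by (simp add: class_ring_simps)
  then show "x \<ominus>\<^bsub>V\<^esub> y = x \<oplus>\<^bsub>V\<^esub> (-1) \<odot>\<^bsub>V\<^esub> y" by (simp add: a_minus_def)
qed


lemmas cspace_closed = cspace_add_closed cspace_zero_closed cspace_smult_closed cspace_minus_closed

lemma cspace_lcomm:
  assumes "cspace V" "x \<in> carrier V" "y \<in> carrier V" "z \<in> carrier V"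
  shows "x \<oplus>\<^bsub>V\<^esub> (y \<oplus>\<^bsub>V\<^esub> z) = y \<oplus>\<^bsub>V\<^esub> (x \<oplus>\<^bsub>V\<^esub> z)"
  using assms by (metis cspace_assoc cspace_comm)

lemma cspace_minus_self:
  assumes "cspace V" "x \<in> carrier V" shows "x \<ominus>\<^bsub>V\<^esub> x = \<zero>\<^bsub>V\<^esub>"
proof -
  have "x \<ominus>\<^bsub>V\<^esub> x = 1 \<odot>\<^bsub>V\<^esub> x \<oplus>\<^bsub>V\<^esub> (-1) \<odot>\<^bsub>V\<^esub> x"
    using assms by (simp add: cspace_minus cspace_smult_one)
  also have "\<dots> = (1 + -1) \<odot>\<^bsub>V\<^esub> x" using assms by (simp only: cspace_smult_l_distr)
  finally show ?thesis using assms by (simp add: cspace_smult_zero)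
qed

lemma cspace_minus_add:
  assumes V: "cspace V" and x: "x \<in> carrier V" and y: "y \<in> carrier V"
  shows "(x \<ominus>\<^bsub>V\<^esub> y) \<oplus>\<^bsub>V\<^esub> y = x"
proof -
  have "(x \<ominus>\<^bsub>V\<^esub> y) \<oplus>\<^bsub>V\<^esub> y = x \<oplus>\<^bsub>V\<^esub> ((-1) \<odot>\<^bsub>V\<^esub> y \<oplus>\<^bsub>V\<^esub> 1 \<odot>\<^bsub>V\<^esub> y)"
    using assms by (simp add: cspace_minus cspace_assoc cspace_smult_closed cspace_smult_one)
  also have "\<dots> = x \<oplus>\<^bsub>V\<^esub> (-1 + 1) \<odot>\<^bsub>V\<^esub> y" using assms by (simp only: cspace_smult_l_distr)
  finally show ?thesis using assms cspace_comm[OF V x cspace_zero_closed[OF V]]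
    by (simp add: cspace_smult_zero cspace_zero_left)
qed

lemma cspace_eqI:
  assumes "cspace V" "x \<in> carrier V" "y \<in> carrier V" "x \<ominus>\<^bsub>V\<^esub> y = \<zero>\<^bsub>V\<^esub>"
  shows "x = y"
  using cspace_minus_add[OF assms(1-3)] assms by (simp add: cspace_zero_left)

lemma linI:
  assumes "\<And>x. x \<in> carrier V \<Longrightarrow> T x \<in> carrier W"
    and "\<And>x y. x \<in> carrier V \<Longrightarrow> y \<in> carrier V \<Longrightarrow> T (x \<oplus>\<^bsub>V\<^esub> y) = T x \<oplus>\<^bsub>W\<^esub> T y"
    and "\<And>c x. x \<in> carrier V \<Longrightarrow> T (c \<odot>\<^bsub>V\<^esub> x) = c \<odot>\<^bsub>W\<^esub> T x"
  shows "T \<in> lin V W"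
  using assms by (auto simp: LinearCombinations.module_hom_def)

lemma lin_closed: "T \<in> lin V W \<Longrightarrow> x \<in> carrier V \<Longrightarrow> T x \<in> carrier W"
  and lin_add: "T \<in> lin V W \<Longrightarrow> x \<in> carrier V \<Longrightarrow> y \<in> carrier V \<Longrightarrow> T (x \<oplus>\<^bsub>V\<^esub> y) = T x \<oplus>\<^bsub>W\<^esub> T y"
  and lin_smult: "T \<in> lin V W \<Longrightarrow> x \<in> carrier V \<Longrightarrow> T (c \<odot>\<^bsub>V\<^esub> x) = c \<odot>\<^bsub>W\<^esub> T x"
  by (auto simp: LinearCombinations.module_hom_def)

lemma lin_zero:
  assumes "cspace V" "cspace W" "T \<in> lin V W" shows "T \<zero>\<^bsub>V\<^esub> = \<zero>\<^bsub>W\<^esub>"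
proof -
  have "T (0 \<odot>\<^bsub>V\<^esub> \<zero>\<^bsub>V\<^esub>) = 0 \<odot>\<^bsub>W\<^esub> T \<zero>\<^bsub>V\<^esub>" using assms lin_smult cspace_zero_closed by metis
  then show ?thesis using assms by (simp add: cspace_smult_zero lin_closed cspace_zero_closed)
qed

lemma lin_minus:
  assumes "cspace V" "cspace W" "T \<in> lin V W" "x \<in> carrier V" "y \<in> carrier V"
  shows "T (x \<ominus>\<^bsub>V\<^esub> y) = T x \<ominus>\<^bsub>W\<^esub> T y"
  using assms by (simp add: cspace_minus lin_add lin_smult lin_closed cspace_smult_closed)

lemma lin_comp:
  assumes "T \<in> lin V W" "S \<in> lin U V" shows "(\<lambda>x. T (S x)) \<in> lin U W"
  using assms by (intro linI) (auto simp: lin_closed lin_add lin_smult)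

lemma linear_mapI: "cspace V \<Longrightarrow> cspace W \<Longrightarrow> T \<in> lin V W \<Longrightarrow> linear_map class_ring V W T"
  by (auto simp: linear_map_def mod_hom_def mod_hom_axioms_def vectorspace_def)

lemma lin_inj_onI:
  assumes V: "cspace V" and W: "cspace W" and T: "T \<in> lin V W"
    and ker: "\<And>x. x \<in> carrier V \<Longrightarrow> T x = \<zero>\<^bsub>W\<^esub> \<Longrightarrow> x = \<zero>\<^bsub>V\<^esub>"
  shows "inj_on T (carrier V)"
proof (rule inj_onI)
  fix x y assume xy: "x \<in> carrier V" "y \<in> carrier V" "T x = T y"
  have "T (x \<ominus>\<^bsub>V\<^esub> y) = \<zero>\<^bsub>W\<^esub>"
    using xy lin_minus[OF V W T xy(1,2)] by (simp add: cspace_minus_self W lin_closed[OF T])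
  then show "x = y" using ker cspace_eqI[OF V xy(1,2)] xy by (simp add: cspace_minus_closed V)
qed

lemma scaling_lin:
  assumes V: "cspace V" shows "(\<lambda>v. c \<odot>\<^bsub>V\<^esub> v) \<in> lin V V"
  by (intro linI) (auto simp: V cspace_closed cspace_smult_r_distr cspace_smult_assoc[symmetric]
      mult.commute)

text \<open>The axioms in \<open>cspaceI\<close> are equations, so they pass to a set with operations that a vector space maps
  onto.\<close>

lemma cspace_image:
  fixes V :: "('v, 'g) rep" and X :: "('x, 'h) rep"
  assumes V: "cspace V"
    and carr: "carrier X = Q ` carrier V"
    and add: "\<And>x y. x \<in> carrier V \<Longrightarrow> y \<in> carrier V \<Longrightarrow> Q x \<oplus>\<^bsub>X\<^esub> Q y = Q (x \<oplus>\<^bsub>V\<^esub> y)"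
    and smult: "\<And>c x. x \<in> carrier V \<Longrightarrow> c \<odot>\<^bsub>X\<^esub> Q x = Q (c \<odot>\<^bsub>V\<^esub> x)"
    and zero: "\<zero>\<^bsub>X\<^esub> = Q \<zero>\<^bsub>V\<^esub>"
  shows "cspace X" and "Q \<in> lin V X"
proof -
  note c = cspace_closed[OF V]
  show "cspace X"
  proof (rule cspaceI, unfold carr)
    fix x y z assume "x \<in> Q ` carrier V" "y \<in> Q ` carrier V" "z \<in> Q ` carrier V"
    then show "x \<oplus>\<^bsub>X\<^esub> y \<oplus>\<^bsub>X\<^esub> z = x \<oplus>\<^bsub>X\<^esub> (y \<oplus>\<^bsub>X\<^esub> z)"
      using c cspace_assoc[OF V] by (auto simp: add)
  next
    fix x y assume "x \<in> Q ` carrier V" "y \<in> Q ` carrier V"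
    then show "x \<oplus>\<^bsub>X\<^esub> y = y \<oplus>\<^bsub>X\<^esub> x" using cspace_comm[OF V] by (auto simp: add)
  next
    fix x y and a :: complex assume "x \<in> Q ` carrier V" "y \<in> Q ` carrier V"
    then show "a \<odot>\<^bsub>X\<^esub> (x \<oplus>\<^bsub>X\<^esub> y) = a \<odot>\<^bsub>X\<^esub> x \<oplus>\<^bsub>X\<^esub> a \<odot>\<^bsub>X\<^esub> y"
      using c cspace_smult_r_distr[OF V] by (auto simp: add smult)
  qed (use c in \<open>auto simp: add smult zero cspace_smult_l_distr[OF V] cspace_smult_assoc[OF V]
        cspace_smult_one[OF V] cspace_smult_zero[OF V] cspace_zero_left[OF V]\<close>)
  show "Q \<in> lin V X" by (intro linI) (auto simp: carr add smult)
qed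

section \<open>Quotients\<close>

lemma submodule_closed:
  fixes V :: "('v, 'g) rep" and c :: complex
  assumes "submodule class_ring W V"
  shows "W \<subseteq> carrier V" "\<zero>\<^bsub>V\<^esub> \<in> W" "x \<in> W \<Longrightarrow> y \<in> W \<Longrightarrow> x \<oplus>\<^bsub>V\<^esub> y \<in> W"
    "x \<in> W \<Longrightarrow> c \<odot>\<^bsub>V\<^esub> x \<in> W"
  using assms by (auto simp: submodule_def)

lemma submoduleI:
  fixes V :: "('v, 'g) rep"
  assumes "cspace V" "W \<subseteq> carrier V" "\<zero>\<^bsub>V\<^esub> \<in> W" "\<And>x y. x \<in> W \<Longrightarrow> y \<in> W \<Longrightarrow> x \<oplus>\<^bsub>V\<^esub> y \<in> W"
    "\<And>(c::complex) x. x \<in> W \<Longrightarrow> c \<odot>\<^bsub>V\<^esub> x \<in> W"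
  shows "submodule class_ring W V"
  using assms by (auto simp: submodule_def vectorspace_def)

lemma span_submodule:
  fixes V :: "('v, 'g) rep"
  assumes "cspace V" "S \<subseteq> carrier V"
  shows "submodule class_ring (LinearCombinations.module.span (class_ring :: complex ring) V S) V"
  using assms by (simp add: vectorspace_def LinearCombinations.module.span_is_submodule)

lemma in_span:
  fixes V :: "('v, 'g) rep"
  assumes "cspace V" "S \<subseteq> carrier V" "s \<in> S"
  shows "s \<in> LinearCombinations.module.span (class_ring :: complex ring) V S"
  using assms LinearCombinations.module.in_own_span[of class_ring V S] by (auto simp: vectorspace_def)

lemma span_least:
  fixes V :: "('v, 'g) rep"
  assumes "cspace V" "submodule class_ring W V" "S \<subseteq> W"
  shows "LinearCombinations.module.span (class_ring :: complex ring) V S \<subseteq> W"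
  using assms LinearCombinations.module.span_is_subset[of class_ring V S W] by (auto simp: vectorspace_def)

text \<open>The kernel of \<open>T\<close>, and in the next lemma the preimage of the span under \<open>T\<close>, is a subspace that
  contains the generators.\<close>

lemma lin_vanish_span:
  assumes V: "cspace V" and W: "cspace W" and T: "T \<in> lin V W"
    and S: "S \<subseteq> carrier V" "\<And>s. s \<in> S \<Longrightarrow> T s = \<zero>\<^bsub>W\<^esub>"
    and v: "v \<in> LinearCombinations.module.span (class_ring :: complex ring) V S"
  shows "T v = \<zero>\<^bsub>W\<^esub>"
proof -
  have "submodule class_ring {v \<in> carrier V. T v = \<zero>\<^bsub>W\<^esub>} V"
    by (intro submoduleI[OF V]) (auto simp: cspace_closed V W lin_zero[OF V W T] lin_add[OF T]
        lin_smult[OF T] cspace_zero_left cspace_smult_zero_right)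
  from span_least[OF V this, of S] S v show ?thesis by auto
qed

lemma lin_stable_span:
  assumes V: "cspace V" and T: "T \<in> lin V V" and S: "S \<subseteq> carrier V" "\<And>s. s \<in> S \<Longrightarrow> T s \<in> S"
    and v: "v \<in> LinearCombinations.module.span (class_ring :: complex ring) V S"
  shows "T v \<in> LinearCombinations.module.span (class_ring :: complex ring) V S" (is "_ \<in> ?W")
proof -
  note W = submodule_closed[OF span_submodule[OF V S(1)]]
  have "submodule class_ring {v \<in> carrier V. T v \<in> ?W} V"
    by (intro submoduleI[OF V]) (auto simp: cspace_closed V lin_zero[OF V V T] lin_add[OF T]
        lin_smult[OF T] W)
  from span_least[OF V this, of S] S v in_span[OF V S(1)] show ?thesis by blast
qed

definition coset :: "('v, 'g) rep \<Rightarrow> 'v set \<Rightarrow> 'v \<Rightarrow> 'v set" where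
  "coset V W v = W +>\<^bsub>V\<^esub> v"

lemma coset_iff:
  "y \<in> coset V W v \<longleftrightarrow> (\<exists>w\<in>W. y = w \<oplus>\<^bsub>V\<^esub> v)"
  by (auto simp: coset_def a_r_coset_def')

context
  fixes V :: "('v, 'g) rep" and W :: "'v set"
  assumes V: "cspace V" and W: "submodule class_ring W V"
begin

private lemma W': "w \<in> W \<Longrightarrow> w \<in> carrier V" "\<zero>\<^bsub>V\<^esub> \<in> W" "x \<in> W \<Longrightarrow> y \<in> W \<Longrightarrow> x \<oplus>\<^bsub>V\<^esub> y \<in> W"
    "x \<in> W \<Longrightarrow> c \<odot>\<^bsub>V\<^esub> x \<in> W" for c :: complex
  using submodule_closed[OF W] by auto

lemma coset_eq_iff:
  assumes x: "x \<in> carrier V" and y: "y \<in> carrier V"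
  shows "coset V W x = coset V W y \<longleftrightarrow> x \<ominus>\<^bsub>V\<^esub> y \<in> W"
proof
  assume "coset V W x = coset V W y"
  moreover have "x \<in> coset V W x"
    using x by (auto simp: coset_iff cspace_zero_left V intro!: bexI[OF _ W'(2)])
  ultimately obtain w where w: "w \<in> W" "x = w \<oplus>\<^bsub>V\<^esub> y" by (auto simp: coset_iff)
  have "x \<ominus>\<^bsub>V\<^esub> y = w \<oplus>\<^bsub>V\<^esub> (y \<ominus>\<^bsub>V\<^esub> y)"
    using w W' y by (simp add: cspace_minus V cspace_assoc cspace_closed)
  then show "x \<ominus>\<^bsub>V\<^esub> y \<in> W" using w W' y
    by (simp add: cspace_minus_self V cspace_comm[OF V _ cspace_zero_closed[OF V]] cspace_zero_left)
next
  have *: "coset V W x \<subseteq> coset V W y" if x: "x \<in> carrier V" and y: "y \<in> carrier V"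
    and d: "x \<ominus>\<^bsub>V\<^esub> y \<in> W" for x y
  proof
    fix z assume "z \<in> coset V W x"
    then obtain w where w: "w \<in> W" "z = w \<oplus>\<^bsub>V\<^esub> x" by (auto simp: coset_iff)
    then have "z = (w \<oplus>\<^bsub>V\<^esub> (x \<ominus>\<^bsub>V\<^esub> y)) \<oplus>\<^bsub>V\<^esub> y"
      using x y W' by (simp add: cspace_assoc V cspace_closed cspace_minus_add)
    then show "z \<in> coset V W y" using w d W' by (auto simp: coset_iff)
  qed
  assume d: "x \<ominus>\<^bsub>V\<^esub> y \<in> W"
  have "y \<ominus>\<^bsub>V\<^esub> x = (-1) \<odot>\<^bsub>V\<^esub> (x \<ominus>\<^bsub>V\<^esub> y)"
    using x y cspace_comm[OF V] by (simp add: cspace_minus V cspace_closed cspace_smult_r_distr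
        cspace_smult_assoc[symmetric] cspace_smult_one)
  then have "y \<ominus>\<^bsub>V\<^esub> x \<in> W" using d W' by auto
  with d * x y show "coset V W x = coset V W y" by blast
qed

lemma coset_add:
  assumes x: "x \<in> carrier V" and y: "y \<in> carrier V"
  shows "coset V W x <+>\<^bsub>V\<^esub> coset V W y = coset V W (x \<oplus>\<^bsub>V\<^esub> y)"
proof (intro equalityI subsetI)
  fix z assume "z \<in> coset V W x <+>\<^bsub>V\<^esub> coset V W y"
  then obtain w w' where w: "w \<in> W" "w' \<in> W" "z = (w \<oplus>\<^bsub>V\<^esub> x) \<oplus>\<^bsub>V\<^esub> (w' \<oplus>\<^bsub>V\<^esub> y)"
    by (auto simp: coset_iff set_add_def')
  then have "z = (w \<oplus>\<^bsub>V\<^esub> w') \<oplus>\<^bsub>V\<^esub> (x \<oplus>\<^bsub>V\<^esub> y)"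
    using x y W' cspace_lcomm[OF V] by (simp add: cspace_assoc V cspace_closed)
  then show "z \<in> coset V W (x \<oplus>\<^bsub>V\<^esub> y)" using w W' by (auto simp: coset_iff)
next
  fix z assume "z \<in> coset V W (x \<oplus>\<^bsub>V\<^esub> y)"
  then obtain w where w: "w \<in> W" "z = w \<oplus>\<^bsub>V\<^esub> (x \<oplus>\<^bsub>V\<^esub> y)" by (auto simp: coset_iff)
  then have "z = (w \<oplus>\<^bsub>V\<^esub> x) \<oplus>\<^bsub>V\<^esub> (\<zero>\<^bsub>V\<^esub> \<oplus>\<^bsub>V\<^esub> y)"
    using x y W' by (simp add: cspace_assoc V cspace_closed cspace_zero_left)
  moreover have "w \<oplus>\<^bsub>V\<^esub> x \<in> coset V W x" "\<zero>\<^bsub>V\<^esub> \<oplus>\<^bsub>V\<^esub> y \<in> coset V W y"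
    using w W' by (auto simp: coset_iff)
  ultimately show "z \<in> coset V W x <+>\<^bsub>V\<^esub> coset V W y"
    unfolding set_add_def' by blast
qed

lemma coset_image:
  assumes T: "T \<in> lin V V" and TW: "\<And>w. w \<in> W \<Longrightarrow> T w \<in> W" and x: "x \<in> carrier V"
  shows "W <+>\<^bsub>V\<^esub> T ` coset V W x = coset V W (T x)"
proof (intro equalityI subsetI)
  fix z assume "z \<in> W <+>\<^bsub>V\<^esub> T ` coset V W x"
  then obtain w w' where w: "w \<in> W" "w' \<in> W" "z = w \<oplus>\<^bsub>V\<^esub> T (w' \<oplus>\<^bsub>V\<^esub> x)"
    by (auto simp: coset_iff set_add_def')
  then have "z = (w \<oplus>\<^bsub>V\<^esub> T w') \<oplus>\<^bsub>V\<^esub> T x"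
    using x W' by (simp add: lin_add[OF T] cspace_assoc V lin_closed[OF T])
  then show "z \<in> coset V W (T x)" using w W' TW by (auto simp: coset_iff)
next
  fix z assume "z \<in> coset V W (T x)"
  then obtain w where w: "w \<in> W" "z = w \<oplus>\<^bsub>V\<^esub> T x" by (auto simp: coset_iff)
  then have "z = w \<oplus>\<^bsub>V\<^esub> T (\<zero>\<^bsub>V\<^esub> \<oplus>\<^bsub>V\<^esub> x)" using x by (simp add: V cspace_zero_left)
  moreover have "\<zero>\<^bsub>V\<^esub> \<oplus>\<^bsub>V\<^esub> x \<in> coset V W x" using W' by (auto simp: coset_iff)
  ultimately show "z \<in> W <+>\<^bsub>V\<^esub> T ` coset V W x"
    using w unfolding set_add_def' by blast
qed

lemma coset_zero: "coset V W \<zero>\<^bsub>V\<^esub> = W"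
proof -
  have "w \<oplus>\<^bsub>V\<^esub> \<zero>\<^bsub>V\<^esub> = w" if "w \<in> W" for w
    using that W' by (metis V cspace_comm cspace_zero_closed cspace_zero_left)
  then show ?thesis by (auto simp: coset_iff set_eq_iff)
qed

lemma carrier_quotient: "carrier (quotient_rep V W) = coset V W ` carrier V"
  by (auto simp: quotient_rep_def A_RCOSETS_def' coset_def a_r_coset_def')

lemma quotient_cspace: "cspace (quotient_rep V W)"
  and coset_lin: "coset V W \<in> lin V (quotient_rep V W)"
proof -
  have sm: "W <+>\<^bsub>V\<^esub> (\<lambda>v. c \<odot>\<^bsub>V\<^esub> v) ` coset V W x = coset V W (c \<odot>\<^bsub>V\<^esub> x)"
    if "x \<in> carrier V" for c x
    by (rule coset_image[OF scaling_lin[OF V]]) (use that W' in auto)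
  have z: "\<zero>\<^bsub>quotient_rep V W\<^esub> = coset V W \<zero>\<^bsub>V\<^esub>"
    by (simp add: quotient_rep_def coset_zero)
  have a: "coset V W x \<oplus>\<^bsub>quotient_rep V W\<^esub> coset V W y = coset V W (x \<oplus>\<^bsub>V\<^esub> y)"
    if "x \<in> carrier V" "y \<in> carrier V" for x y
    using that by (simp add: quotient_rep_def coset_add)
  have s: "c \<odot>\<^bsub>quotient_rep V W\<^esub> coset V W x = coset V W (c \<odot>\<^bsub>V\<^esub> x)"
    if "x \<in> carrier V" for c x
    using that by (simp add: quotient_rep_def sm)
  show "cspace (quotient_rep V W)" by (rule cspace_image(1)[OF V carrier_quotient a s z])
  show "coset V W \<in> lin V (quotient_rep V W)" by (rule cspace_image(2)[OF V carrier_quotient a s z])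
qed

lemma coset_eq_zero_iff:
  "v \<in> carrier V \<Longrightarrow> coset V W v = \<zero>\<^bsub>quotient_rep V W\<^esub> \<longleftrightarrow> v \<in> W"
  using coset_eq_iff[of v "\<zero>\<^bsub>V\<^esub>"] coset_zero
  by (simp add: quotient_rep_def cspace_closed V cspace_minus cspace_smult_zero_right
      cspace_comm[OF V _ cspace_zero_closed] cspace_zero_left)

lemma quotient_act:
  assumes "act V g \<in> lin V V" "\<And>w. w \<in> W \<Longrightarrow> act V g w \<in> W" "x \<in> carrier V"
  shows "act (quotient_rep V W) g (coset V W x) = coset V W (act V g x)"
  using coset_image[OF assms] by (simp add: quotient_rep_def)

lemma quotient_factor:
  fixes U :: "('u, 'h) rep"
  assumes U: "cspace U" and T: "T \<in> lin V U" and ker: "\<And>w. w \<in> W \<Longrightarrow> T w = \<zero>\<^bsub>U\<^esub>"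
  obtains S where "S \<in> lin (quotient_rep V W) U" "\<And>v. v \<in> carrier V \<Longrightarrow> S (coset V W v) = T v"
proof
  define S where "S X = T (SOME v. v \<in> carrier V \<and> coset V W v = X)" for X
  show S: "S (coset V W v) = T v" if v: "v \<in> carrier V" for v
  proof -
    define v' where "v' = (SOME v'. v' \<in> carrier V \<and> coset V W v' = coset V W v)"
    have v': "v' \<in> carrier V \<and> coset V W v' = coset V W v"
      unfolding v'_def by (rule someI[of _ v]) (use v in auto)
    then have "v' \<ominus>\<^bsub>V\<^esub> v \<in> W" using coset_eq_iff v by auto
    then have "T v' \<ominus>\<^bsub>U\<^esub> T v = \<zero>\<^bsub>U\<^esub>" using ker lin_minus[OF V U T, of v' v] v v' by auto
    then have "T v' = T v" using cspace_eqI[OF U] v v' lin_closed[OF T] by auto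
    then show ?thesis by (simp add: S_def v'_def)
  qed
  show "S \<in> lin (quotient_rep V W) U"
  proof (intro linI)
    fix x assume "x \<in> carrier (quotient_rep V W)"
    then show "S x \<in> carrier U" by (auto simp: carrier_quotient S lin_closed[OF T])
  next
    fix x y assume "x \<in> carrier (quotient_rep V W)" "y \<in> carrier (quotient_rep V W)"
    then show "S (x \<oplus>\<^bsub>quotient_rep V W\<^esub> y) = S x \<oplus>\<^bsub>U\<^esub> S y"
      by (auto simp: carrier_quotient S lin_add[OF T] lin_add[OF coset_lin, symmetric] cspace_closed V)
  next
    fix c x assume "x \<in> carrier (quotient_rep V W)"
    then show "S (c \<odot>\<^bsub>quotient_rep V W\<^esub> x) = c \<odot>\<^bsub>U\<^esub> S x"
      by (auto simp: carrier_quotient S lin_smult[OF T] lin_smult[OF coset_lin, symmetric] cspace_closed V)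
  qed
qed

end

section \<open>Constructions with representations\<close>

lemma representationI:
  assumes "group G" "cspace V" "\<And>g. g \<in> carrier G \<Longrightarrow> act V g \<in> lin V V"
    "\<And>v. v \<in> carrier V \<Longrightarrow> act V \<one>\<^bsub>G\<^esub> v = v"
    "\<And>g h v. g \<in> carrier G \<Longrightarrow> h \<in> carrier G \<Longrightarrow> v \<in> carrier V \<Longrightarrow>
      act V (g \<otimes>\<^bsub>G\<^esub> h) v = act V g (act V h v)"
  shows "representation G V"
  using assms by (auto simp: representation_def representation_axioms_def)

lemma representationD:
  assumes "representation G V"
  shows "group G" "cspace V" "g \<in> carrier G \<Longrightarrow> act V g \<in> lin V V"
    "v \<in> carrier V \<Longrightarrow> act V \<one>\<^bsub>G\<^esub> v = v"
    "g \<in> carrier G \<Longrightarrow> h \<in> carrier G \<Longrightarrow> v \<in> carrier V \<Longrightarrow>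
      act V (g \<otimes>\<^bsub>G\<^esub> h) v = act V g (act V h v)"
    "g \<in> carrier G \<Longrightarrow> v \<in> carrier V \<Longrightarrow> act V g v \<in> carrier V"
  using assms by (auto simp: representation_def representation_axioms_def lin_closed)

text \<open>An action on a quotient is often defined by a formula that makes sense only for group elements that
  preserve the relations. This lemma derives the axioms from those of the representation that is mapped
  onto it.\<close>

lemma representation_image:
  assumes V: "representation G V" and X: "cspace X" and Q: "Q \<in> lin V X"
    and surj: "carrier X = Q ` carrier V"
    and act: "\<And>g v. g \<in> carrier G \<Longrightarrow> v \<in> carrier V \<Longrightarrow> act X g (Q v) = Q (act V g v)"
  shows "representation G X"
proof (rule representationI)
  note V' = representationD[OF V]
  fix g assume g: "g \<in> carrier G"
  show "act X g \<in> lin X X"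
  proof (rule linI, unfold surj)
    fix x y assume "x \<in> Q ` carrier V" "y \<in> Q ` carrier V"
    then show "act X g (x \<oplus>\<^bsub>X\<^esub> y) = act X g x \<oplus>\<^bsub>X\<^esub> act X g y"
      using g by (auto simp: act lin_add[OF Q, symmetric] cspace_closed V' lin_add[OF V'(3)])
  next
    fix c x assume "x \<in> Q ` carrier V"
    then show "act X g (c \<odot>\<^bsub>X\<^esub> x) = c \<odot>\<^bsub>X\<^esub> act X g x"
      using g by (auto simp: act lin_smult[OF Q, symmetric] cspace_closed V' lin_smult[OF V'(3)])
  qed (use g in \<open>auto simp: act V'\<close>)
qed (use representationD[OF V] in \<open>auto simp: X surj act group.is_monoid monoid.m_closed
    group.subgroup_self subgroup.one_closed\<close>)

lemma representation_subgroup: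
  assumes "representation G V" "subgroup H G"
  shows "representation (G\<lparr>carrier := H\<rparr>) V"
proof (rule representationI)
  note V = representationD[OF assms(1)]
  note H = subgroup.mem_carrier[OF assms(2)]
  show "group (G\<lparr>carrier := H\<rparr>)" by (rule group.subgroup_imp_group[OF V(1) assms(2)])
  show "cspace V" by (rule V)
qed (use representationD[OF assms(1)] subgroup.mem_carrier[OF assms(2)] in simp_all)

lemma pullback_simps [simp]:
  "carrier (pullback \<phi> V) = carrier V" "zero (pullback \<phi> V) = \<zero>\<^bsub>V\<^esub>" "add (pullback \<phi> V) = add V"
  "smult (pullback \<phi> V) = smult V" "act (pullback \<phi> V) g = act V (\<phi> g)"
  by (auto simp: pullback_def)

lemma cspace_pullback: "cspace V \<Longrightarrow> cspace (pullback \<phi> V)"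
  by (rule cspace_image(1)[of V _ "\<lambda>v. v"]) auto

lemma lin_pullback [simp]:
  "lin (pullback \<phi> V) W = lin V W" "lin W (pullback \<phi> V) = lin W V"
  by (auto simp: LinearCombinations.module_hom_def)

lemma representation_pullback:
  assumes V: "representation G V" and H: "group H" and \<phi>: "\<phi> \<in> hom H G"
  shows "representation H (pullback \<phi> V)"
proof (rule representationI[OF H])
  have "\<phi> \<one>\<^bsub>H\<^esub> = \<one>\<^bsub>G\<^esub>"
    using group_hom.hom_one[of H G \<phi>] H \<phi> representationD(1)[OF V]
    by (simp add: group_hom_def group_hom_axioms_def)
  then show "act (pullback \<phi> V) \<one>\<^bsub>H\<^esub> v = v" if "v \<in> carrier (pullback \<phi> V)" for v
    using that representationD[OF V] by simp
  show "cspace (pullback \<phi> V)" by (intro cspace_pullback representationD[OF V])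
qed (use representationD(3,5)[OF V] \<phi> in \<open>simp_all add: hom_def Pi_iff\<close>)

lemma cspace_induced:
  assumes V: "cspace V" and G: "group G" and H: "H \<subseteq> carrier G"
    and act: "\<And>h. h \<in> H \<Longrightarrow> act V h \<in> lin V V"
  shows "cspace (induced_rep G H V)"
proof -
  have *: "h \<otimes>\<^bsub>G\<^esub> x \<in> carrier G" if "h \<in> H" "x \<in> carrier G" for h x
    using that G H by (auto intro: group.is_monoid monoid.m_closed)
  show ?thesis
    by (rule cspaceI)
      (auto simp: induced_rep_def V cspace_closed cspace_assoc cspace_zero_left cspace_smult_l_distr
        cspace_smult_r_distr cspace_smult_assoc cspace_smult_one cspace_smult_zero PiE_iff
        restrict_def extensional_def fun_eq_iff lin_add[OF act] lin_smult[OF act] lin_zero[OF V V act] *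
        cspace_comm[OF V])
qed

lemma representation_induced:
  assumes G: "group G" and H: "subgroup H G" and V: "representation (G\<lparr>carrier := H\<rparr>) V"
  shows "representation G (induced_rep G H V)"
proof (rule representationI[OF G])
  interpret group G by (rule G)
  note V' = representationD[OF V, simplified]
  show "cspace (induced_rep G H V)"
    using cspace_induced[OF V'(2) G] subgroup.subset[OF H] V'(3) by blast
  show "act (induced_rep G H V) g \<in> lin (induced_rep G H V) (induced_rep G H V)"
    if g: "g \<in> carrier G" for g
    by (rule linI) (use g subgroup.subset[OF H] in \<open>auto simp: induced_rep_def PiE_iff extensional_def
        fun_eq_iff m_assoc subset_iff\<close>)
qed (auto simp: induced_rep_def PiE_iff extensional_def fun_eq_iff group.is_monoid[OF G]
    monoid.m_assoc monoid.m_closed)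

lemma representation_direct_sum:
  assumes G: "group G" and V: "\<And>k. k \<in> K \<Longrightarrow> representation G (V k)"
  shows "representation G (direct_sum_rep K V)"
proof (rule representationI[OF G])
  note V' = representationD[OF V]
  show "cspace (direct_sum_rep K V)"
    by (rule cspaceI)
      (auto simp: direct_sum_rep_def V'(2) cspace_closed cspace_assoc cspace_zero_left
        cspace_smult_l_distr cspace_smult_r_distr cspace_smult_assoc cspace_smult_one
        cspace_smult_zero PiE_iff restrict_def extensional_def fun_eq_iff cspace_comm[OF V'(2)])
  show "act (direct_sum_rep K V) g \<in> lin (direct_sum_rep K V) (direct_sum_rep K V)"
    if g: "g \<in> carrier G" for g
    by (rule linI) (use g in \<open>auto simp: direct_sum_rep_def PiE_iff fun_eq_iff lin_add[OF V'(3)]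
      lin_smult[OF V'(3)] V'(6)\<close>)
qed (auto simp: direct_sum_rep_def representationD[OF V] PiE_iff fun_eq_iff extensional_def
      restrict_def)

section \<open>Tensor products\<close>

text \<open>Linear extension of a map between the index sets of two free vector spaces. The action on
  \<open>free_rep V W\<close> and the tensor product of two linear maps are both of this form.\<close>

definition push :: "('a \<Rightarrow> 'b) \<Rightarrow> ('a \<Rightarrow>\<^sub>0 complex) \<Rightarrow> ('b \<Rightarrow>\<^sub>0 complex)" where
  "push \<phi> f = (\<Sum>k\<in>Poly_Mapping.keys f. Poly_Mapping.single (\<phi> k) (Poly_Mapping.lookup f k))"

lemma push_superset:
  assumes "finite A" "Poly_Mapping.keys f \<subseteq> A"
  shows "push \<phi> f = (\<Sum>k\<in>A. Poly_Mapping.single (\<phi> k) (Poly_Mapping.lookup f k))"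
  unfolding push_def using assms
  by (intro sum.mono_neutral_left) (auto simp: in_keys_iff)

lemma push_add: "push \<phi> (f + g) = push \<phi> f + push \<phi> g"
proof -
  let ?A = "Poly_Mapping.keys f \<union> Poly_Mapping.keys g"
  have "Poly_Mapping.keys (f + g) \<subseteq> ?A" by (rule Poly_Mapping.keys_add)
  then show ?thesis
    by (simp add: push_superset[of ?A] lookup_add single_add sum.distrib)
qed

lemma push_single: "push \<phi> (Poly_Mapping.single k c) = Poly_Mapping.single (\<phi> k) c"
  by (simp add: push_superset[of "{k}"])

lemma push_diff: "push \<phi> (f - g) = push \<phi> f - push \<phi> g"
  using push_add[of \<phi> "f - g" g] by (simp add: algebra_simps)

lemma lookup_scale: "Poly_Mapping.lookup (Poly_Mapping.map ((*) c) f) k = c * Poly_Mapping.lookup f k"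
  for c :: complex
  by (simp add: Poly_Mapping.map.rep_eq when_def)

lemma keys_scale: "Poly_Mapping.keys (Poly_Mapping.map ((*) c) f) \<subseteq> Poly_Mapping.keys f"
  for c :: complex
  by (auto simp: in_keys_iff lookup_scale)

lemma scale_single: "Poly_Mapping.map ((*) c) (Poly_Mapping.single k d) = Poly_Mapping.single k (c * d)"
  for c :: complex
  by (rule poly_mapping_eqI) (simp add: lookup_scale lookup_single when_def)

lemma scale_add: "Poly_Mapping.map ((*) c) (f + g) = Poly_Mapping.map ((*) c) f + Poly_Mapping.map ((*) c) g"
  for c :: complex
  by (rule poly_mapping_eqI) (simp add: lookup_scale lookup_add algebra_simps)

lemma push_scale: "push \<phi> (Poly_Mapping.map ((*) c) f) = Poly_Mapping.map ((*) c) (push \<phi> f)"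
proof -
  have "Poly_Mapping.map ((*) c) (\<Sum>k\<in>A. Poly_Mapping.single (\<phi> k) (Poly_Mapping.lookup f k)) =
    (\<Sum>k\<in>A. Poly_Mapping.single (\<phi> k) (c * Poly_Mapping.lookup f k))" if "finite A" for A
    using that
  proof induction
    case empty
    show ?case by (rule poly_mapping_eqI) (simp add: lookup_scale)
  qed (simp add: scale_add scale_single)
  then show ?thesis
    by (simp add: push_superset[OF finite_keys keys_scale[of c f]] lookup_scale push_def[of \<phi> f])
qed

lemma free_rep_simps [simp]:
  "carrier (free_rep V W) = {f. Poly_Mapping.keys f \<subseteq> carrier V \<times> carrier W}"
  "zero (free_rep V W) = 0" "add (free_rep V W) = (+)"
  "smult (free_rep V W) = (\<lambda>c. Poly_Mapping.map ((*) c))"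
  by (auto simp: free_rep_def)

lemma free_rep_act: "act (free_rep V W) (g, h) = push (map_prod (act V g) (act W h))"
  by (auto simp: free_rep_def push_def fun_eq_iff case_prod_unfold map_prod_def intro!: sum.cong)

lemma cspace_free: "cspace (free_rep V W)"
proof (rule cspaceI)
  fix x y assume "x \<in> carrier (free_rep V W)" "y \<in> carrier (free_rep V W)"
  then show "x \<oplus>\<^bsub>free_rep V W\<^esub> y \<in> carrier (free_rep V W)"
    using Poly_Mapping.keys_add[of x y] by auto
next
  fix c and x assume "x \<in> carrier (free_rep V W)"
  then show "c \<odot>\<^bsub>free_rep V W\<^esub> x \<in> carrier (free_rep V W)" using keys_scale[of c x] by auto
qed (auto intro!: poly_mapping_eqI simp: lookup_scale lookup_add algebra_simps)

lemma minus_free: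
  assumes "x \<in> carrier (free_rep V W)" "y \<in> carrier (free_rep V W)"
  shows "x \<ominus>\<^bsub>free_rep V W\<^esub> y = x - y"
  using cspace_minus[OF cspace_free assms]
  by (auto intro!: poly_mapping_eqI simp: lookup_scale lookup_add lookup_minus)

lemma push_lin:
  assumes "\<phi> \<in> carrier V \<times> carrier W \<rightarrow> carrier V' \<times> carrier W'"
  shows "push \<phi> \<in> lin (free_rep V W) (free_rep V' W')"
proof (rule linI)
  fix f assume "f \<in> carrier (free_rep V W)"
  then have "Poly_Mapping.keys f \<subseteq> carrier V \<times> carrier W" by simp
  then have "\<phi> ` Poly_Mapping.keys f \<subseteq> carrier V' \<times> carrier W'"
    using assms by (blast dest: funcset_mem)
  moreover have "Poly_Mapping.keys (push \<phi> f) \<subseteq> \<phi> ` Poly_Mapping.keys f"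
    unfolding push_def by (rule order.trans[OF Poly_Mapping.keys_sum]) (auto split: if_splits)
  ultimately show "push \<phi> f \<in> carrier (free_rep V' W')" by auto
qed (simp_all add: push_add push_scale)

abbreviation tensor_relations :: "('v, 'g) rep \<Rightarrow> ('w, 'h) rep \<Rightarrow> ('v \<times> 'w \<Rightarrow>\<^sub>0 complex) set" where
  "tensor_relations V W \<equiv> LinearCombinations.module.span class_ring (free_rep V W) (bilinearity_relations V W)"

abbreviation tensor_class :: "('v, 'g) rep \<Rightarrow> ('w, 'h) rep \<Rightarrow> ('v \<times> 'w \<Rightarrow>\<^sub>0 complex) \<Rightarrow> ('v \<times> 'w \<Rightarrow>\<^sub>0 complex) set" where
  "tensor_class V W \<equiv> coset (free_rep V W) (tensor_relations V W)"

text \<open>The pure tensor of \<open>v\<close> and \<open>w\<close>.\<close>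

definition tens :: "('v, 'g) rep \<Rightarrow> ('w, 'h) rep \<Rightarrow> 'v \<Rightarrow> 'w \<Rightarrow> ('v \<times> 'w \<Rightarrow>\<^sub>0 complex) set" where
  "tens V W v w = tensor_class V W (basis_elt v w)"

lemma keys_diff_subset:
  fixes a b :: "'a \<Rightarrow>\<^sub>0 complex"
  assumes "Poly_Mapping.keys a \<subseteq> S" "Poly_Mapping.keys b \<subseteq> S"
  shows "Poly_Mapping.keys (a - b) \<subseteq> S"
  using assms Poly_Mapping.keys_diff[of a b] by auto

context
  fixes V :: "('v, 'g) rep" and W :: "('w, 'h) rep"
  assumes V: "cspace V" and W: "cspace W"
begin

lemma bilinearity_relations_subset: "bilinearity_relations V W \<subseteq> carrier (free_rep V W)"
proof
  have k: "Poly_Mapping.keys (Poly_Mapping.single (v, w) c) \<subseteq> carrier V \<times> carrier W"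
    if "v \<in> carrier V" "w \<in> carrier W" for v w and c :: complex
    using that by auto
  fix r assume "r \<in> bilinearity_relations V W"
  then show "r \<in> carrier (free_rep V W)"
    unfolding bilinearity_relations_def free_rep_simps mem_Collect_eq
    by (elim UnE CollectE exE conjE; hypsubst; intro keys_diff_subset k; simp add: V W cspace_closed)
qed

lemma tensor_relations_submodule: "submodule class_ring (tensor_relations V W) (free_rep V W)"
  by (rule span_submodule[OF cspace_free bilinearity_relations_subset])

lemma cspace_tensor: "cspace (tensor_rep V W)"
  unfolding tensor_rep_def by (rule quotient_cspace[OF cspace_free tensor_relations_submodule])

lemma basis_elt_carrier: "v \<in> carrier V \<Longrightarrow> w \<in> carrier W \<Longrightarrow>
    Poly_Mapping.single (v, w) c \<in> carrier (free_rep V W)"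
  by auto

lemma coset_eqI_relation:
  assumes "x - y \<in> bilinearity_relations V W" "x \<in> carrier (free_rep V W)" "y \<in> carrier (free_rep V W)"
  shows "tensor_class V W x = tensor_class V W y"
  using assms in_span[OF cspace_free bilinearity_relations_subset, of "x - y"]
  by (simp add: coset_eq_iff[OF cspace_free tensor_relations_submodule] minus_free del: free_rep_simps)

lemmas tensor_coset_lin =
  coset_lin[OF cspace_free tensor_relations_submodule, folded tensor_rep_def]

lemma tens_closed: "v \<in> carrier V \<Longrightarrow> w \<in> carrier W \<Longrightarrow> tens V W v w \<in> carrier (tensor_rep V W)"
  unfolding tens_def by (rule lin_closed[OF tensor_coset_lin]) (auto simp: basis_elt_carrier)

lemma tens_smult:
  assumes "v \<in> carrier V" "w \<in> carrier W"
  shows "c \<odot>\<^bsub>tensor_rep V W\<^esub> tens V W v w =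
    tensor_class V W (Poly_Mapping.single (v, w) c)"
  unfolding tens_def using lin_smult[OF tensor_coset_lin basis_elt_carrier[OF assms], of c 1]
  by (simp add: scale_single)

lemma tens_lin_left:
  assumes w: "w \<in> carrier W" shows "(\<lambda>v. tens V W v w) \<in> lin V (tensor_rep V W)"
proof (rule linI)
  fix x y assume x: "x \<in> carrier V" and y: "y \<in> carrier V"
  have "basis_elt (x \<oplus>\<^bsub>V\<^esub> y) w - (basis_elt x w + basis_elt y w) \<in> bilinearity_relations V W"
    unfolding bilinearity_relations_def diff_diff_eq[symmetric] using x y w by blast
  from coset_eqI_relation[OF this]
  show "tens V W (x \<oplus>\<^bsub>V\<^esub> y) w = tens V W x w \<oplus>\<^bsub>tensor_rep V W\<^esub> tens V W y w"
    using x y w lin_add[OF tensor_coset_lin basis_elt_carrier basis_elt_carrier, of x w y w 1 1]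
      cspace_add_closed[OF cspace_free basis_elt_carrier basis_elt_carrier, of x w y w 1 1]
    by (simp add: tens_def V cspace_closed)
next
  fix c x assume x: "x \<in> carrier V"
  have "basis_elt (c \<odot>\<^bsub>V\<^esub> x) w - Poly_Mapping.single (x, w) c \<in> bilinearity_relations V W"
    unfolding bilinearity_relations_def using x w by blast
  from coset_eqI_relation[OF this]
  show "tens V W (c \<odot>\<^bsub>V\<^esub> x) w = c \<odot>\<^bsub>tensor_rep V W\<^esub> tens V W x w"
    using x w by (simp add: tens_smult) (simp add: tens_def V cspace_closed)
qed (use w in \<open>auto intro: tens_closed\<close>)

lemma tens_lin_right:
  assumes v: "v \<in> carrier V" shows "(\<lambda>w. tens V W v w) \<in> lin W (tensor_rep V W)"
proof (rule linI)
  fix x y assume x: "x \<in> carrier W" and y: "y \<in> carrier W"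
  have "basis_elt v (x \<oplus>\<^bsub>W\<^esub> y) - (basis_elt v x + basis_elt v y) \<in> bilinearity_relations V W"
    unfolding bilinearity_relations_def diff_diff_eq[symmetric] using x y v by blast
  from coset_eqI_relation[OF this]
  show "tens V W v (x \<oplus>\<^bsub>W\<^esub> y) = tens V W v x \<oplus>\<^bsub>tensor_rep V W\<^esub> tens V W v y"
    using x y v lin_add[OF tensor_coset_lin basis_elt_carrier basis_elt_carrier, of v x v y 1 1]
      cspace_add_closed[OF cspace_free basis_elt_carrier basis_elt_carrier, of v x v y 1 1]
    by (simp add: tens_def W cspace_closed)
next
  fix c x assume x: "x \<in> carrier W"
  have "basis_elt v (c \<odot>\<^bsub>W\<^esub> x) - Poly_Mapping.single (v, x) c \<in> bilinearity_relations V W"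
    unfolding bilinearity_relations_def using x v by blast
  from coset_eqI_relation[OF this]
  show "tens V W v (c \<odot>\<^bsub>W\<^esub> x) = c \<odot>\<^bsub>tensor_rep V W\<^esub> tens V W v x"
    using x v by (simp add: tens_smult) (simp add: tens_def W cspace_closed)
qed (use v in \<open>auto intro: tens_closed\<close>)

text \<open>Pure tensors determine a linear map: every element of the free space is a sum of multiples of basis
  elements.\<close>

lemma tensor_lin_eqI:
  fixes U :: "('u, 'k) rep"
  assumes U: "cspace U" and S: "S \<in> lin (tensor_rep V W) U" and T: "T \<in> lin (tensor_rep V W) U"
    and eq: "\<And>v w. v \<in> carrier V \<Longrightarrow> w \<in> carrier W \<Longrightarrow> S (tens V W v w) = T (tens V W v w)"
    and t: "t \<in> carrier (tensor_rep V W)"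
  shows "S t = T t"
proof -
  let ?Q = "tensor_class V W"
  note Q = tensor_coset_lin
  have sum: "S (?Q (\<Sum>k\<in>A. Poly_Mapping.single k (a k))) = T (?Q (\<Sum>k\<in>A. Poly_Mapping.single k (a k)))
      \<and> (\<Sum>k\<in>A. Poly_Mapping.single k (a k)) \<in> carrier (free_rep V W)"
    if "finite A" "A \<subseteq> carrier V \<times> carrier W" for A and a :: "'v \<times> 'w \<Rightarrow> complex"
    using that
  proof (induction A)
    case empty
    have "S (?Q \<zero>\<^bsub>free_rep V W\<^esub>) = T (?Q \<zero>\<^bsub>free_rep V W\<^esub>)"
      by (simp only: lin_zero[OF cspace_free cspace_tensor Q] lin_zero[OF cspace_tensor U S]
          lin_zero[OF cspace_tensor U T])
    then show ?case by simp
  next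
    case (insert k A)
    obtain v w where k: "k = (v, w)" "v \<in> carrier V" "w \<in> carrier W" using insert.prems by auto
    let ?x = "Poly_Mapping.single k (a k)" and ?y = "\<Sum>k\<in>A. Poly_Mapping.single k (a k)"
    have x: "?x \<in> carrier (free_rep V W)" and y: "?y \<in> carrier (free_rep V W)"
      using basis_elt_carrier k insert by auto
    have "S (?Q ?x) = T (?Q ?x)"
      unfolding k(1) tens_smult[OF k(2,3), symmetric]
      by (simp only: lin_smult[OF S tens_closed[OF k(2,3)]] lin_smult[OF T tens_closed[OF k(2,3)]] eq[OF k(2,3)])
    moreover have "S (?Q ?y) = T (?Q ?y)" using insert by auto
    ultimately have "S (?Q (?x + ?y)) = T (?Q (?x + ?y))"
      using lin_add[OF Q x y] lin_add[OF S lin_closed[OF Q x] lin_closed[OF Q y]]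
        lin_add[OF T lin_closed[OF Q x] lin_closed[OF Q y]] by simp
    moreover have "?x + ?y \<in> carrier (free_rep V W)"
      using cspace_add_closed[OF cspace_free x y] by simp
    ultimately show ?case using insert.hyps by simp
  qed
  obtain f where f: "f \<in> carrier (free_rep V W)" "t = ?Q f"
    using t unfolding tensor_rep_def carrier_quotient[OF cspace_free tensor_relations_submodule] by auto
  have "f = (\<Sum>k\<in>Poly_Mapping.keys f. Poly_Mapping.single k (Poly_Mapping.lookup f k))"
    by (rule poly_mapping_eqI)
      (simp add: lookup_sum lookup_single when_def in_keys_iff if_distrib sum.delta)
  then show ?thesis using sum[OF finite_keys, of f "Poly_Mapping.lookup f"] f by auto
qed

end

text \<open>Linear maps \<open>S\<close> and \<open>T\<close> send each bilinearity relation to a relation of the same kind.\<close>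

lemma push_relations:
  assumes V: "cspace V" and W: "cspace W" and V': "cspace V'" and W': "cspace W'"
    and S: "S \<in> lin V V'" and T: "T \<in> lin W W'"
    and f: "f \<in> tensor_relations V W"
  shows "push (map_prod S T) f \<in> tensor_relations V' W'"
proof -
  have P: "push (map_prod S T) \<in> lin (free_rep V W) (free_rep V' W')"
    by (rule push_lin) (auto simp: lin_closed[OF S] lin_closed[OF T])
  note C = lin_comp[OF tensor_coset_lin[OF V' W'] P]
  have rel: "push (map_prod S T) r \<in> bilinearity_relations V' W'" if "r \<in> bilinearity_relations V W" for r
    using that unfolding bilinearity_relations_def
    by (elim UnE CollectE exE conjE; simp only: push_diff push_single map_prod_simp lin_add[OF S]
        lin_add[OF T] lin_smult[OF S] lin_smult[OF T])
      (use lin_closed[OF S] lin_closed[OF T] in blast)+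
  have "tensor_class V' W' (push (map_prod S T) f) = \<zero>\<^bsub>tensor_rep V' W'\<^esub>"
  proof (rule lin_vanish_span[OF cspace_free cspace_tensor[OF V' W'] C bilinearity_relations_subset[OF V W] _ f])
    fix r assume r: "r \<in> bilinearity_relations V W"
    then have "push (map_prod S T) r \<in> tensor_relations V' W'"
      using in_span[OF cspace_free bilinearity_relations_subset[OF V' W'] rel] by blast
    then show "tensor_class V' W' (push (map_prod S T) r) = \<zero>\<^bsub>tensor_rep V' W'\<^esub>"
      using coset_eq_zero_iff[OF cspace_free tensor_relations_submodule[OF V' W']]
        lin_closed[OF P] bilinearity_relations_subset[OF V W] r unfolding tensor_rep_def by blast
  qed
  moreover have "f \<in> carrier (free_rep V W)"
    using f submodule_closed(1)[OF tensor_relations_submodule[OF V W]] by blast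
  ultimately show ?thesis
    using coset_eq_zero_iff[OF cspace_free tensor_relations_submodule[OF V' W']] lin_closed[OF P]
    unfolding tensor_rep_def by blast
qed

text \<open>The tensor product of two linear maps.\<close>

lemma tensor_map:
  assumes V: "cspace V" and W: "cspace W" and V': "cspace V'" and W': "cspace W'"
    and S: "S \<in> lin V V'" and T: "T \<in> lin W W'"
  obtains R where "R \<in> lin (tensor_rep V W) (tensor_rep V' W')"
    "\<And>v w. v \<in> carrier V \<Longrightarrow> w \<in> carrier W \<Longrightarrow> R (tens V W v w) = tens V' W' (S v) (T w)"
proof -
  let ?Q = "tensor_class V' W'"
  have P: "push (map_prod S T) \<in> lin (free_rep V W) (free_rep V' W')"
    by (rule push_lin) (auto simp: lin_closed[OF S] lin_closed[OF T])
  note C = lin_comp[OF tensor_coset_lin[OF V' W'] P]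
  have "?Q (push (map_prod S T) f) = \<zero>\<^bsub>tensor_rep V' W'\<^esub>" if "f \<in> tensor_relations V W" for f
    using push_relations[OF assms that]  coset_eq_zero_iff[OF cspace_free tensor_relations_submodule[OF V' W']]
      submodule_closed(1)[OF tensor_relations_submodule[OF V' W']] unfolding tensor_rep_def by blast
  from quotient_factor[OF cspace_free tensor_relations_submodule[OF V W] cspace_tensor[OF V' W'] C this]
  obtain R where R: "R \<in> lin (tensor_rep V W) (tensor_rep V' W')"
    "\<And>f. f \<in> carrier (free_rep V W) \<Longrightarrow>
      R (tensor_class V W f) = ?Q (push (map_prod S T) f)"
    unfolding tensor_rep_def by blast
  show thesis
    by (rule that[OF R(1)]) (simp add: tens_def R(2)[OF basis_elt_carrier[OF V W]] push_single)
qed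

lemma tensor_act:
  assumes V: "cspace V" and W: "cspace W" and g: "act V g \<in> lin V V" and h: "act W h \<in> lin W W"
  shows "act (tensor_rep V W) (g, h) \<in> lin (tensor_rep V W) (tensor_rep V W)"
    and "v \<in> carrier V \<Longrightarrow> w \<in> carrier W \<Longrightarrow>
      act (tensor_rep V W) (g, h) (tens V W v w) = tens V W (act V g v) (act W h w)"
proof -
  have P: "act (free_rep V W) (g, h) \<in> lin (free_rep V W) (free_rep V W)"
    unfolding free_rep_act by (rule push_lin) (auto simp: lin_closed[OF g] lin_closed[OF h])
  have rel: "act (free_rep V W) (g, h) f \<in> tensor_relations V W" if "f \<in> tensor_relations V W" for f
    unfolding free_rep_act by (rule push_relations[OF V W V W g h that])
  have q: "act (tensor_rep V W) (g, h) (tensor_class V W f) =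
      tensor_class V W (act (free_rep V W) (g, h) f)"
    if "f \<in> carrier (free_rep V W)" for f
    unfolding tensor_rep_def
    by (rule quotient_act[OF cspace_free tensor_relations_submodule[OF V W] P rel that])
  note Q = tensor_coset_lin[OF V W]
  have carr: "carrier (tensor_rep V W) = tensor_class V W ` carrier (free_rep V W)"
    unfolding tensor_rep_def by (rule carrier_quotient[OF cspace_free tensor_relations_submodule[OF V W]])
  show "act (tensor_rep V W) (g, h) (tens V W v w) = tens V W (act V g v) (act W h w)"
    if "v \<in> carrier V" "w \<in> carrier W"
    unfolding tens_def using q[OF basis_elt_carrier[OF V W that]] by (simp add: free_rep_act push_single)
  note c = cspace_closed[OF cspace_free[of V W]]
  show "act (tensor_rep V W) (g, h) \<in> lin (tensor_rep V W) (tensor_rep V W)"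
  proof (rule linI)
    fix x y assume "x \<in> carrier (tensor_rep V W)" "y \<in> carrier (tensor_rep V W)"
    then show "act (tensor_rep V W) (g, h) (x \<oplus>\<^bsub>tensor_rep V W\<^esub> y) =
        act (tensor_rep V W) (g, h) x \<oplus>\<^bsub>tensor_rep V W\<^esub> act (tensor_rep V W) (g, h) y"
      unfolding carr
      by (auto simp del: free_rep_simps simp: lin_add[OF Q, symmetric] c q lin_closed[OF P] lin_add[OF P])
  next
    fix a x assume "x \<in> carrier (tensor_rep V W)"
    then show "act (tensor_rep V W) (g, h) (a \<odot>\<^bsub>tensor_rep V W\<^esub> x) =
        a \<odot>\<^bsub>tensor_rep V W\<^esub> act (tensor_rep V W) (g, h) x"
      unfolding carr
      by (auto simp del: free_rep_simps simp: lin_smult[OF Q, symmetric] c q lin_closed[OF P] lin_smult[OF P])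
  qed (auto simp del: free_rep_simps simp: carr q lin_closed[OF P])
qed

lemma representation_tensor:
  assumes V: "representation G V" and W: "representation H W"
  shows "representation (G \<times>\<times> H) (tensor_rep V W)"
proof (rule representationI)
  note V' = representationD[OF V] and W' = representationD[OF W]
  note T = tensor_act[OF V'(2) W'(2) V'(3) W'(3)]
  show "group (G \<times>\<times> H)" by (rule DirProd_group[OF V'(1) W'(1)])
  show U: "cspace (tensor_rep V W)" by (rule cspace_tensor[OF V'(2) W'(2)])
  have one: "\<one>\<^bsub>G\<^esub> \<in> carrier G" "\<one>\<^bsub>H\<^esub> \<in> carrier H"
    using V' W' by (auto intro: group.is_monoid monoid.one_closed)
  show "act (tensor_rep V W) x \<in> lin (tensor_rep V W) (tensor_rep V W)" if "x \<in> carrier (G \<times>\<times> H)" for x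
    using T(1) that by auto
  show "act (tensor_rep V W) \<one>\<^bsub>G \<times>\<times> H\<^esub> t = t" if t: "t \<in> carrier (tensor_rep V W)" for t
    unfolding one_DirProd
    by (rule tensor_lin_eqI[OF V'(2) W'(2) U T(1)[OF one] _ _ t, where T = "\<lambda>t. t"])
      (auto intro!: linI simp: T(2) one V' W')
  show "act (tensor_rep V W) (x \<otimes>\<^bsub>G \<times>\<times> H\<^esub> y) t = act (tensor_rep V W) x (act (tensor_rep V W) y t)"
    if "x \<in> carrier (G \<times>\<times> H)" "y \<in> carrier (G \<times>\<times> H)" and t: "t \<in> carrier (tensor_rep V W)" for x y t
  proof -
    obtain g h g' h' where x: "x = (g, h)" "y = (g', h')" by (metis surj_pair)
    have gh: "g \<in> carrier G" "h \<in> carrier H" "g' \<in> carrier G" "h' \<in> carrier H"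
      "g \<otimes>\<^bsub>G\<^esub> g' \<in> carrier G" "h \<otimes>\<^bsub>H\<^esub> h' \<in> carrier H"
      using that V' W' by (auto simp: x intro: group.is_monoid monoid.m_closed)
    show ?thesis unfolding x mult_DirProd
      by (rule tensor_lin_eqI[OF V'(2) W'(2) U T(1)[OF gh(5,6)] lin_comp[OF T(1)[OF gh(1,2)] T(1)[OF gh(3,4)]] _ t])
        (simp add: T(2) gh V' W')
  qed
qed

section \<open>Averaging over a finite subgroup\<close>

text \<open>The projection of \<open>V\<close> onto the vectors on which \<open>N\<close> acts through \<open>\<theta>\<close>, when \<open>N\<close> is a finite subgroup and \<open>\<theta>\<close> a character.\<close>

definition avg :: "('v, 'g) rep \<Rightarrow> 'g set \<Rightarrow> ('g \<Rightarrow> complex) \<Rightarrow> 'v \<Rightarrow> 'v" where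
  "avg V N \<theta> v = (1 / of_nat (card N)) \<odot>\<^bsub>V\<^esub> finsum V (\<lambda>u. inverse (\<theta> u) \<odot>\<^bsub>V\<^esub> act V u v) N"

lemma cspace_abelian_group: "cspace V \<Longrightarrow> abelian_group V"
  by (auto simp: vectorspace_def Module.module_def)

lemma cspace_abelian_monoid: "cspace V \<Longrightarrow> abelian_monoid V"
  by (auto dest: cspace_abelian_group simp: abelian_group_def)

lemma finsum_in_carrier:
  "cspace V \<Longrightarrow> (\<And>a. a \<in> A \<Longrightarrow> f a \<in> carrier V) \<Longrightarrow> finsum V f A \<in> carrier V"
  by (rule abelian_monoid.finsum_closed[OF cspace_abelian_monoid]) auto

lemma lin_finsum:
  assumes V: "cspace V" and W: "cspace W" and T: "T \<in> lin V W"
    and f: "\<And>a. a \<in> A \<Longrightarrow> f a \<in> carrier V"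
  shows "T (finsum V f A) = finsum W (\<lambda>a. T (f a)) A"
  using f
proof (induction A rule: infinite_finite_induct)
  case (infinite A)
  then show ?case by (simp add: abelian_monoid.finsum_infinite cspace_abelian_monoid V W lin_zero[OF V W T])
next
  case empty
  then show ?case by (simp add: abelian_monoid.finsum_empty cspace_abelian_monoid V W lin_zero[OF V W T])
next
  case (insert a A)
  then show ?case
    by (simp add: abelian_monoid.finsum_insert[OF cspace_abelian_monoid[OF V]] Pi_iff
        abelian_monoid.finsum_insert[OF cspace_abelian_monoid[OF W]] lin_closed[OF T] lin_add[OF T]
        finsum_in_carrier[OF V])
qed

lemma finsum_const:
  assumes V: "cspace V" and v: "v \<in> carrier V" and "finite A"
  shows "finsum V (\<lambda>_. v) A = of_nat (card A) \<odot>\<^bsub>V\<^esub> v"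
  using \<open>finite A\<close>
proof (induction A)
  case empty
  then show ?case
    by (simp add: abelian_monoid.finsum_empty cspace_abelian_monoid V cspace_smult_zero v)
next
  case (insert a A)
  then show ?case
    by (simp add: abelian_monoid.finsum_insert[OF cspace_abelian_monoid[OF V]] Pi_iff v
        cspace_smult_l_distr V cspace_smult_one)
qed

lemma finsum_permute:
  assumes V: "cspace V" and N: "finite N" and inj: "inj_on \<phi> N" and im: "\<phi> ` N \<subseteq> N"
    and f: "\<And>y. y \<in> N \<Longrightarrow> f y \<in> carrier V"
  shows "finsum V (\<lambda>y. f (\<phi> y)) N = finsum V f N"
proof -
  have "\<phi> ` N = N" using N inj im by (simp add: endo_inj_surj)
  then show ?thesis
    using abelian_monoid.finsum_reindex[OF cspace_abelian_monoid[OF V] _ inj, of f] f by (auto simp: Pi_iff)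
qed

lemma avg_closed:
  assumes "cspace V" "\<And>u. u \<in> N \<Longrightarrow> act V u v \<in> carrier V"
  shows "avg V N \<theta> v \<in> carrier V"
  unfolding avg_def using assms by (intro cspace_smult_closed finsum_in_carrier) auto

text \<open>Averages are natural; applied to suitable maps this gives most of their properties.\<close>

lemma avg_map:
  assumes V: "cspace V" and W: "cspace W" and T: "T \<in> lin V W"
    and act: "\<And>u. u \<in> N \<Longrightarrow> act V u v \<in> carrier V"
    and comm: "\<And>u. u \<in> N \<Longrightarrow> T (act V u v) = act W u (T v)"
  shows "T (avg V N \<theta> v) = avg W N \<theta> (T v)"
proof -
  have "T (finsum V (\<lambda>u. inverse (\<theta> u) \<odot>\<^bsub>V\<^esub> act V u v) N) =
      finsum W (\<lambda>u. T (inverse (\<theta> u) \<odot>\<^bsub>V\<^esub> act V u v)) N"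
    by (rule lin_finsum[OF V W T]) (simp add: act cspace_closed V)
  also have "\<dots> = finsum W (\<lambda>u. inverse (\<theta> u) \<odot>\<^bsub>W\<^esub> act W u (T v)) N"
    using lin_closed[OF T act] by (intro abelian_monoid.finsum_cong'[OF cspace_abelian_monoid[OF W]])
      (auto simp: lin_smult[OF T] act comm cspace_closed W)
  finally show ?thesis
    unfolding avg_def by (simp add: lin_smult[OF T] finsum_in_carrier act cspace_closed V)
qed

lemma avg_fixed:
  assumes V: "cspace V" and v: "v \<in> carrier V" and N: "finite N" "N \<noteq> {}"
    and act: "\<And>u. u \<in> N \<Longrightarrow> act V u v = \<theta> u \<odot>\<^bsub>V\<^esub> v" and \<theta>: "\<And>u. u \<in> N \<Longrightarrow> \<theta> u \<noteq> 0"
  shows "avg V N \<theta> v = v"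
proof -
  have "finsum V (\<lambda>u. inverse (\<theta> u) \<odot>\<^bsub>V\<^esub> act V u v) N = finsum V (\<lambda>_. v) N"
    using v by (intro abelian_monoid.finsum_cong'[OF cspace_abelian_monoid[OF V]])
      (auto simp: act \<theta> cspace_smult_assoc[OF V, symmetric] cspace_smult_one V)
  then show ?thesis
    using N v by (simp add: avg_def finsum_const V cspace_smult_assoc[symmetric] cspace_smult_one)
qed

abbreviation twist_relations :: "('v, 'g) rep \<Rightarrow> 'g set \<Rightarrow> ('g \<Rightarrow> complex) \<Rightarrow> 'v set" where
  "twist_relations V N \<theta> \<equiv> {act V u v \<ominus>\<^bsub>V\<^esub> (\<theta> u \<odot>\<^bsub>V\<^esub> v) | u v. u \<in> N \<and> v \<in> carrier V}"

abbreviation twist_span :: "('v, 'g) rep \<Rightarrow> 'g set \<Rightarrow> ('g \<Rightarrow> complex) \<Rightarrow> 'v set" where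
  "twist_span V N \<theta> \<equiv> LinearCombinations.module.span class_ring V (twist_relations V N \<theta>)"

definition finite_character :: "('g, 'x) monoid_scheme \<Rightarrow> 'g set \<Rightarrow> ('g \<Rightarrow> complex) \<Rightarrow> bool" where
  "finite_character G N \<theta> \<longleftrightarrow> subgroup N G \<and> finite N \<and>
     (\<forall>u\<in>N. \<forall>u'\<in>N. \<theta> (u \<otimes>\<^bsub>G\<^esub> u') = \<theta> u * \<theta> u') \<and> (\<forall>u\<in>N. \<theta> u \<noteq> 0)"

definition normalizes :: "('g, 'x) monoid_scheme \<Rightarrow> 'g set \<Rightarrow> ('g \<Rightarrow> complex) \<Rightarrow> 'g \<Rightarrow> bool" where
  "normalizes G N \<theta> g \<longleftrightarrow> g \<in> carrier G \<and>
     (\<forall>u\<in>N. g \<otimes>\<^bsub>G\<^esub> u \<otimes>\<^bsub>G\<^esub> inv\<^bsub>G\<^esub> g \<in> N \<and> \<theta> (g \<otimes>\<^bsub>G\<^esub> u \<otimes>\<^bsub>G\<^esub> inv\<^bsub>G\<^esub> g) = \<theta> u)"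

context
  fixes G :: "('g, 'x) monoid_scheme" and V :: "('v, 'g) rep" and N :: "'g set" and \<theta> :: "'g \<Rightarrow> complex"
  assumes V: "representation G V" and char: "finite_character G N \<theta>"
begin

private lemma N: "subgroup N G" and fin: "finite N"
  and \<theta>_mult: "u \<in> N \<Longrightarrow> u' \<in> N \<Longrightarrow> \<theta> (u \<otimes>\<^bsub>G\<^esub> u') = \<theta> u * \<theta> u'"
  and \<theta>_nonzero: "u \<in> N \<Longrightarrow> \<theta> u \<noteq> 0"
  using char by (auto simp: finite_character_def)

private lemma cV: "cspace V" and NG: "u \<in> N \<Longrightarrow> u \<in> carrier G"
  and av: "u \<in> N \<Longrightarrow> act V u \<in> lin V V"  and ac: "u \<in> N \<Longrightarrow> v \<in> carrier V \<Longrightarrow> act V u v \<in> carrier V"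
  using representationD[OF V] subgroup.mem_carrier[OF N] by auto

lemma avg_lin: "avg V N \<theta> \<in> lin V V"
proof (rule linI)
  show "avg V N \<theta> x \<in> carrier V" if "x \<in> carrier V" for x
    using avg_closed[OF cV ac] that by blast
  show "avg V N \<theta> (c \<odot>\<^bsub>V\<^esub> x) = c \<odot>\<^bsub>V\<^esub> avg V N \<theta> x" if "x \<in> carrier V" for c x
    by (rule avg_map[OF cV cV scaling_lin[OF cV], symmetric])
      (use that in \<open>auto simp: ac lin_smult[OF av]\<close>)
  show "avg V N \<theta> (x \<oplus>\<^bsub>V\<^esub> y) = avg V N \<theta> x \<oplus>\<^bsub>V\<^esub> avg V N \<theta> y"
    if x: "x \<in> carrier V" and y: "y \<in> carrier V" for x y
  proof -
    note M = cspace_abelian_monoid[OF cV]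
    have "finsum V (\<lambda>u. inverse (\<theta> u) \<odot>\<^bsub>V\<^esub> act V u (x \<oplus>\<^bsub>V\<^esub> y)) N =
      finsum V (\<lambda>u. inverse (\<theta> u) \<odot>\<^bsub>V\<^esub> act V u x \<oplus>\<^bsub>V\<^esub> inverse (\<theta> u) \<odot>\<^bsub>V\<^esub> act V u y) N"
      using x y by (intro abelian_monoid.finsum_cong'[OF M])
        (auto simp: lin_add[OF av] ac cspace_smult_r_distr cV cspace_closed)
    also have "\<dots> = finsum V (\<lambda>u. inverse (\<theta> u) \<odot>\<^bsub>V\<^esub> act V u x) N \<oplus>\<^bsub>V\<^esub>
        finsum V (\<lambda>u. inverse (\<theta> u) \<odot>\<^bsub>V\<^esub> act V u y) N"
      using x y by (intro abelian_monoid.finsum_addf[OF M]) (auto simp: ac cspace_closed cV)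
    finally show ?thesis
      using x y by (simp add: avg_def cspace_smult_r_distr cV finsum_in_carrier ac cspace_closed)
  qed
qed

lemma \<theta>_one: "\<theta> \<one>\<^bsub>G\<^esub> = 1"
proof -
  have "\<one>\<^bsub>G\<^esub> \<in> N" by (rule subgroup.one_closed[OF N])
  then show ?thesis
    using \<theta>_mult[of "\<one>\<^bsub>G\<^esub>" "\<one>\<^bsub>G\<^esub>"] \<theta>_nonzero[of "\<one>\<^bsub>G\<^esub>"] group.is_monoid[OF representationD(1)[OF V]]
    by (simp add: monoid.r_one monoid.one_closed)
qed

lemma act_avg:
  assumes u: "u \<in> N" and v: "v \<in> carrier V"
  shows "act V u (avg V N \<theta> v) = \<theta> u \<odot>\<^bsub>V\<^esub> avg V N \<theta> v"
proof -
  interpret group G by (rule representationD(1)[OF V])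
  note M = cspace_abelian_monoid[OF cV]
  let ?s = "\<lambda>u. inverse (\<theta> u) \<odot>\<^bsub>V\<^esub> act V u v"
  have c: "\<theta> u * (inverse (\<theta> u) * x) = x" "\<theta> u * (x * inverse (\<theta> u)) = x" for x
    using \<theta>_nonzero[OF u] by simp_all
  have inj: "inj_on (\<lambda>y. u \<otimes>\<^bsub>G\<^esub> y) N" using u NG by (auto intro!: inj_onI)
  have im: "(\<lambda>y. u \<otimes>\<^bsub>G\<^esub> y) ` N \<subseteq> N" using u by (auto intro: subgroup.m_closed[OF N])
  have "act V u (finsum V ?s N) = finsum V (\<lambda>y. act V u (?s y)) N"
    using v by (intro lin_finsum[OF cV cV av[OF u]]) (auto simp: ac cspace_closed cV)
  also have "\<dots> = finsum V (\<lambda>y. \<theta> u \<odot>\<^bsub>V\<^esub> ?s (u \<otimes>\<^bsub>G\<^esub> y)) N"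
    using v u \<theta>_nonzero NG
    by (intro abelian_monoid.finsum_cong'[OF M])
      (auto simp: c ac cspace_closed cV lin_smult[OF av] representationD(5)[OF V] \<theta>_mult
        cspace_smult_assoc[OF cV, symmetric] subgroup.m_closed[OF N])
  also have "\<dots> = \<theta> u \<odot>\<^bsub>V\<^esub> finsum V (\<lambda>y. ?s (u \<otimes>\<^bsub>G\<^esub> y)) N"
    using v u by (intro lin_finsum[OF cV cV scaling_lin[OF cV], symmetric])
      (auto simp: ac cspace_closed cV subgroup.m_closed[OF N])
  also have "finsum V (\<lambda>y. ?s (u \<otimes>\<^bsub>G\<^esub> y)) N = finsum V ?s N"
    by (rule finsum_permute[OF cV fin inj im]) (simp add: v ac cspace_closed cV)
  finally have "act V u (finsum V ?s N) = \<theta> u \<odot>\<^bsub>V\<^esub> finsum V ?s N" .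
  then show ?thesis
    using finsum_in_carrier[OF cV, of N ?s] v
    by (simp add: avg_def lin_smult[OF av[OF u]] cspace_smult_assoc[OF cV, symmetric] ac cspace_closed
        cV mult.commute)
qed

lemma avg_fixed':
  assumes "v \<in> carrier V" "\<And>u. u \<in> N \<Longrightarrow> act V u v = \<theta> u \<odot>\<^bsub>V\<^esub> v"
  shows "avg V N \<theta> v = v"
  by (rule avg_fixed[OF cV assms(1) fin _ assms(2) \<theta>_nonzero]) (use subgroup.one_closed[OF N] in auto)

lemma avg_act:
  assumes u: "u \<in> N" and v: "v \<in> carrier V"
  shows "avg V N \<theta> (act V u v) = \<theta> u \<odot>\<^bsub>V\<^esub> avg V N \<theta> v"
proof -
  interpret group G by (rule representationD(1)[OF V])
  note M = cspace_abelian_monoid[OF cV]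
  let ?s = "\<lambda>u. inverse (\<theta> u) \<odot>\<^bsub>V\<^esub> act V u v"
  have c: "\<theta> u * (inverse (\<theta> u) * x) = x" "\<theta> u * (x * inverse (\<theta> u)) = x" for x
    using \<theta>_nonzero[OF u] by simp_all
  have inj: "inj_on (\<lambda>y. y \<otimes>\<^bsub>G\<^esub> u) N" using u NG by (auto intro!: inj_onI)
  have im: "(\<lambda>y. y \<otimes>\<^bsub>G\<^esub> u) ` N \<subseteq> N" using u by (auto intro: subgroup.m_closed[OF N])
  have "finsum V (\<lambda>y. inverse (\<theta> y) \<odot>\<^bsub>V\<^esub> act V y (act V u v)) N =
      finsum V (\<lambda>y. \<theta> u \<odot>\<^bsub>V\<^esub> ?s (y \<otimes>\<^bsub>G\<^esub> u)) N"
    using v u \<theta>_nonzero NG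
    by (intro abelian_monoid.finsum_cong'[OF M])
      (auto simp: c ac cspace_closed cV representationD(5)[OF V] \<theta>_mult
        cspace_smult_assoc[OF cV, symmetric] subgroup.m_closed[OF N])
  also have "\<dots> = \<theta> u \<odot>\<^bsub>V\<^esub> finsum V (\<lambda>y. ?s (y \<otimes>\<^bsub>G\<^esub> u)) N"
    using v u by (intro lin_finsum[OF cV cV scaling_lin[OF cV], symmetric])
      (auto simp: ac cspace_closed cV subgroup.m_closed[OF N])
  also have "finsum V (\<lambda>y. ?s (y \<otimes>\<^bsub>G\<^esub> u)) N = finsum V ?s N"
    by (rule finsum_permute[OF cV fin inj im]) (simp add: v ac cspace_closed cV)
  finally have "finsum V (\<lambda>y. inverse (\<theta> y) \<odot>\<^bsub>V\<^esub> act V y (act V u v)) N = \<theta> u \<odot>\<^bsub>V\<^esub> finsum V ?s N" .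
  then show ?thesis
    using finsum_in_carrier[OF cV, of N ?s] v
    by (simp add: avg_def cspace_smult_assoc[OF cV, symmetric] ac cspace_closed cV mult.commute)
qed

lemma twist_relations_subset: "twist_relations V N \<theta> \<subseteq> carrier V"
  by (auto simp: cspace_closed cV ac)

lemma twist_submodule: "submodule class_ring (twist_span V N \<theta>) V"
  by (rule span_submodule[OF cV twist_relations_subset])

lemma avg_vanish: "v \<in> (twist_span V N \<theta>) \<Longrightarrow> avg V N \<theta> v = \<zero>\<^bsub>V\<^esub>"
proof (rule lin_vanish_span[OF cV cV avg_lin twist_relations_subset])
  fix s assume "s \<in> twist_relations V N \<theta>"
  then obtain u v where u: "u \<in> N" and v: "v \<in> carrier V" and s: "s = act V u v \<ominus>\<^bsub>V\<^esub> (\<theta> u \<odot>\<^bsub>V\<^esub> v)"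
    by blast
  show "avg V N \<theta> s = \<zero>\<^bsub>V\<^esub>"
    unfolding s using u v lin_closed[OF avg_lin v]
    by (simp add: lin_minus[OF cV cV avg_lin] ac cspace_closed cV avg_act lin_smult[OF avg_lin]
        cspace_minus_self)
qed

lemma coinvariant_act:
  assumes "u \<in> N" "v \<in> carrier V"
  shows "coset V (twist_span V N \<theta>) (act V u v) = \<theta> u \<odot>\<^bsub>quotient_rep V (twist_span V N \<theta>)\<^esub> coset V (twist_span V N \<theta>) v"
proof -
  have "act V u v \<ominus>\<^bsub>V\<^esub> (\<theta> u \<odot>\<^bsub>V\<^esub> v) \<in> (twist_span V N \<theta>)"
    by (rule in_span[OF cV twist_relations_subset]) (use assms in blast)
  then have "coset V (twist_span V N \<theta>) (act V u v) = coset V (twist_span V N \<theta>) (\<theta> u \<odot>\<^bsub>V\<^esub> v)"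
    using assms by (simp add: coset_eq_iff[OF cV twist_submodule] ac cspace_closed cV)
  then show ?thesis
    using lin_smult[OF coset_lin[OF cV twist_submodule] assms(2)] by simp
qed

text \<open>On the coinvariants \<open>N\<close> acts through \<open>\<theta>\<close>, so averaging there is the identity; averaging commutes
  with the quotient map.\<close>

lemma coinvariant_avg:
  assumes v: "v \<in> carrier V"
  shows "coset V (twist_span V N \<theta>) (avg V N \<theta> v) = coset V (twist_span V N \<theta>) v"
proof -
  define X where "X = quotient_rep V (twist_span V N \<theta>) \<lparr>act := \<lambda>u x. \<theta> u \<odot>\<^bsub>quotient_rep V (twist_span V N \<theta>)\<^esub> x\<rparr>"
  note Q = quotient_cspace[OF cV twist_submodule] coset_lin[OF cV twist_submodule]
  have X: "cspace X" "coset V (twist_span V N \<theta>) \<in> lin V X"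
    by (rule cspace_image[OF Q(1), of X "\<lambda>x. x"]; simp add: X_def)
      (use Q(2) in \<open>simp add: X_def LinearCombinations.module_hom_def\<close>)
  have "coset V (twist_span V N \<theta>) (avg V N \<theta> v) = avg X N \<theta> (coset V (twist_span V N \<theta>) v)"
    by (rule avg_map[OF cV X]) (use v in \<open>auto simp: ac X_def coinvariant_act\<close>)
  also have "\<dots> = coset V (twist_span V N \<theta>) v"
    by (rule avg_fixed[OF X(1) lin_closed[OF X(2) v] fin _ _ \<theta>_nonzero])
      (use subgroup.one_closed[OF N] in \<open>auto simp: X_def\<close>)
  finally show ?thesis .
qed

text \<open>Averaging turns the quotient by the relations into the subspace of \<open>\<theta>\<close>-equivariant vectors.\<close>

lemma twist_span_iff:
  assumes v: "v \<in> carrier V"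
  shows "v \<in> twist_span V N \<theta> \<longleftrightarrow> avg V N \<theta> v = \<zero>\<^bsub>V\<^esub>"
proof
  assume "avg V N \<theta> v = \<zero>\<^bsub>V\<^esub>"
  then have "coset V (twist_span V N \<theta>) v = \<zero>\<^bsub>quotient_rep V (twist_span V N \<theta>)\<^esub>"
    using coinvariant_avg[OF v]
      lin_zero[OF cV quotient_cspace[OF cV twist_submodule] coset_lin[OF cV twist_submodule]]
    by simp
  then show "v \<in> twist_span V N \<theta>"
    using coset_eq_zero_iff[OF cV twist_submodule v] by simp
qed (rule avg_vanish)

lemma coinvariant_section:
  obtains j where "j \<in> lin (twisted_coinvariants V N \<theta>) V"
    "\<And>v. v \<in> carrier V \<Longrightarrow> j (coset V (twist_span V N \<theta>) v) = avg V N \<theta> v"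
  using quotient_factor[OF cV twist_submodule cV avg_lin avg_vanish]
  unfolding twisted_coinvariants_def by blast

text \<open>An element that normalizes \<open>N\<close> and \<open>\<theta>\<close> sends the relation of \<open>u\<close> and \<open>v\<close> to that of the conjugate of
  \<open>u\<close> and the translate of \<open>v\<close>.\<close>

lemma twist_span_stable:
  assumes norm: "normalizes G N \<theta> g" and v: "v \<in> twist_span V N \<theta>"
  shows "act V g v \<in> twist_span V N \<theta>"
proof -
  have g: "g \<in> carrier G"
    and norm: "\<And>u. u \<in> N \<Longrightarrow> g \<otimes>\<^bsub>G\<^esub> u \<otimes>\<^bsub>G\<^esub> inv\<^bsub>G\<^esub> g \<in> N"
      "\<And>u. u \<in> N \<Longrightarrow> \<theta> (g \<otimes>\<^bsub>G\<^esub> u \<otimes>\<^bsub>G\<^esub> inv\<^bsub>G\<^esub> g) = \<theta> u"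
    using norm by (auto simp: normalizes_def)
  show ?thesis
proof (rule lin_stable_span[OF cV representationD(3)[OF V g] twist_relations_subset _ v])
    interpret group G by (rule representationD(1)[OF V])
    note ag = representationD(3)[OF V g]
    fix s assume "s \<in> twist_relations V N \<theta>"
    then obtain u v where u: "u \<in> N" and v: "v \<in> carrier V" and s: "s = act V u v \<ominus>\<^bsub>V\<^esub> (\<theta> u \<odot>\<^bsub>V\<^esub> v)"
      by blast
    let ?u = "g \<otimes>\<^bsub>G\<^esub> u \<otimes>\<^bsub>G\<^esub> inv\<^bsub>G\<^esub> g"
    have "act V g (act V u v) = act V (g \<otimes>\<^bsub>G\<^esub> u) v"
      using representationD(5)[OF V g NG[OF u] v] by simp
    also have "g \<otimes>\<^bsub>G\<^esub> u = ?u \<otimes>\<^bsub>G\<^esub> g" using g NG[OF u] by (simp add: m_assoc)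
    also have "act V \<dots> v = act V ?u (act V g v)"
      using representationD(5)[OF V _ g v] g NG[OF u] by simp
    finally have "act V g s = act V ?u (act V g v) \<ominus>\<^bsub>V\<^esub> (\<theta> ?u \<odot>\<^bsub>V\<^esub> act V g v)"
      unfolding s using u v by (simp add: lin_minus[OF cV cV ag] ac cspace_closed cV lin_smult[OF ag] norm)
    then show "act V g s \<in> twist_relations V N \<theta>"
      using norm(1)[OF u] lin_closed[OF ag v] by blast
  qed
qed

lemma coinvariants_act:
  assumes norm: "normalizes G N \<theta> g" and v: "v \<in> carrier V"
  shows "act (twisted_coinvariants V N \<theta>) g (coset V (twist_span V N \<theta>) v) =
    coset V (twist_span V N \<theta>) (act V g v)"
proof -
  have "g \<in> carrier G" using norm by (simp add: normalizes_def)
  from quotient_act[OF cV twist_submodule representationD(3)[OF V this] twist_span_stable[OF norm] v]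
  show ?thesis unfolding twisted_coinvariants_def .
qed

lemma representation_coinvariants:
  assumes H: "subgroup H G"
    and norm: "\<And>h. h \<in> H \<Longrightarrow> normalizes G N \<theta> h"
  shows "representation (G\<lparr>carrier := H\<rparr>) (twisted_coinvariants V N \<theta>)"
proof (rule representation_image[OF representation_subgroup[OF V H],
      where Q = "coset V (twist_span V N \<theta>)"])
  show "cspace (twisted_coinvariants V N \<theta>)" "coset V (twist_span V N \<theta>) \<in> lin V (twisted_coinvariants V N \<theta>)"
    "carrier (twisted_coinvariants V N \<theta>) = coset V (twist_span V N \<theta>) ` carrier V"
    unfolding twisted_coinvariants_def
    by (rule quotient_cspace[OF cV twist_submodule] coset_lin[OF cV twist_submodule]
        carrier_quotient[OF cV twist_submodule])+
qed (simp add: coinvariants_act norm)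

end

section \<open>Twisted coinvariants of an induced representation\<close>

text \<open>The setting: \<open>P\<close> is the subgroup from which \<open>V\<close> is induced, \<open>H\<close> normalizes \<open>N\<close> and its character
  \<open>\<theta>\<close>, and \<open>w k\<close> for \<open>k \<in> K\<close> represents a double coset of \<open>P\<close> and \<open>H N\<close>. By \<open>disjoint\<close> and
  \<open>L_P\<close> these double cosets are distinct and \<open>L k\<close> consists of the \<open>H\<close>-components of the elements of \<open>H N\<close>
  that stabilize the point \<open>P w k\<close>. The target \<open>Y k\<close> is a model for the coinvariants of \<open>V\<close> under
  \<open>w k N (w k)\<inverse> \<inter> P\<close>: by \<open>lift\<close> the map \<open>q k\<close> identifies it with the equivariant vectors, and \<open>q_L\<close>
  describes the action of \<open>L k\<close> there. By \<open>cover\<close>, every other double coset has a point at which some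
  \<open>u \<in> N\<close> with \<open>\<theta> u \<noteq> 1\<close> stabilizes the point and acts trivially on the fibre.\<close>

locale twisted_mackey = group G for G :: "('g, 'x) monoid_scheme" (structure) +
  fixes P N H :: "'g set" and \<theta> :: "'g \<Rightarrow> complex" and V :: "('v, 'g) rep"
    and K :: "'k set" and w :: "'k \<Rightarrow> 'g" and L :: "'k \<Rightarrow> 'g set"
    and Y :: "'k \<Rightarrow> ('y, 'g) rep" and q :: "'k \<Rightarrow> 'v \<Rightarrow> 'y"
  assumes P: "subgroup P G" and H: "subgroup H G" and char: "finite_character G N \<theta>"
    and norm: "h \<in> H \<Longrightarrow> normalizes G N \<theta> h"
    and V: "representation (G\<lparr>carrier := P\<rparr>) V"
    and w: "k \<in> K \<Longrightarrow> w k \<in> carrier G"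
    and L: "k \<in> K \<Longrightarrow> subgroup (L k) G" and L_sub: "k \<in> K \<Longrightarrow> L k \<subseteq> H"
    and Y: "k \<in> K \<Longrightarrow> cspace (Y k)"
    and q: "k \<in> K \<Longrightarrow> q k \<in> lin V (Y k)"
    and disjoint: "k \<in> K \<Longrightarrow> k' \<in> K \<Longrightarrow> h \<in> H \<Longrightarrow> u \<in> N \<Longrightarrow>
      w k \<otimes> h \<otimes> u \<otimes> inv (w k') \<in> P \<Longrightarrow> k = k' \<and> h \<in> L k"
    and L_P: "k \<in> K \<Longrightarrow> h \<in> L k \<Longrightarrow> w k \<otimes> h \<otimes> inv (w k) \<in> P"
    and q_L: "k \<in> K \<Longrightarrow> h \<in> L k \<Longrightarrow> v \<in> carrier V \<Longrightarrow>
      q k (act V (w k \<otimes> h \<otimes> inv (w k)) v) = act (Y k) h (q k v)"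
    and lift: "k \<in> K \<Longrightarrow> y \<in> carrier (Y k) \<Longrightarrow> \<exists>!v. v \<in> carrier V \<and> q k v = y \<and>
      (\<forall>u\<in>N. w k \<otimes> u \<otimes> inv (w k) \<in> P \<longrightarrow> act V (w k \<otimes> u \<otimes> inv (w k)) v = \<theta> u \<odot>\<^bsub>V\<^esub> v)"
    and cover: "x \<in> carrier G \<Longrightarrow>
      (\<exists>k\<in>K. \<exists>p\<in>P. \<exists>h\<in>H. \<exists>u\<in>N. x = p \<otimes> w k \<otimes> h \<otimes> u) \<or>
      (\<exists>u\<in>N. x \<otimes> u \<otimes> inv x \<in> P \<and> \<theta> u \<noteq> 1 \<and> (\<forall>v\<in>carrier V. act V (x \<otimes> u \<otimes> inv x) v = v))"
begin

abbreviation "I \<equiv> induced_rep G P V"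
abbreviation "GH \<equiv> G\<lparr>carrier := H\<rparr>"
abbreviation "D \<equiv> twist_span I N \<theta>"
abbreviation "Target \<equiv> direct_sum_rep K (\<lambda>k. induced_rep GH (L k) (Y k))"

lemma N: "subgroup N G"
  and \<theta>_mult: "u \<in> N \<Longrightarrow> u' \<in> N \<Longrightarrow> \<theta> (u \<otimes> u') = \<theta> u * \<theta> u'"
  and \<theta>_nonzero: "u \<in> N \<Longrightarrow> \<theta> u \<noteq> 0"
  using char by (auto simp: finite_character_def)

lemma normal: "h \<in> H \<Longrightarrow> u \<in> N \<Longrightarrow> h \<otimes> u \<otimes> inv h \<in> N"
  and \<theta>_normal: "h \<in> H \<Longrightarrow> u \<in> N \<Longrightarrow> \<theta> (h \<otimes> u \<otimes> inv h) = \<theta> u"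
  using norm by (auto simp: normalizes_def)

lemmas P_carrier = subgroup.mem_carrier[OF P]
lemmas N_carrier = subgroup.mem_carrier[OF N]
lemmas H_carrier = subgroup.mem_carrier[OF H]

lemma V_facts: "cspace V" "p \<in> P \<Longrightarrow> act V p \<in> lin V V" "v \<in> carrier V \<Longrightarrow> act V \<one> v = v"
  "p \<in> P \<Longrightarrow> p' \<in> P \<Longrightarrow> v \<in> carrier V \<Longrightarrow> act V (p \<otimes> p') v = act V p (act V p' v)"
  "p \<in> P \<Longrightarrow> v \<in> carrier V \<Longrightarrow> act V p v \<in> carrier V"
  using representationD[OF V] by auto

lemma repr_I: "representation G I"
  by (rule representation_induced[OF is_group P V])

lemma cI: "cspace I"
  by (rule representationD(2)[OF repr_I])

lemma subgroup_L: "k \<in> K \<Longrightarrow> subgroup (L k) GH"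
  by (rule subgroup_incl[OF L H L_sub])

lemma conj_mult:
  assumes "x \<in> carrier G" "a \<in> carrier G" "b \<in> carrier G"
  shows "(x \<otimes> a \<otimes> inv x) \<otimes> (x \<otimes> b \<otimes> inv x) = x \<otimes> (a \<otimes> b) \<otimes> inv x"
proof -
  have "inv x \<otimes> (x \<otimes> (b \<otimes> inv x)) = b \<otimes> inv x" using assms by (simp add: m_assoc[symmetric])
  then show ?thesis using assms by (simp add: m_assoc)
qed

lemma repr_Y: assumes k: "k \<in> K" shows "representation (G\<lparr>carrier := L k\<rparr>) (Y k)"
proof -
  have hom: "(\<lambda>h. w k \<otimes> h \<otimes> inv (w k)) \<in> hom (G\<lparr>carrier := L k\<rparr>) (G\<lparr>carrier := P\<rparr>)"
    using w[OF k] subgroup.mem_carrier[OF L[OF k]] by (auto simp: hom_def L_P[OF k] conj_mult)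
  have surj: "carrier (Y k) = q k ` carrier V"
    using lift[OF k] lin_closed[OF q[OF k]] by blast
  show ?thesis
    by (rule representation_image[OF representation_pullback[OF V subgroup_imp_group[OF L[OF k]] hom] Y[OF k]])
      (use q[OF k] q_L[OF k] surj in auto)
qed

lemma repr_Target: "representation GH Target"
proof (rule representation_direct_sum)
  show "group GH" by (rule subgroup_imp_group[OF H])
  fix k assume k: "k \<in> K"
  show "representation GH (induced_rep GH (L k) (Y k))"
    by (rule representation_induced[OF subgroup_imp_group[OF H] subgroup_L[OF k]]) (use repr_Y[OF k] in simp)
qed

lemma repr_coinvariants: "representation GH (twisted_coinvariants I N \<theta>)"
  by (rule representation_coinvariants[OF repr_I char H norm])

lemmas avg_I_lin = avg_lin[OF repr_I char]
lemmas D_submodule = twist_submodule[OF repr_I char]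
lemmas D_iff = twist_span_iff[OF repr_I char]

lemma I_closed: "f \<in> carrier I \<Longrightarrow> x \<in> carrier G \<Longrightarrow> f x \<in> carrier V"
  and I_left: "f \<in> carrier I \<Longrightarrow> p \<in> P \<Longrightarrow> x \<in> carrier G \<Longrightarrow> f (p \<otimes> x) = act V p (f x)"
  and I_act: "x \<in> carrier G \<Longrightarrow> act I g f x = f (x \<otimes> g)"
  and I_smult: "x \<in> carrier G \<Longrightarrow> (c \<odot>\<^bsub>I\<^esub> f) x = c \<odot>\<^bsub>V\<^esub> f x"
  and I_add: "x \<in> carrier G \<Longrightarrow> (f \<oplus>\<^bsub>I\<^esub> f') x = f x \<oplus>\<^bsub>V\<^esub> f' x"
  by (auto simp: induced_rep_def)

lemma I_eqI:
  assumes "f \<in> carrier I" "f' \<in> carrier I" "\<And>x. x \<in> carrier G \<Longrightarrow> f x = f' x"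
  shows "f = f'"
proof
  fix x show "f x = f' x"
    using assms by (cases "x \<in> carrier G") (auto simp: induced_rep_def PiE_iff extensional_def)
qed

definition equivariant :: "('g \<Rightarrow> 'v) \<Rightarrow> bool" where
  "equivariant f \<longleftrightarrow> f \<in> carrier I \<and> (\<forall>x\<in>carrier G. \<forall>u\<in>N. f (x \<otimes> u) = \<theta> u \<odot>\<^bsub>V\<^esub> f x)"

lemma equivariant_avg:
  assumes f: "f \<in> carrier I" shows "equivariant (avg I N \<theta> f)"
  unfolding equivariant_def
proof (intro conjI ballI)
  show "avg I N \<theta> f \<in> carrier I" by (rule lin_closed[OF avg_I_lin f])
  fix x u assume x: "x \<in> carrier G" and u: "u \<in> N"
  show "avg I N \<theta> f (x \<otimes> u) = \<theta> u \<odot>\<^bsub>V\<^esub> avg I N \<theta> f x"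
    using fun_cong[OF act_avg[OF repr_I char u f], of x] x
    by (simp add: I_act I_smult)
qed

lemma avg_equivariant: "equivariant f \<Longrightarrow> avg I N \<theta> f = f"
proof (rule avg_fixed'[OF repr_I char])
  fix u assume f: "equivariant f" and u: "u \<in> N"
  then have "f \<in> carrier I" by (simp add: equivariant_def)
  then show "act I u f = \<theta> u \<odot>\<^bsub>I\<^esub> f"
    using u f by (intro I_eqI representationD(6)[OF repr_I] N_carrier cspace_smult_closed[OF cI])
      (auto simp: I_act I_smult equivariant_def)
qed (simp add: equivariant_def)

text \<open>The vectors on which \<open>w k N (w k)\<inverse> \<inter> P\<close> acts through \<open>\<theta>\<close>; \<open>lift\<close> says that \<open>q k\<close> maps them
  bijectively onto \<open>Y k\<close>.\<close>

definition eigen :: "'k \<Rightarrow> 'v \<Rightarrow> bool" where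
  "eigen k v \<longleftrightarrow> v \<in> carrier V \<and>
    (\<forall>u\<in>N. w k \<otimes> u \<otimes> inv (w k) \<in> P \<longrightarrow> act V (w k \<otimes> u \<otimes> inv (w k)) v = \<theta> u \<odot>\<^bsub>V\<^esub> v)"

lemma eigen_lift:
  assumes "k \<in> K" "y \<in> carrier (Y k)" obtains v where "eigen k v" "q k v = y"
  using lift[OF assms] by (auto simp: eigen_def)

lemma eigen_unique:
  assumes "k \<in> K" "eigen k v" "eigen k v'" "q k v = q k v'" shows "v = v'"
  using lift[OF assms(1) lin_closed[OF q[OF assms(1)], of v]] assms by (auto simp: eigen_def)

lemma eigen_smult: "eigen k v \<Longrightarrow> eigen k (c \<odot>\<^bsub>V\<^esub> v)"
  by (auto simp: eigen_def cspace_closed V_facts lin_smult[OF V_facts(2)]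
      cspace_smult_assoc[OF V_facts(1), symmetric] mult.commute)

lemma eigen_zero: "eigen k \<zero>\<^bsub>V\<^esub>"
  by (auto simp: eigen_def cspace_closed V_facts lin_zero[OF V_facts(1) V_facts(1) V_facts(2)]
      cspace_smult_zero_right)

lemma conj_inv: "h \<in> H \<Longrightarrow> u \<in> N \<Longrightarrow> inv h \<otimes> u \<otimes> h \<in> N"
  "h \<in> H \<Longrightarrow> u \<in> N \<Longrightarrow> \<theta> (inv h \<otimes> u \<otimes> h) = \<theta> u"
  using normal[of "inv h" u] \<theta>_normal[of "inv h" u] subgroup.m_inv_closed[OF H, of h] H_carrier[of h]
  by auto

lemma eigen_value:
  assumes f: "equivariant f" and k: "k \<in> K" and h: "h \<in> H"
  shows "eigen k (f (w k \<otimes> h))"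
  unfolding eigen_def
proof (intro conjI ballI impI)
  have fI: "f \<in> carrier I" using f by (simp add: equivariant_def)
  note c = w[OF k] H_carrier[OF h]
  show "f (w k \<otimes> h) \<in> carrier V" using c by (simp add: I_closed[OF fI])
  fix u assume u: "u \<in> N" and p: "w k \<otimes> u \<otimes> inv (w k) \<in> P"
  have "act V (w k \<otimes> u \<otimes> inv (w k)) (f (w k \<otimes> h)) = f (w k \<otimes> u \<otimes> inv (w k) \<otimes> (w k \<otimes> h))"
    using I_left[OF fI p, of "w k \<otimes> h"] c by simp
  also have "w k \<otimes> u \<otimes> inv (w k) \<otimes> (w k \<otimes> h) = w k \<otimes> h \<otimes> (inv h \<otimes> u \<otimes> h)"
  proof -
    have "inv (w k) \<otimes> (w k \<otimes> h) = h" "h \<otimes> (inv h \<otimes> (u \<otimes> h)) = u \<otimes> h"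
      using c N_carrier[OF u] by (simp_all add: m_assoc[symmetric])
    then show ?thesis using c N_carrier[OF u] by (simp add: m_assoc)
  qed
  also have "f \<dots> = \<theta> u \<odot>\<^bsub>V\<^esub> f (w k \<otimes> h)"
    using f conj_inv[OF h u] c by (simp add: equivariant_def)
  finally show "act V (w k \<otimes> u \<otimes> inv (w k)) (f (w k \<otimes> h)) = \<theta> u \<odot>\<^bsub>V\<^esub> f (w k \<otimes> h)" .
qed

text \<open>An equivariant function is determined by its values at the points \<open>w k h\<close>, which lie in the space of
  \<open>lift\<close>. At a point outside the double cosets of the \<open>w k\<close> it vanishes, because \<open>u\<close> as in \<open>cover\<close>
  multiplies its value by \<open>\<theta> u\<close> and also by \<open>1\<close>.\<close>

lemma equivariant_zero:
  assumes f: "equivariant f" and 0: "\<And>k h. k \<in> K \<Longrightarrow> h \<in> H \<Longrightarrow> q k (f (w k \<otimes> h)) = \<zero>\<^bsub>Y k\<^esub>"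
  shows "f = \<zero>\<^bsub>I\<^esub>"
proof (rule I_eqI)
  show fI: "f \<in> carrier I" using f by (simp add: equivariant_def)
  show "\<zero>\<^bsub>I\<^esub> \<in> carrier I" by (rule cspace_zero_closed[OF cI])
  note cV = V_facts(1)
  fix x assume x: "x \<in> carrier G"
  have "f x = \<zero>\<^bsub>V\<^esub>"
    using cover[OF x]
  proof (elim disjE bexE conjE)
    fix k p h u assume k: "k \<in> K" and p: "p \<in> P" and h: "h \<in> H" and u: "u \<in> N"
      and x: "x = p \<otimes> w k \<otimes> h \<otimes> u"
    note c = w[OF k] P_carrier[OF p] H_carrier[OF h] N_carrier[OF u]
    have cY: "cspace (Y k)" using Y[OF k] .
    have "f (w k \<otimes> h) = \<zero>\<^bsub>V\<^esub>"
      by (rule eigen_unique[OF k eigen_value[OF f k h] eigen_zero])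
        (simp add: 0 k h lin_zero[OF cV cY q[OF k]])
    then have "f (w k \<otimes> h \<otimes> u) = \<zero>\<^bsub>V\<^esub>"
      using f u c by (simp add: equivariant_def cspace_smult_zero_right cV)
    moreover have "f x = act V p (f (w k \<otimes> h \<otimes> u))"
      using I_left[OF fI p, of "w k \<otimes> h \<otimes> u"] c by (simp add: x m_assoc)
    ultimately show ?thesis by (simp add: lin_zero[OF cV cV V_facts(2)[OF p]])
  next
    fix u assume u: "u \<in> N" and p: "x \<otimes> u \<otimes> inv x \<in> P" and n: "\<theta> u \<noteq> 1"
      and triv: "\<forall>v\<in>carrier V. act V (x \<otimes> u \<otimes> inv x) v = v"
    have fx: "f x \<in> carrier V" by (rule I_closed[OF fI x])
    have "\<theta> u \<odot>\<^bsub>V\<^esub> f x = f (x \<otimes> u)" using f x u by (simp add: equivariant_def)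
    also have "x \<otimes> u = (x \<otimes> u \<otimes> inv x) \<otimes> x" using x N_carrier[OF u] by (simp add: m_assoc)
    also have "f \<dots> = f x" using I_left[OF fI p x] triv fx by simp
    finally have "(1 / (\<theta> u - 1)) \<odot>\<^bsub>V\<^esub> ((\<theta> u + -1) \<odot>\<^bsub>V\<^esub> f x) = (1 / (\<theta> u - 1)) \<odot>\<^bsub>V\<^esub> ((1 + -1) \<odot>\<^bsub>V\<^esub> f x)"
      using fx by (simp only: cspace_smult_l_distr[OF cV] cspace_smult_one[OF cV])
    then show ?thesis
      using fx n by (simp add: cspace_smult_assoc[OF cV, symmetric] cspace_smult_one cV cspace_smult_zero
          cspace_smult_zero_right)
  qed
  then show "f x = \<zero>\<^bsub>I\<^esub> x" using x by (simp add: induced_rep_def)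
qed

text \<open>The isomorphism on the level of functions: average, evaluate at the points \<open>w k h\<close>, and pass to the
  coinvariants of the fibre.\<close>

definition \<Phi> :: "('g \<Rightarrow> 'v) \<Rightarrow> 'k \<Rightarrow> 'g \<Rightarrow> 'y" where
  "\<Phi> f = (\<lambda>k\<in>K. \<lambda>h\<in>H. q k (avg I N \<theta> f (w k \<otimes> h)))"

lemma \<Phi>_closed:
  assumes f: "f \<in> carrier I" shows "\<Phi> f \<in> carrier Target"
proof -
  let ?f = "avg I N \<theta> f"
  have fI: "?f \<in> carrier I" by (rule lin_closed[OF avg_I_lin f])
  have "q k (?f (w k \<otimes> h)) \<in> carrier (Y k)" if "k \<in> K" "h \<in> H" for k h
    using lin_closed[OF q I_closed[OF fI]] w H_carrier that by auto
  moreover have "q k (?f (w k \<otimes> (l \<otimes> h))) = act (Y k) l (q k (?f (w k \<otimes> h)))"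
    if k: "k \<in> K" and h: "h \<in> H" and l: "l \<in> L k" for k h l
  proof -
    note c = w[OF k] H_carrier[OF h] subgroup.mem_carrier[OF L[OF k] l]
    have "inv (w k) \<otimes> (w k \<otimes> h) = h" using c by (simp add: m_assoc[symmetric])
    then have "w k \<otimes> (l \<otimes> h) = (w k \<otimes> l \<otimes> inv (w k)) \<otimes> (w k \<otimes> h)" using c by (simp add: m_assoc)
    then show ?thesis
      using I_left[OF fI L_P[OF k l], of "w k \<otimes> h"] q_L[OF k l I_closed[OF fI, of "w k \<otimes> h"]] c by simp
  qed
  moreover have "l \<otimes> h \<in> H" if "k \<in> K" "h \<in> H" "l \<in> L k" for k h l
    using that L_sub by (auto intro: subgroup.m_closed[OF H])
  ultimately show ?thesis
    by (auto simp: direct_sum_rep_def induced_rep_def \<Phi>_def PiE_iff)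
qed

lemma \<Phi>_lin: "\<Phi> \<in> lin I Target"
proof (rule linI)
  show "\<Phi> f \<in> carrier Target" if "f \<in> carrier I" for f by (rule \<Phi>_closed[OF that])
  have c: "w k \<otimes> h \<in> carrier G" if "k \<in> K" "h \<in> H" for k h using that w H_carrier by auto
  note A = lin_closed[OF avg_I_lin]
  show "\<Phi> (f \<oplus>\<^bsub>I\<^esub> f') = \<Phi> f \<oplus>\<^bsub>Target\<^esub> \<Phi> f'" if "f \<in> carrier I" "f' \<in> carrier I" for f f'
    using that c by (auto simp: \<Phi>_def direct_sum_rep_def induced_rep_def[of GH] lin_add[OF avg_I_lin] I_add
        lin_add[OF q] I_closed A fun_eq_iff)
  show "\<Phi> (a \<odot>\<^bsub>I\<^esub> f) = a \<odot>\<^bsub>Target\<^esub> \<Phi> f" if "f \<in> carrier I" for a f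
    using that c by (auto simp: \<Phi>_def direct_sum_rep_def induced_rep_def[of GH] lin_smult[OF avg_I_lin] I_smult
        lin_smult[OF q] I_closed A fun_eq_iff)
qed

lemma \<Phi>_eq_zero_iff:
  assumes f: "f \<in> carrier I" shows "\<Phi> f = \<zero>\<^bsub>Target\<^esub> \<longleftrightarrow> f \<in> D"
proof -
  have cY: "cspace (Y k)" if "k \<in> K" for k by (rule Y[OF that])
  have "avg I N \<theta> f = \<zero>\<^bsub>I\<^esub>" if z: "\<Phi> f = \<zero>\<^bsub>Target\<^esub>"
  proof (rule equivariant_zero[OF equivariant_avg[OF f]])
    fix k h assume "k \<in> K" "h \<in> H"
    then show "q k (avg I N \<theta> f (w k \<otimes> h)) = \<zero>\<^bsub>Y k\<^esub>"
      using fun_cong[OF fun_cong[OF z, of k], of h] by (simp add: \<Phi>_def direct_sum_rep_def induced_rep_def)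
  qed
  moreover have "\<Phi> f = \<zero>\<^bsub>Target\<^esub>" if "avg I N \<theta> f = \<zero>\<^bsub>I\<^esub>"
    using that w H_carrier by (auto simp: \<Phi>_def direct_sum_rep_def induced_rep_def fun_eq_iff
        lin_zero[OF V_facts(1) cY q])
  ultimately show ?thesis using D_iff[OF f] by blast
qed

lemma \<Phi>_act:
  assumes g: "g \<in> H" and f: "f \<in> carrier I"
  shows "\<Phi> (act I g f) = act Target g (\<Phi> f)"
proof -
  note gG = H_carrier[OF g]
  note ag = representationD(3)[OF repr_I gG]
  let ?A = "avg I N \<theta>"
  have Af: "?A f \<in> carrier I" by (rule lin_closed[OF avg_I_lin f])
  have AAf: "?A (?A f) = ?A f" by (rule avg_equivariant[OF equivariant_avg[OF f]])
  \<comment> \<open>\<open>f - avg f\<close> lies in \<open>D\<close>, which \<open>g\<close> preserves, so \<open>avg\<close> kills its translate.\<close>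
  have d: "f \<ominus>\<^bsub>I\<^esub> ?A f \<in> D"
    by (subst D_iff) (simp_all add: cspace_closed cI f Af lin_minus[OF cI cI avg_I_lin] AAf cspace_minus_self)
  have "act I g (f \<ominus>\<^bsub>I\<^esub> ?A f) \<in> D"
    by (rule twist_span_stable[OF repr_I char norm[OF g] d])
  from avg_vanish[OF repr_I char this] have "?A (act I g f) \<ominus>\<^bsub>I\<^esub> ?A (act I g (?A f)) = \<zero>\<^bsub>I\<^esub>"
    using f Af
    by (simp add: lin_minus[OF cI cI ag] lin_minus[OF cI cI avg_I_lin] lin_closed[OF ag] cspace_closed cI)
  then have "?A (act I g f) = ?A (act I g (?A f))"
    by (rule cspace_eqI[OF cI lin_closed[OF avg_I_lin lin_closed[OF ag f]]
          lin_closed[OF avg_I_lin lin_closed[OF ag Af]]])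
  also have "\<dots> = act I g (?A f)"
  proof (rule avg_equivariant)
    show "equivariant (act I g (?A f))"
      unfolding equivariant_def
    proof (intro conjI ballI)
      show "act I g (?A f) \<in> carrier I" by (rule lin_closed[OF ag Af])
      fix x u assume x: "x \<in> carrier G" and u: "u \<in> N"
      note uG = N_carrier[OF u]
      have "g \<otimes> (inv g \<otimes> (u \<otimes> g)) = u \<otimes> g" using gG uG by (simp add: m_assoc[symmetric])
      then have "x \<otimes> u \<otimes> g = x \<otimes> g \<otimes> (inv g \<otimes> u \<otimes> g)" using x gG uG by (simp add: m_assoc)
      then show "act I g (?A f) (x \<otimes> u) = \<theta> u \<odot>\<^bsub>V\<^esub> act I g (?A f) x"
        using equivariant_avg[OF f] conj_inv[OF g u] x gG uG by (simp add: I_act equivariant_def)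
    qed
  qed
  finally have A: "?A (act I g f) = act I g (?A f)" .
  have *: "w k \<otimes> h \<in> carrier G" "w k \<otimes> h \<otimes> g = w k \<otimes> (h \<otimes> g)" "h \<otimes> g \<in> H" if "k \<in> K" "h \<in> H" for k h
    using that w H_carrier gG g by (auto simp: m_assoc intro: subgroup.m_closed[OF H])
  show ?thesis
    by (auto simp: \<Phi>_def A I_act * direct_sum_rep_def induced_rep_def[of GH] fun_eq_iff)
qed

lemma cancel: "x \<in> carrier G \<Longrightarrow> y \<in> carrier G \<Longrightarrow> inv x \<otimes> (x \<otimes> y) = y"
  by (simp add: m_assoc[symmetric])

text \<open>A function with prescribed images under \<open>\<Phi>\<close> has to take the value \<open>p (\<theta> u v)\<close> at \<open>p w k h u\<close>, where
  \<open>v\<close> lifts the prescribed vector at \<open>h\<close>. This value depends only on the point: two decompositions differ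
  by \<open>m = w k a b (w k)\<inverse> \<in> P\<close> with \<open>a \<in> L k\<close> and \<open>b \<in> N\<close>, and \<open>m\<close> maps the lift at \<open>h'\<close> to \<open>\<theta> b\<close> times the lift at \<open>h\<close>.\<close>

lemma transport_eq:
  assumes F: "F \<in> carrier Target"
    and k: "k \<in> K" and p: "p \<in> P" and h: "h \<in> H" and u: "u \<in> N"
    and v: "eigen k v" "q k v = F k h"
    and k': "k' \<in> K" and p': "p' \<in> P" and h': "h' \<in> H" and u': "u' \<in> N"
    and v': "eigen k' v'" "q k' v' = F k' h'"
    and eq: "p \<otimes> w k \<otimes> h \<otimes> u = p' \<otimes> w k' \<otimes> h' \<otimes> u'"
  shows "act V p (\<theta> u \<odot>\<^bsub>V\<^esub> v) = act V p' (\<theta> u' \<odot>\<^bsub>V\<^esub> v')"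
proof -
  note c = w[OF k] w[OF k'] P_carrier[OF p] P_carrier[OF p'] H_carrier[OF h] H_carrier[OF h']
    N_carrier[OF u] N_carrier[OF u']
  have vc: "v \<in> carrier V" "v' \<in> carrier V" using v v' by (auto simp: eigen_def)
  define m where "m = inv p \<otimes> p'"
  have m: "m \<in> P" unfolding m_def using p p' by (intro subgroup.m_closed[OF P] subgroup.m_inv_closed[OF P])
  define a where "a = h \<otimes> inv h'"
  define b where "b = h' \<otimes> (u \<otimes> inv u') \<otimes> inv h'"
  have a: "a \<in> H" unfolding a_def using h h' by (intro subgroup.m_closed[OF H] subgroup.m_inv_closed[OF H])
  have uu: "u \<otimes> inv u' \<in> N" using u u' by (intro subgroup.m_closed[OF N] subgroup.m_inv_closed[OF N])
  have b: "b \<in> N" "\<theta> b = \<theta> (u \<otimes> inv u')" unfolding b_def using normal[OF h' uu] \<theta>_normal[OF h' uu] by auto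
  have ac: "a \<in> carrier G" "b \<in> carrier G" using a b H_carrier N_carrier by auto
  have "w k \<otimes> h \<otimes> u = inv p \<otimes> (p' \<otimes> w k' \<otimes> h' \<otimes> u')"
    unfolding eq[symmetric] using c by (simp add: m_assoc[symmetric])
  then have e: "w k \<otimes> h \<otimes> u = m \<otimes> w k' \<otimes> h' \<otimes> u'" unfolding m_def using c by (simp add: m_assoc)
  have "a \<otimes> b \<otimes> h' \<otimes> u' = h \<otimes> u"
  proof -
    have "inv u' \<otimes> (inv h' \<otimes> (h' \<otimes> u')) = \<one>"  "inv h' \<otimes> (h' \<otimes> (u \<otimes> \<one>)) = u"
      using c by (simp_all add: m_assoc[symmetric])
    then show ?thesis unfolding a_def b_def using c by (simp add: m_assoc)
  qed
  then have e2: "w k \<otimes> a \<otimes> b \<otimes> (h' \<otimes> u') = m \<otimes> w k' \<otimes> (h' \<otimes> u')"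
    using e c ac P_carrier[OF m] by (simp add: m_assoc)
  then have e3: "w k \<otimes> a \<otimes> b = m \<otimes> w k'"
    using c ac P_carrier[OF m] by (simp only: right_cancel m_closed)
  then have e4: "w k \<otimes> a \<otimes> b \<otimes> inv (w k') = m"
    using c ac P_carrier[OF m] by (simp add: m_assoc)
  from disjoint[OF k k' a b(1)] m e4 have kk: "k = k'" and aL: "a \<in> L k" by auto
  note wk = w[OF k]
  have mm: "m = (w k \<otimes> a \<otimes> inv (w k)) \<otimes> (w k \<otimes> b \<otimes> inv (w k))"
  proof -
    have "inv (w k) \<otimes> (w k \<otimes> (b \<otimes> inv (w k))) = b \<otimes> inv (w k)"
      using wk ac by (simp add: m_assoc[symmetric])
    then show ?thesis using e4[symmetric] wk ac by (simp add: kk[symmetric] m_assoc)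
  qed
  have pa: "w k \<otimes> a \<otimes> inv (w k) \<in> P" by (rule L_P[OF k aL])
  have "w k \<otimes> b \<otimes> inv (w k) = inv (w k \<otimes> a \<otimes> inv (w k)) \<otimes> m"
    unfolding mm using wk ac by (intro cancel[symmetric]) auto
  then have pb: "w k \<otimes> b \<otimes> inv (w k) \<in> P"
    using pa m by (simp add: subgroup.m_closed[OF P] subgroup.m_inv_closed[OF P])
  have mv: "act V m v' \<in> carrier V" using V_facts(5)[OF m vc(2)] .
  have "q k (act V m v') = act (Y k) a (q k (act V (w k \<otimes> b \<otimes> inv (w k)) v'))"
    unfolding mm using V_facts(4)[OF pa pb vc(2)] q_L[OF k aL V_facts(5)[OF pb vc(2)]] by simp
  also have "act V (w k \<otimes> b \<otimes> inv (w k)) v' = \<theta> b \<odot>\<^bsub>V\<^esub> v'"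
    using v'(1) b(1) pb by (simp add: eigen_def kk)
  also have "act (Y k) a (q k (\<theta> b \<odot>\<^bsub>V\<^esub> v')) = \<theta> b \<odot>\<^bsub>Y k\<^esub> act (Y k) a (F k h')"
    using aL v'(2) lin_closed[OF q[OF k'] vc(2)]
    by (simp add: lin_smult[OF q[OF k'] vc(2)] kk lin_smult[OF representationD(3)[OF repr_Y[OF k']]])
  also have "act (Y k) a (F k h') = F k (a \<otimes> h')"
    using F k aL h' by (auto simp: direct_sum_rep_def induced_rep_def PiE_iff)
  also have "a \<otimes> h' = h" unfolding a_def using c by (simp add: m_assoc)
  finally have qm: "q k (act V m v') = \<theta> b \<odot>\<^bsub>Y k\<^esub> q k v" by (simp add: v(2))
  \<comment> \<open>\<open>m\<close> normalizes \<open>w k N (w k)\<inverse> \<inter> P\<close>: it conjugates the element given by \<open>z\<close> to that given by \<open>y\<close>.\<close>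
  have eig: "eigen k (act V m v')"
    unfolding eigen_def
  proof (intro conjI ballI impI)
    show "act V m v' \<in> carrier V" by (rule mv)
    fix y assume y: "y \<in> N" and py: "w k \<otimes> y \<otimes> inv (w k) \<in> P"
    note yG = N_carrier[OF y]
    define z where "z = inv b \<otimes> (inv a \<otimes> y \<otimes> a) \<otimes> b"
    have y1: "inv a \<otimes> y \<otimes> a \<in> N" "\<theta> (inv a \<otimes> y \<otimes> a) = \<theta> y" using conj_inv[OF a y] by auto
    have z: "z \<in> N" unfolding z_def
      by (rule subgroup.m_closed[OF N subgroup.m_closed[OF N subgroup.m_inv_closed[OF N b(1)] y1(1)] b(1)])
    have "b \<otimes> z = (inv a \<otimes> y \<otimes> a) \<otimes> b"
      unfolding z_def using ac yG by (simp add: m_assoc[symmetric])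
    then have bz: "\<theta> b * \<theta> z = \<theta> y * \<theta> b"
      using \<theta>_mult[OF b(1) z] \<theta>_mult[OF y1(1) b(1)] y1 by metis
    then have \<theta>z: "\<theta> z = \<theta> y" using \<theta>_nonzero[OF b(1)] by simp
    have zG: "z \<in> carrier G" using N_carrier[OF z] .
    have ab: "a \<otimes> b \<otimes> z = y \<otimes> a \<otimes> b"
    proof -
      have "a \<otimes> (b \<otimes> z) = y \<otimes> (a \<otimes> b)"
        unfolding \<open>b \<otimes> z = _\<close> using ac yG by (simp add: m_assoc[symmetric])
      then show ?thesis using ac yG zG by (simp add: m_assoc)
    qed
    have m': "m = w k \<otimes> (a \<otimes> b) \<otimes> inv (w k)" using e4 wk ac by (simp add: kk[symmetric] m_assoc)
    have sw: "m \<otimes> (w k \<otimes> z \<otimes> inv (w k)) = (w k \<otimes> y \<otimes> inv (w k)) \<otimes> m"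
      unfolding m' using conj_mult[OF wk] ac yG zG ab by (simp add: m_assoc)
    have mG: "m \<in> carrier G" by (rule P_carrier[OF m])
    have "w k \<otimes> z \<otimes> inv (w k) = inv m \<otimes> (m \<otimes> (w k \<otimes> z \<otimes> inv (w k)))"
      using mG wk zG by (simp add: m_assoc[symmetric])
    then have pz: "w k \<otimes> z \<otimes> inv (w k) \<in> P"
      unfolding sw using m py by (simp add: subgroup.m_closed[OF P] subgroup.m_inv_closed[OF P])
    have "act V (w k \<otimes> y \<otimes> inv (w k)) (act V m v') = act V m (act V (w k \<otimes> z \<otimes> inv (w k)) v')"
      using V_facts(4)[OF py m vc(2)] V_facts(4)[OF m pz vc(2)] sw by simp
    also have "act V (w k \<otimes> z \<otimes> inv (w k)) v' = \<theta> y \<odot>\<^bsub>V\<^esub> v'"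
      using v'(1) z pz \<theta>z by (simp add: eigen_def kk)
    finally show "act V (w k \<otimes> y \<otimes> inv (w k)) (act V m v') = \<theta> y \<odot>\<^bsub>V\<^esub> act V m v'"
      by (simp add: lin_smult[OF V_facts(2)[OF m] vc(2)])
  qed
  have "act V m v' = \<theta> b \<odot>\<^bsub>V\<^esub> v"
    by (rule eigen_unique[OF k eig eigen_smult[OF v(1)]]) (simp add: qm lin_smult[OF q[OF k] vc(1)])
  moreover have "\<theta> b * \<theta> u' = \<theta> u"
  proof -
    have "u \<otimes> inv u' \<otimes> u' = u" using c by (simp add: m_assoc)
    then show ?thesis using \<theta>_mult[OF uu u'] b by simp
  qed
  ultimately have "act V m (\<theta> u' \<odot>\<^bsub>V\<^esub> v') = \<theta> u \<odot>\<^bsub>V\<^esub> v"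
    using vc by (simp add: lin_smult[OF V_facts(2)[OF m]] cspace_smult_assoc[OF V_facts(1), symmetric] mult.commute)
  moreover have "p \<otimes> m = p'" unfolding m_def using c by (simp add: m_assoc[symmetric])
  ultimately show ?thesis
    using V_facts(4)[OF p m, of "\<theta> u' \<odot>\<^bsub>V\<^esub> v'"] vc by (simp add: cspace_closed V_facts(1))
qed

lemma \<Phi>_surj:
  assumes F: "F \<in> carrier Target"
  obtains f where "f \<in> carrier I" "\<Phi> f = F"
proof -
  have Fc: "F k h \<in> carrier (Y k)" if "k \<in> K" "h \<in> H" for k h
    using F that by (auto simp: direct_sum_rep_def induced_rep_def PiE_iff)
  \<comment> \<open>\<open>y\<close> is the value that some decomposition of \<open>x\<close> assigns to \<open>x\<close>.\<close>
  define dec where "dec x y \<longleftrightarrow> (\<exists>k\<in>K. \<exists>p\<in>P. \<exists>h\<in>H. \<exists>u\<in>N. \<exists>v. eigen k v \<and> q k v = F k h \<and>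
      x = p \<otimes> w k \<otimes> h \<otimes> u \<and> y = act V p (\<theta> u \<odot>\<^bsub>V\<^esub> v))" for x y
  have uniq: "y = y'" if "dec x y" "dec x y'" for x y y'
    using that unfolding dec_def by (elim bexE exE conjE) (simp, rule transport_eq[OF F]; simp)
  define f where "f = (\<lambda>x\<in>carrier G. if \<exists>y. dec x y then THE y. dec x y else \<zero>\<^bsub>V\<^esub>)"
  have fdec: "f x = y" if "dec x y" "x \<in> carrier G" for x y
    using that uniq by (auto simp: f_def intro!: the_equality)
  have fnot: "f x = \<zero>\<^bsub>V\<^esub>" if "\<nexists>y. dec x y" "x \<in> carrier G" for x
    using that by (auto simp: f_def)
  have dec_closed: "y \<in> carrier V" if "dec x y" for x y
    using that by (auto simp: dec_def eigen_def V_facts cspace_closed)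
  have dec_left: "dec (p \<otimes> x) (act V p y)" if "dec x y" and p: "p \<in> P" for p x y
  proof -
    from that obtain k p' h u v where d: "k \<in> K" "p' \<in> P" "h \<in> H" "u \<in> N" "eigen k v" "q k v = F k h"
      "x = p' \<otimes> w k \<otimes> h \<otimes> u" "y = act V p' (\<theta> u \<odot>\<^bsub>V\<^esub> v)" unfolding dec_def by blast
    have "p \<otimes> x = (p \<otimes> p') \<otimes> w k \<otimes> h \<otimes> u"
      unfolding d using d p by (simp add: m_assoc P_carrier w H_carrier N_carrier)
    moreover have "act V p y = act V (p \<otimes> p') (\<theta> u \<odot>\<^bsub>V\<^esub> v)"
      unfolding d using d p by (simp add: V_facts(4) eigen_def cspace_closed V_facts(1))
    ultimately show ?thesis unfolding dec_def using d subgroup.m_closed[OF P p d(2)] by blast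
  qed
  have dec_right: "dec (x \<otimes> u) (\<theta> u \<odot>\<^bsub>V\<^esub> y)" if "dec x y" and u: "u \<in> N" for u x y
  proof -
    from that obtain k p h u' v where d: "k \<in> K" "p \<in> P" "h \<in> H" "u' \<in> N" "eigen k v" "q k v = F k h"
      "x = p \<otimes> w k \<otimes> h \<otimes> u'" "y = act V p (\<theta> u' \<odot>\<^bsub>V\<^esub> v)" unfolding dec_def by blast
    have "x \<otimes> u = p \<otimes> w k \<otimes> h \<otimes> (u' \<otimes> u)"
      unfolding d using d u by (simp add: m_assoc P_carrier w H_carrier N_carrier)
    moreover have "\<theta> u \<odot>\<^bsub>V\<^esub> y = act V p (\<theta> (u' \<otimes> u) \<odot>\<^bsub>V\<^esub> v)"
      unfolding d using d u by (simp add: \<theta>_mult eigen_def cspace_closed V_facts(1) mult.commute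
          lin_smult[OF V_facts(2), symmetric] cspace_smult_assoc[OF V_facts(1), symmetric])
    ultimately show ?thesis unfolding dec_def using d subgroup.m_closed[OF N d(4) u] by blast
  qed
  have left: "f (p \<otimes> x) = act V p (f x)" if p: "p \<in> P" and x: "x \<in> carrier G" for p x
  proof (cases "\<exists>y. dec x y")
    case True
    then show ?thesis using fdec dec_left p x P_carrier[OF p] by (metis m_closed)
  next
    case False
    have "\<nexists>y. dec (p \<otimes> x) y"
    proof
      assume "\<exists>y. dec (p \<otimes> x) y"
      then obtain y where "dec (p \<otimes> x) y" ..
      from dec_left[OF this subgroup.m_inv_closed[OF P p]] False show False
        using p x P_carrier[OF p] by (simp add: m_assoc[symmetric])
    qed
    with False show ?thesis
      using fnot x P_carrier[OF p] lin_zero[OF V_facts(1) V_facts(1) V_facts(2)[OF p]] by auto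
  qed
  have right: "f (x \<otimes> u) = \<theta> u \<odot>\<^bsub>V\<^esub> f x" if u: "u \<in> N" and x: "x \<in> carrier G" for u x
  proof (cases "\<exists>y. dec x y")
    case True
    then show ?thesis using fdec dec_right u x N_carrier[OF u] by (metis m_closed)
  next
    case False
    have "\<nexists>y. dec (x \<otimes> u) y"
    proof
      assume "\<exists>y. dec (x \<otimes> u) y"
      then obtain y where "dec (x \<otimes> u) y" ..
      from dec_right[OF this subgroup.m_inv_closed[OF N u]] False show False
        using u x N_carrier[OF u] by (simp add: m_assoc)
    qed
    with False show ?thesis
      using fnot x N_carrier[OF u] cspace_smult_zero_right[OF V_facts(1)] by auto
  qed
  have "f x \<in> carrier V" if x: "x \<in> carrier G" for x
  proof (cases "\<exists>y. dec x y")
    case True then show ?thesis using fdec dec_closed x by blast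
  next
    case False then show ?thesis using fnot x cspace_zero_closed[OF V_facts(1)] by simp
  qed
  then have fI: "f \<in> carrier I" using left by (auto simp: induced_rep_def f_def)
  then have eq: "equivariant f" using right by (simp add: equivariant_def)
  have "q k (f (w k \<otimes> h)) = F k h" if k: "k \<in> K" and h: "h \<in> H" for k h
  proof -
    obtain v where v: "eigen k v" "q k v = F k h" using eigen_lift[OF k Fc[OF k h]] .
    have vc: "v \<in> carrier V" using v by (simp add: eigen_def)
    have "dec (w k \<otimes> h) v"
      unfolding dec_def
    proof (intro bexI exI conjI)
      show "w k \<otimes> h = \<one> \<otimes> w k \<otimes> h \<otimes> \<one>" using w[OF k] H_carrier[OF h] by simp
      show "v = act V \<one> (\<theta> \<one> \<odot>\<^bsub>V\<^esub> v)"
        using vc V_facts \<theta>_one[OF repr_I char] by (simp add: cspace_smult_one)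
    qed (use k h v P N in \<open>auto intro: subgroup.one_closed\<close>)
    then show ?thesis using fdec w[OF k] H_carrier[OF h] v by simp
  qed
  moreover have "F k = undefined" if "k \<notin> K" for k
    using F that by (auto simp: direct_sum_rep_def PiE_iff extensional_def)
  moreover have "F k h = undefined" if "k \<in> K" "h \<notin> H" for k h
    using F that by (auto simp: direct_sum_rep_def induced_rep_def PiE_iff extensional_def)
  ultimately have "\<Phi> f = F"
    by (intro ext) (simp add: \<Phi>_def avg_equivariant[OF eq] restrict_def)
  with fI that show thesis by blast
qed

theorem coinvariants_of_induced: "rep_iso GH (twisted_coinvariants I N \<theta>) Target"
proof -
  let ?C = "coset I D"
  note QD = quotient_cspace[OF cI D_submodule] coset_lin[OF cI D_submodule]
  have cT: "cspace Target" by (rule representationD(2)[OF repr_Target])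
  have D_sub: "f \<in> carrier I" if "f \<in> D" for f using submodule_closed(1)[OF D_submodule] that by blast
  have "\<Phi> f = \<zero>\<^bsub>Target\<^esub>" if "f \<in> D" for f using \<Phi>_eq_zero_iff[OF D_sub[OF that]] that by simp
  from quotient_factor[OF cI D_submodule cT \<Phi>_lin this]
  obtain T where T: "T \<in> lin (quotient_rep I D) Target" "\<And>f. f \<in> carrier I \<Longrightarrow> T (?C f) = \<Phi> f" by blast
  have carr: "carrier (quotient_rep I D) = ?C ` carrier I" by (rule carrier_quotient[OF cI D_submodule])
  have inj: "inj_on T (carrier (quotient_rep I D))"
  proof (rule lin_inj_onI[OF QD(1) cT T(1)])
    fix x assume "x \<in> carrier (quotient_rep I D)" and x0: "T x = \<zero>\<^bsub>Target\<^esub>"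
    then obtain f where f: "f \<in> carrier I" "x = ?C f" unfolding carr by blast
    then have "f \<in> D" using x0 T(2)[OF f(1)] \<Phi>_eq_zero_iff[OF f(1)] by simp
    then show "x = \<zero>\<^bsub>quotient_rep I D\<^esub>"
      unfolding f(2) using coset_eq_zero_iff[OF cI D_submodule f(1)] by simp
  qed
  have "T ` carrier (quotient_rep I D) = carrier Target"
    unfolding carr
  proof (intro equalityI subsetI)
    fix F assume "F \<in> T ` ?C ` carrier I"
    then obtain f where f: "f \<in> carrier I" "F = T (?C f)" by blast
    show "F \<in> carrier Target" unfolding f(2) T(2)[OF f(1)] by (rule \<Phi>_closed[OF f(1)])
  next
    fix F assume "F \<in> carrier Target"
    then obtain f where f: "f \<in> carrier I" "\<Phi> f = F" by (rule \<Phi>_surj)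
    then have "F = T (?C f)" by (simp only: T(2))
    then show "F \<in> T ` ?C ` carrier I" by (rule image_eqI[OF _ imageI[OF f(1)]])
  qed
  with inj have bij: "bij_betw T (carrier (quotient_rep I D)) (carrier Target)" by (simp add: bij_betw_def)
  have act: "T (act (quotient_rep I D) g x) = act Target g (T x)"
    if g: "g \<in> H" and x: "x \<in> carrier (quotient_rep I D)" for g x
  proof -
    obtain f where f: "f \<in> carrier I" "x = ?C f" using x unfolding carr by blast
    note ag = representationD(3)[OF repr_I H_carrier[OF g]]
    have "act (quotient_rep I D) g (?C f) = ?C (act I g f)"
      using coinvariants_act[OF repr_I char norm[OF g] f(1)] by (simp add: twisted_coinvariants_def)
    then show ?thesis using f T(2) lin_closed[OF ag f(1)] \<Phi>_act[OF g f(1)] by simp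
  qed
  show ?thesis
    unfolding rep_iso_def
    using repr_coinvariants repr_Target linear_mapI[OF QD(1) cT T(1)] bij act
    by (auto simp: twisted_coinvariants_def)
qed

end

section \<open>Coinvariants of a tensor product\<close>

lemma coinvariants_facts:
  assumes "representation G V" "finite_character G N \<theta>"
  shows "cspace (twisted_coinvariants V N \<theta>)"
    "coset V (twist_span V N \<theta>) \<in> lin V (twisted_coinvariants V N \<theta>)"
    "carrier (twisted_coinvariants V N \<theta>) = coset V (twist_span V N \<theta>) ` carrier V"
  unfolding twisted_coinvariants_def
  by (rule quotient_cspace coset_lin carrier_quotient; intro representationD(2)[OF assms(1)]
      twist_submodule[OF assms])+

text \<open>The quotient map \<open>q\<close> is the tensor product of the two quotient maps. The sections
  \<open>coinvariant_section\<close> of the factors give a section \<open>s\<close> of \<open>q\<close>, and \<open>s \<circ> q\<close> is the averaging operator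
  of \<open>M \<times> N\<close>. Hence \<open>q\<close> maps the equivariant tensors bijectively onto the target.\<close>

lemma tensor_coinvariants:
  assumes V: "representation G V" and W: "representation H W"
    and M: "finite_character G M \<mu>" and N: "finite_character H N \<nu>"
  obtains q where
    "q \<in> lin (tensor_rep V W) (tensor_rep (twisted_coinvariants V M \<mu>) (twisted_coinvariants W N \<nu>))"
    "\<And>g h t. normalizes G M \<mu> g \<Longrightarrow> normalizes H N \<nu> h \<Longrightarrow> t \<in> carrier (tensor_rep V W) \<Longrightarrow>
      q (act (tensor_rep V W) (g, h) t) =
        act (tensor_rep (twisted_coinvariants V M \<mu>) (twisted_coinvariants W N \<nu>)) (g, h) (q t)"
    "\<And>y. y \<in> carrier (tensor_rep (twisted_coinvariants V M \<mu>) (twisted_coinvariants W N \<nu>)) \<Longrightarrow>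
      \<exists>!t. t \<in> carrier (tensor_rep V W) \<and> q t = y \<and>
        (\<forall>m\<in>M. \<forall>u\<in>N. act (tensor_rep V W) (m, u) t = (\<mu> m * \<nu> u) \<odot>\<^bsub>tensor_rep V W\<^esub> t)"
proof -
  let ?A = "twisted_coinvariants V M \<mu>" and ?B = "twisted_coinvariants W N \<nu>"
  let ?a = "coset V (twist_span V M \<mu>)" and ?b = "coset W (twist_span W N \<nu>)"
  let ?T = "tensor_rep V W" and ?C = "tensor_rep ?A ?B"
  note V' = representationD[OF V] and W' = representationD[OF W]
  note A = coinvariants_facts[OF V M] and B = coinvariants_facts[OF W N]
  note cV = V'(2) and cW = W'(2)
  have cT: "cspace ?T" by (rule cspace_tensor[OF cV cW])
  have cC: "cspace ?C" by (rule cspace_tensor[OF A(1) B(1)])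
  have Ms: "subgroup M G" and Ns: "subgroup N H" using M N by (auto simp: finite_character_def)
  have MG: "m \<in> M \<Longrightarrow> m \<in> carrier G" and NH: "u \<in> N \<Longrightarrow> u \<in> carrier H" for m u
    using subgroup.mem_carrier[OF Ms] subgroup.mem_carrier[OF Ns] by auto
  have one: "\<one>\<^bsub>G\<^esub> \<in> M" "\<one>\<^bsub>H\<^esub> \<in> N" using subgroup.one_closed Ms Ns by auto
  note aV = avg_lin[OF V M] and aW = avg_lin[OF W N]
  note act = tensor_act[OF cV cW V'(3) W'(3)]
  obtain q where q: "q \<in> lin ?T ?C"
    "\<And>v w. v \<in> carrier V \<Longrightarrow> w \<in> carrier W \<Longrightarrow> q (tens V W v w) = tens ?A ?B (?a v) (?b w)"
    using tensor_map[OF cV cW A(1) B(1) A(2) B(2)] by blast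
  obtain i where i: "i \<in> lin ?A V" "\<And>v. v \<in> carrier V \<Longrightarrow> i (?a v) = avg V M \<mu> v"
    using coinvariant_section[OF V M] by blast
  obtain j where j: "j \<in> lin ?B W" "\<And>v. v \<in> carrier W \<Longrightarrow> j (?b v) = avg W N \<nu> v"
    using coinvariant_section[OF W N] by blast
  obtain s where s: "s \<in> lin ?C ?T"
    "\<And>x y. x \<in> carrier ?A \<Longrightarrow> y \<in> carrier ?B \<Longrightarrow> s (tens ?A ?B x y) = tens V W (i x) (j y)"
    using tensor_map[OF A(1) B(1) cV cW i(1) j(1)] by blast
  have qs: "q (s y) = y" if y: "y \<in> carrier ?C" for y
  proof (rule tensor_lin_eqI[OF A(1) B(1) cC lin_comp[OF q(1) s(1)] _ _ y, where T = "\<lambda>y. y"])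
    show "q (s (tens ?A ?B x y)) = tens ?A ?B x y" if "x \<in> carrier ?A" "y \<in> carrier ?B" for x y
      using that s(2)[OF that] unfolding A(3) B(3)
      by (auto simp: i j q(2) lin_closed[OF aV] lin_closed[OF aW] coinvariant_avg[OF V M]
          coinvariant_avg[OF W N])
  qed (auto intro: linI)
  have inv: "act ?T (m, u) (s y) = (\<mu> m * \<nu> u) \<odot>\<^bsub>?T\<^esub> s y"
    if m: "m \<in> M" and u: "u \<in> N" and y: "y \<in> carrier ?C" for m u y
  proof (rule tensor_lin_eqI[OF A(1) B(1) cT lin_comp[OF act(1)[OF MG[OF m] NH[OF u]] s(1)]
        lin_comp[OF scaling_lin[OF cT] s(1)] _ y])
    fix x y assume x: "x \<in> carrier ?A" and y: "y \<in> carrier ?B"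
    obtain v where v: "v \<in> carrier V" "x = ?a v" using x unfolding A(3) by blast
    obtain w where w: "w \<in> carrier W" "y = ?b w" using y unfolding B(3) by blast
    have vw: "avg V M \<mu> v \<in> carrier V" "avg W N \<nu> w \<in> carrier W"
      using lin_closed[OF aV] lin_closed[OF aW] v w by auto
    have "act ?T (m, u) (s (tens ?A ?B x y)) = tens V W (\<mu> m \<odot>\<^bsub>V\<^esub> avg V M \<mu> v) (\<nu> u \<odot>\<^bsub>W\<^esub> avg W N \<nu> w)"
      using s(2)[OF x y] v w vw
      by (simp add: i j act(2)[OF MG[OF m] NH[OF u]] act_avg[OF V M m] act_avg[OF W N u])
    also have "\<dots> = \<mu> m \<odot>\<^bsub>?T\<^esub> (\<nu> u \<odot>\<^bsub>?T\<^esub> tens V W (avg V M \<mu> v) (avg W N \<nu> w))"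
      using lin_smult[OF tens_lin_left[OF cV cW] vw(1)] lin_smult[OF tens_lin_right[OF cV cW vw(1)] vw(2)]
        cspace_smult_closed[OF cW vw(2)] by simp
    also have "\<dots> = (\<mu> m * \<nu> u) \<odot>\<^bsub>?T\<^esub> s (tens ?A ?B x y)"
      using s(2)[OF x y] v w vw by (simp add: i j cspace_smult_assoc[OF cT] tens_closed[OF cV cW])
    finally show "act ?T (m, u) (s (tens ?A ?B x y)) = (\<mu> m * \<nu> u) \<odot>\<^bsub>?T\<^esub> s (tens ?A ?B x y)" .
  qed
  \<comment> \<open>\<open>s \<circ> q\<close> is the average over \<open>M \<times> N\<close>, taken one factor at a time, so it fixes eigenvectors.\<close>
  have stay: "s (q t) = t" if t: "t \<in> carrier ?T"
    and eig: "\<And>m u. m \<in> M \<Longrightarrow> u \<in> N \<Longrightarrow> act ?T (m, u) t = (\<mu> m * \<nu> u) \<odot>\<^bsub>?T\<^esub> t" for t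
  proof -
    let ?T1 = "pullback (\<lambda>m. (m, \<one>\<^bsub>H\<^esub>)) ?T" and ?T2 = "pullback (\<lambda>u. (\<one>\<^bsub>G\<^esub>, u)) ?T"
    have "(\<lambda>m. (m, \<one>\<^bsub>H\<^esub>)) \<in> hom G (G \<times>\<times> H)" "(\<lambda>u. (\<one>\<^bsub>G\<^esub>, u)) \<in> hom H (G \<times>\<times> H)"
      using MG[OF one(1)] NH[OF one(2)] group.is_monoid[OF V'(1)] group.is_monoid[OF W'(1)]
      by (auto simp: hom_def monoid.r_one)
    then have R: "representation G ?T1" "representation H ?T2"
      using representation_pullback[OF representation_tensor[OF V W]] V'(1) W'(1) by blast+
    note a1 = avg_lin[OF R(1) M, simplified] and a2 = avg_lin[OF R(2) N, simplified]
    note c1 = representationD(2)[OF R(1)] and c2 = representationD(2)[OF R(2)]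
    have t1: "avg ?T1 M \<mu> (tens V W v w) = tens V W (avg V M \<mu> v) w"
      if "v \<in> carrier V" "w \<in> carrier W" for v w
      using that MG by (intro avg_map[OF cV c1, symmetric])
        (auto simp: tens_lin_left[OF cV cW] V' W' act(2) NH[OF one(2)])
    have t2: "avg ?T2 N \<nu> (tens V W v w) = tens V W v (avg W N \<nu> w)"
      if "v \<in> carrier V" "w \<in> carrier W" for v w
      using that NH by (intro avg_map[OF cW c2, symmetric])
        (auto simp: tens_lin_right[OF cV cW] V' W' act(2) MG[OF one(1)])
    have "s (q t) = avg ?T1 M \<mu> (avg ?T2 N \<nu> t)"
    proof (rule tensor_lin_eqI[OF cV cW cT lin_comp[OF s(1) q(1)] lin_comp[OF a1 a2] _ t])
      fix v w assume "v \<in> carrier V" "w \<in> carrier W"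
      then show "s (q (tens V W v w)) = avg ?T1 M \<mu> (avg ?T2 N \<nu> (tens V W v w))"
        using lin_closed[OF A(2)] lin_closed[OF B(2)] lin_closed[OF aW]
        by (simp add: q(2) s(2) i j t1 t2)
    qed
    also have "avg ?T2 N \<nu> t = t"
      using eig[OF one(1)] t by (intro avg_fixed'[OF R(2) N]) (auto simp: \<theta>_one[OF V M])
    also have "avg ?T1 M \<mu> t = t"
      using eig[OF _ one(2)] t by (intro avg_fixed'[OF R(1) M]) (auto simp: \<theta>_one[OF W N])
    finally show ?thesis .
  qed
  show thesis
  proof (rule that[OF q(1)])
    fix g h t assume g: "normalizes G M \<mu> g" and h: "normalizes H N \<nu> h" and t: "t \<in> carrier ?T"
    have gh: "g \<in> carrier G" "h \<in> carrier H" using g h by (auto simp: normalizes_def)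
    have gA: "act ?A g (?a v) = ?a (act V g v)" if "v \<in> carrier V" for v
      by (rule coinvariants_act[OF V M g that])
    have hB: "act ?B h (?b w) = ?b (act W h w)" if "w \<in> carrier W" for w
      by (rule coinvariants_act[OF W N h that])
    have lA: "act ?A g \<in> lin ?A ?A"
    proof (rule linI, unfold A(3))
      fix x y assume "x \<in> ?a ` carrier V" "y \<in> ?a ` carrier V"
      then show "act ?A g (x \<oplus>\<^bsub>?A\<^esub> y) = act ?A g x \<oplus>\<^bsub>?A\<^esub> act ?A g y"
        by clarify (simp add: gA lin_add[OF A(2), symmetric] cspace_closed cV V'(6) gh lin_add[OF V'(3)])
    next
      fix c x assume "x \<in> ?a ` carrier V"
      then show "act ?A g (c \<odot>\<^bsub>?A\<^esub> x) = c \<odot>\<^bsub>?A\<^esub> act ?A g x"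
        by clarify (simp add: gA lin_smult[OF A(2), symmetric] cspace_closed cV V'(6) gh lin_smult[OF V'(3)])
    qed (use gA V'(6) gh in auto)
    have lB: "act ?B h \<in> lin ?B ?B"
    proof (rule linI, unfold B(3))
      fix x y assume "x \<in> ?b ` carrier W" "y \<in> ?b ` carrier W"
      then show "act ?B h (x \<oplus>\<^bsub>?B\<^esub> y) = act ?B h x \<oplus>\<^bsub>?B\<^esub> act ?B h y"
        by clarify (simp add: hB lin_add[OF B(2), symmetric] cspace_closed cW W'(6) gh lin_add[OF W'(3)])
    next
      fix c x assume "x \<in> ?b ` carrier W"
      then show "act ?B h (c \<odot>\<^bsub>?B\<^esub> x) = c \<odot>\<^bsub>?B\<^esub> act ?B h x"
        by clarify (simp add: hB lin_smult[OF B(2), symmetric] cspace_closed cW W'(6) gh lin_smult[OF W'(3)])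
    qed (use hB W'(6) gh in auto)
    note AB = tensor_act[OF A(1) B(1) lA lB]
    show "q (act ?T (g, h) t) = act ?C (g, h) (q t)"
      by (rule tensor_lin_eqI[OF cV cW cC lin_comp[OF q(1) act(1)[OF gh]] lin_comp[OF AB(1) q(1)] _ t])
        (simp add: q(2) act(2)[OF gh] AB(2) lin_closed[OF A(2)] lin_closed[OF B(2)] gA hB V'(6) W'(6) gh)
  next
    fix y assume y: "y \<in> carrier ?C"
    show "\<exists>!t. t \<in> carrier ?T \<and> q t = y \<and> (\<forall>m\<in>M. \<forall>u\<in>N. act ?T (m, u) t = (\<mu> m * \<nu> u) \<odot>\<^bsub>?T\<^esub> t)"
    proof (intro ex1I[of _ "s y"] conjI ballI)
      show "s y \<in> carrier ?T" by (rule lin_closed[OF s(1) y])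
      show "q (s y) = y" by (rule qs[OF y])
      show "act ?T (m, u) (s y) = (\<mu> m * \<nu> u) \<odot>\<^bsub>?T\<^esub> s y" if "m \<in> M" "u \<in> N" for m u
        by (rule inv[OF that y])
      show "t = s y" if "t \<in> carrier ?T \<and> q t = y \<and>
          (\<forall>m\<in>M. \<forall>u\<in>N. act ?T (m, u) t = (\<mu> m * \<nu> u) \<odot>\<^bsub>?T\<^esub> t)" for t
        using stay[of t] that by auto
    qed
  qed
qed

section \<open>General linear groups over a finite field\<close>

lemma GL_carrier: "A \<in> carrier (GL n) \<longleftrightarrow> A \<in> carrier_mat n n \<and> det A \<noteq> 0"
  for A :: "'f::field mat"
  using det_non_zero_imp_unit[of A n "()"] unit_imp_det_non_zero[of A n "()"]
  by (auto simp: GL_def units_of_carrier Units_def ring_mat_simps)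

lemma GL_simps [simp]: "mult (GL n) = (*)" "one (GL n) = 1\<^sub>m n"
  by (auto simp: GL_def units_of_def ring_mat_simps)

lemma GL_group: "group (GL n :: 'f::field mat monoid)"
proof -
  interpret ring "ring_mat TYPE('f) n ()" by (rule ring_mat)
  show ?thesis unfolding GL_def by (rule units_group)
qed

lemma finite_carrier_mat: "finite (carrier_mat m n :: 'f::finite mat set)"
proof -
  have "(carrier_mat m n :: 'f mat set) \<subseteq> mat m n ` (({..<m} \<times> {..<n}) \<rightarrow>\<^sub>E UNIV)"
  proof
    fix A :: "'f mat" assume A: "A \<in> carrier_mat m n"
    let ?f = "\<lambda>ij\<in>{..<m} \<times> {..<n}. A $$ ij"
    have e: "A = mat m n ?f" by (rule eq_matI) (use A in auto)
    show "A \<in> mat m n ` (({..<m} \<times> {..<n}) \<rightarrow>\<^sub>E UNIV)"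
      by (subst e, rule imageI) (auto split: if_splits)
  qed
  then show ?thesis by (rule finite_subset) (intro finite_imageI finite_PiE; simp)
qed

text \<open>Left multiplication by \<open>x \<in> S\<close> is an injective, hence surjective, map from \<open>S\<close> to itself.\<close>

lemma finite_closed_subgroup:
  fixes G (structure)
  assumes G: "group G" and S: "finite S" "S \<subseteq> carrier G" "\<one> \<in> S"
    and closed: "\<And>x y. x \<in> S \<Longrightarrow> y \<in> S \<Longrightarrow> x \<otimes> y \<in> S"
  shows "subgroup S G"
proof -
  interpret group G by (rule G)
  have "inv x \<in> S" if x: "x \<in> S" for x
  proof -
    have "inj_on (\<lambda>y. x \<otimes> y) S"
      using x S(2) by (intro inj_onI) (auto simp: subset_iff)
    moreover have "(\<lambda>y. x \<otimes> y) ` S \<subseteq> S" using closed x by auto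
    ultimately have "(\<lambda>y. x \<otimes> y) ` S = S" using S(1) by (simp add: endo_inj_surj)
    then obtain y where y: "y \<in> S" "x \<otimes> y = \<one>" using S(3) by (metis (no_types, lifting) imageE)
    then have "inv x = y" using x S by (metis inv_equality inv_comm subsetD)
    with y show ?thesis by simp
  qed
  then show ?thesis using S closed by (intro subgroup.intro) auto
qed

lemma GL_subgroupI:
  assumes "S \<subseteq> carrier (GL n :: 'f::{field, finite} mat monoid)" "1\<^sub>m n \<in> S"
    "\<And>x y. x \<in> S \<Longrightarrow> y \<in> S \<Longrightarrow> x * y \<in> S"
  shows "subgroup S (GL n)"
proof (rule finite_closed_subgroup[OF GL_group])
  show "finite S"
    by (rule finite_subset[OF _ finite_carrier_mat[of n n]]) (use assms(1) in \<open>auto simp: GL_carrier\<close>)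
qed (use assms in auto)

lemma GL_mult_closed: "A \<in> carrier (GL n) \<Longrightarrow> B \<in> carrier (GL n) \<Longrightarrow> A * B \<in> carrier (GL n)"
  for A :: "'f::field mat"
  by (auto simp: GL_carrier det_mult)

lemma GL_inverse:
  assumes "A \<in> carrier (GL n :: 'f::field mat monoid)"
  obtains B where "B \<in> carrier (GL n)" "A * B = 1\<^sub>m n" "B * A = 1\<^sub>m n"
proof -
  interpret group "GL n :: 'f mat monoid" by (rule GL_group)
  show thesis using that[of "inv\<^bsub>GL n\<^esub> A"] assms r_inv[of A] l_inv[of A] by auto
qed

lemma GL_inv_eqI:
  assumes A: "A \<in> carrier (GL n :: 'f::field mat monoid)" and B: "B \<in> carrier_mat n n" and "B * A = 1\<^sub>m n"
  shows "inv\<^bsub>GL n\<^esub> A = B"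
proof -
  interpret group "GL n :: 'f mat monoid" by (rule GL_group)
  have "det B \<noteq> 0" using det_mult[OF B, of A] A assms(3) by (auto simp: GL_carrier)
  then show ?thesis using assms by (intro inv_equality) (auto simp: GL_carrier)
qed

section \<open>Block triangular matrices\<close>

definition lower_zero :: "nat \<Rightarrow> 'f::zero mat \<Rightarrow> bool" where
  "lower_zero p A \<longleftrightarrow> (\<forall>i<dim_row A. \<forall>j<dim_col A. p \<le> i \<longrightarrow> j < p \<longrightarrow> A $$ (i, j) = 0)"

lemma mult_index: "A \<in> carrier_mat m l \<Longrightarrow> B \<in> carrier_mat l n \<Longrightarrow> i < m \<Longrightarrow> j < n \<Longrightarrow>
    (A * B) $$ (i, j) = (\<Sum>t<l. A $$ (i, t) * B $$ (t, j))"
  by (auto simp: scalar_prod_def lessThan_atLeast0 intro!: sum.cong)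

lemma lower_zero_mult:
  fixes A :: "'f::comm_ring_1 mat"
  assumes A: "A \<in> carrier_mat m m" "lower_zero p A" and B: "B \<in> carrier_mat m m" "lower_zero p B"
  shows "lower_zero p (A * B)"
  unfolding lower_zero_def
proof (intro allI impI)
  fix i j assume "i < dim_row (A * B)" "j < dim_col (A * B)" and ij: "p \<le> i" "j < p"
  then have i: "i < m" and j: "j < m" using A B by auto
  have "A $$ (i, t) * B $$ (t, j) = 0" if "t < m" for t
    using A B i j ij that by (cases "t < p") (auto simp: lower_zero_def)
  then show "(A * B) $$ (i, j) = 0" unfolding mult_index[OF A(1) B(1) i j] by simp
qed

lemma lower_zero_one: "lower_zero p (1\<^sub>m m)"
  by (auto simp: lower_zero_def)

lemma block_zero_iff:
  "get_block ns i j A = 0\<^sub>m (ns ! i) (ns ! j) \<longleftrightarrow>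
    (\<forall>x<ns ! i. \<forall>y<ns ! j. A $$ (sum_list (take i ns) + x, sum_list (take j ns) + y) = 0)"
  by (auto simp: get_block_def mat_eq_iff)

lemma parabolic_two: "parabolic [p, q] = {A \<in> carrier (GL (p + q)). lower_zero p A}"
proof -
  have "(\<forall>i<length [p, q]. \<forall>j<i. get_block [p, q] i j A = 0\<^sub>m ([p, q] ! i) ([p, q] ! j)) \<longleftrightarrow> lower_zero p A"
    if A: "A \<in> carrier_mat (p + q) (p + q)" for A :: "'a mat"
  proof -
    have "lower_zero p A \<longleftrightarrow> (\<forall>x<q. \<forall>y<p. A $$ (p + x, y) = 0)"
      using A by (auto simp: lower_zero_def) (metis add_less_cancel_left le_add_diff_inverse trans_less_add1)
    then show ?thesis unfolding block_zero_iff by (auto simp: less_Suc_eq)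
  qed
  then show ?thesis by (auto simp: parabolic_def GL_carrier)
qed

lemma parabolic_three:
  assumes k: "2 * k \<le> r" "r \<le> n + k"
  shows "parabolic (P_sizes n r k) = {A \<in> carrier (GL n). lower_zero k A \<and> lower_zero (r - k) A}"
proof -
  have s: "sum_list (P_sizes n r k) = n" using k by (simp add: P_sizes_def)
  have "(\<forall>i<length (P_sizes n r k). \<forall>j<i. get_block (P_sizes n r k) i j A =
      0\<^sub>m (P_sizes n r k ! i) (P_sizes n r k ! j)) \<longleftrightarrow> lower_zero k A \<and> lower_zero (r - k) A"
    (is "?L \<longleftrightarrow> ?R") if A: "A \<in> carrier_mat n n" for A :: "'a mat"
  proof -
    have L: "?L \<longleftrightarrow> (\<forall>x<r - 2 * k. \<forall>y<k. A $$ (k + x, y) = 0) \<and>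
        (\<forall>x<n + k - r. \<forall>y<k. A $$ (r - k + x, y) = 0) \<and>
        (\<forall>x<n + k - r. \<forall>y<r - 2 * k. A $$ (r - k + x, k + y) = 0)"
      unfolding block_zero_iff using k by (auto simp: P_sizes_def less_Suc_eq numeral_3_eq_3)
    show ?thesis
    proof
      assume ?L
      note z = this[unfolded L]
      have "A $$ (i, j) = 0" if "i < n" "k \<le> i" "j < k" for i j
        using z[THEN conjunct1, rule_format, of "i - k" j]
          z[THEN conjunct2, THEN conjunct1, rule_format, of "i - (r - k)" j] that k
        by (cases "i < r - k") auto
      moreover have "A $$ (i, j) = 0" if "i < n" "r - k \<le> i" "j < r - k" for i j
        using z[THEN conjunct2, THEN conjunct2, rule_format, of "i - (r - k)" "j - k"]
          z[THEN conjunct2, THEN conjunct1, rule_format, of "i - (r - k)" j] that k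
        by (cases "j < k") auto
      ultimately show ?R using A by (auto simp: lower_zero_def)
    next
      assume ?R
      then show ?L unfolding L using A k by (auto simp: lower_zero_def)
    qed
  qed
  then show ?thesis by (auto simp: parabolic_def s GL_carrier)
qed

lemma subgroup_lower_zero:
  "subgroup {A \<in> carrier (GL m). lower_zero p A \<and> lower_zero q A} (GL m :: 'f::{field, finite} mat monoid)"
  by (rule GL_subgroupI) (auto simp: GL_mult_closed lower_zero_one lower_zero_mult GL_carrier det_mult)

lemma get_block_two:
  assumes "a \<in> carrier_mat p p" "b \<in> carrier_mat p q" "c \<in> carrier_mat q p" "d \<in> carrier_mat q q"
  shows "get_block [p, q] 0 0 (four_block_mat a b c d) = a"
    "get_block [p, q] 1 1 (four_block_mat a b c d) = d"
    "get_block [p, q] 0 1 (four_block_mat a b c d) = b"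
  using assms by (auto simp: get_block_def intro!: eq_matI)

lemma lower_zero_cases:
  fixes A :: "'f::field mat"
  assumes A: "A \<in> carrier (GL (p + q))" "lower_zero p A"
  obtains a b d where "a \<in> carrier (GL p)" "b \<in> carrier_mat p q" "d \<in> carrier (GL q)"
    "A = four_block_mat a b (0\<^sub>m q p) d"
proof -
  let ?a = "mat p p (\<lambda>(i, j). A $$ (i, j))" and ?b = "mat p q (\<lambda>(i, j). A $$ (i, p + j))"
    and ?d = "mat q q (\<lambda>(i, j). A $$ (p + i, p + j))"
  have e: "A = four_block_mat ?a ?b (0\<^sub>m q p) ?d"
    by (rule eq_matI) (use A in \<open>auto simp: GL_carrier lower_zero_def\<close>)
  have "det A = det ?a * det ?d"
    by (subst e, rule det_four_block_mat_lower_left_zero) auto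
  then show thesis using e A by (intro that[of ?a ?b ?d]) (auto simp: GL_carrier)
qed

lemma diagonal_blocks_hom:
  "(\<lambda>A. (get_block [p, q] 0 0 A, get_block [p, q] 1 1 A)) \<in>
    hom (GL (p + q) \<lparr>carrier := parabolic [p, q]\<rparr>) (GL p \<times>\<times> (GL q :: 'f::field mat monoid))"
proof (rule homI)
  fix A :: "'f mat" assume "A \<in> carrier (GL (p + q) \<lparr>carrier := parabolic [p, q]\<rparr>)"
  then have "A \<in> carrier (GL (p + q))" "lower_zero p A" by (auto simp: parabolic_two)
  from lower_zero_cases[OF this] obtain a b d where
    "a \<in> carrier (GL p)" "b \<in> carrier_mat p q" "d \<in> carrier (GL q)" "A = four_block_mat a b (0\<^sub>m q p) d" .
  then show "(get_block [p, q] 0 0 A, get_block [p, q] 1 1 A) \<in> carrier (GL p \<times>\<times> GL q)"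
    using get_block_two[of a p b q "0\<^sub>m q p" d] by (simp add: GL_carrier)
next
  fix A B :: "'f mat" assume "A \<in> carrier (GL (p + q) \<lparr>carrier := parabolic [p, q]\<rparr>)"
    "B \<in> carrier (GL (p + q) \<lparr>carrier := parabolic [p, q]\<rparr>)"
  then have "A \<in> carrier (GL (p + q))" "lower_zero p A" "B \<in> carrier (GL (p + q))" "lower_zero p B"
    by (auto simp: parabolic_two)
  then obtain a b d a' b' d' where
    A: "a \<in> carrier (GL p)" "b \<in> carrier_mat p q" "d \<in> carrier (GL q)" "A = four_block_mat a b (0\<^sub>m q p) d" and
    B: "a' \<in> carrier (GL p)" "b' \<in> carrier_mat p q" "d' \<in> carrier (GL q)" "B = four_block_mat a' b' (0\<^sub>m q p) d'"
    using lower_zero_cases by metis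
  note c = A(1-3)[unfolded GL_carrier] B(1-3)[unfolded GL_carrier]
  have m: "a * a' \<in> carrier_mat p p" "a * b' + b * d' \<in> carrier_mat p q" "d * d' \<in> carrier_mat q q"
    using c by auto
  have "A * B = four_block_mat (a * a') (a * b' + b * d') (0\<^sub>m q p) (d * d')"
    unfolding A(4) B(4) using c by (subst mult_four_block_mat[of _ p p _ q _ q _ _ p _ q]) auto
  then show "(get_block [p, q] 0 0 (A \<otimes>\<^bsub>GL (p + q)\<lparr>carrier := parabolic [p, q]\<rparr>\<^esub> B),
      get_block [p, q] 1 1 (A \<otimes>\<^bsub>GL (p + q)\<lparr>carrier := parabolic [p, q]\<rparr>\<^esub> B)) =
    (get_block [p, q] 0 0 A, get_block [p, q] 1 1 A) \<otimes>\<^bsub>GL p \<times>\<times> GL q\<^esub>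
    (get_block [p, q] 0 0 B, get_block [p, q] 1 1 B)"
    using c get_block_two[of a p b q "0\<^sub>m q p" d] get_block_two[of a' p b' q "0\<^sub>m q p" d']
      get_block_two[OF m(1,2) zero_carrier_mat m(3)] A(4) B(4)
    by simp
qed

text \<open>Otherwise every permutation moves some index \<open>\<ge> a\<close> to one below \<open>b\<close>, so that each term of the Leibniz
  formula vanishes.\<close>

lemma zero_block_bound:
  fixes A :: "'f::field mat"
  assumes A: "A \<in> carrier (GL n)" and z: "\<And>i j. i < n \<Longrightarrow> a \<le> i \<Longrightarrow> j < b \<Longrightarrow> A $$ (i, j) = 0"
    and b: "b \<le> n" and a: "a \<le> n"
  shows "b \<le> a"
proof (rule ccontr)
  assume ba: "\<not> b \<le> a"
  have Ac: "A \<in> carrier_mat n n" using A by (simp add: GL_carrier)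
  have "(\<Prod>i = 0..<n. A $$ (i, p i)) = 0" if p: "p permutes {0..<n}" for p
  proof -
    have "\<exists>i\<in>{a..<n}. p i < b"
    proof (rule ccontr)
      assume "\<not> ?thesis"
      then have "p ` {a..<n} \<subseteq> {b..<n}" using permutes_in_image[OF p] by (auto simp: not_less)
      then have "card (p ` {a..<n}) \<le> card {b..<n}" by (intro card_mono) auto
      moreover have "card (p ` {a..<n}) = card {a..<n}"
        by (rule card_image) (use permutes_inj[OF p] in \<open>auto simp: inj_on_def\<close>)
      ultimately show False using ba b a by simp
    qed
    then obtain i where "i \<in> {a..<n}" "p i < b" by blast
    then have "i \<in> {0..<n}" "A $$ (i, p i) = 0" using z by auto
    then show ?thesis by (intro prod_zero) blast+
  qed
  then have "det A = 0" unfolding det_def'[OF Ac] by (intro sum.neutral) auto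
  then show False using A by (simp add: GL_carrier)
qed

section \<open>Unipotent groups with one off-diagonal block\<close>

definition upper_unip :: "nat \<Rightarrow> nat \<Rightarrow> 'f::field mat set" where
  "upper_unip p q = {four_block_mat (1\<^sub>m p) X (0\<^sub>m q p) (1\<^sub>m q) | X. X \<in> carrier_mat p q}"

text \<open>A partial trace of the upper right block. For \<open>(d, p)\<close> equal to \<open>(0, n)\<close>, \<open>(0, k)\<close> and
  \<open>(r - 2 k, n - k)\<close> this gives the characters \<open>\<psi>\<close>, \<open>\<psi>\<^bsub>k,1\<^esub>\<close> and \<open>\<psi>\<^bsub>k,2\<^esub>\<close>.\<close>

definition upper_char :: "('f::field \<Rightarrow> complex) \<Rightarrow> nat \<Rightarrow> nat \<Rightarrow> 'f mat \<Rightarrow> complex" where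
  "upper_char \<psi>0 d p A = \<psi>0 (\<Sum>i<p - d. A $$ (d + i, p + i))"

lemma upper_char_block:
  assumes "X \<in> carrier_mat p q" "d \<le> p" "p - d \<le> q"
  shows "upper_char \<psi>0 d p (four_block_mat (1\<^sub>m p) X (0\<^sub>m q p) (1\<^sub>m q)) = \<psi>0 (\<Sum>i<p - d. X $$ (d + i, i))"
  unfolding upper_char_def using assms by (intro arg_cong[of _ _ \<psi>0] sum.cong) auto

lemma upper_unip_mult:
  assumes "X \<in> carrier_mat p q" "Y \<in> carrier_mat p q"
  shows "four_block_mat (1\<^sub>m p) X (0\<^sub>m q p) (1\<^sub>m q) * four_block_mat (1\<^sub>m p) Y (0\<^sub>m q p) (1\<^sub>m q) =
    four_block_mat (1\<^sub>m p) (X + Y) (0\<^sub>m q p) (1\<^sub>m q :: 'f::field mat)"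
  using assms by (subst mult_four_block_mat[of _ p p _ q _ q _ _ p _ q]) (auto simp: comm_add_mat[of _ p q])

lemma upper_unip_GL: "upper_unip p q \<subseteq> carrier (GL (p + q))"
proof
  fix A :: "'a mat" assume "A \<in> upper_unip p q"
  then obtain X where X: "X \<in> carrier_mat p q" "A = four_block_mat (1\<^sub>m p) X (0\<^sub>m q p) (1\<^sub>m q)"
    by (auto simp: upper_unip_def)
  then have "det A = det (1\<^sub>m p :: 'a mat) * det (1\<^sub>m q :: 'a mat)"
    using det_four_block_mat_lower_left_zero[of "1\<^sub>m p" p X q "0\<^sub>m q p" "1\<^sub>m q"] by auto
  then show "A \<in> carrier (GL (p + q))" using X by (auto simp: GL_carrier)
qed

lemma upper_unip_finite_character:
  fixes \<psi>0 :: "'f::{field, finite} \<Rightarrow> complex"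
  assumes \<psi>0: "nontrivial_additive_character \<psi>0" and d: "d \<le> p" "p - d \<le> q"
  shows "finite_character (GL (p + q)) (upper_unip p q) (upper_char \<psi>0 d p)"
  unfolding finite_character_def
proof (intro conjI ballI)
  show "subgroup (upper_unip p q) (GL (p + q) :: 'f mat monoid)"
  proof (rule GL_subgroupI[OF upper_unip_GL])
    show "1\<^sub>m (p + q) \<in> (upper_unip p q :: 'f mat set)"
      unfolding upper_unip_def mem_Collect_eq by (rule exI[of _ "0\<^sub>m p q"]) simp
    fix A B :: "'f mat" assume "A \<in> upper_unip p q" "B \<in> upper_unip p q"
    then obtain X Y where X: "X \<in> carrier_mat p q" "A = four_block_mat (1\<^sub>m p) X (0\<^sub>m q p) (1\<^sub>m q)"
      and Y: "Y \<in> carrier_mat p q" "B = four_block_mat (1\<^sub>m p) Y (0\<^sub>m q p) (1\<^sub>m q)"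
      unfolding upper_unip_def by blast
    have "X + Y \<in> carrier_mat p q" using X(1) Y(1) by simp
    then show "A * B \<in> upper_unip p q"
      unfolding X(2) Y(2) upper_unip_mult[OF X(1) Y(1)] upper_unip_def by blast
  qed
  show "finite (upper_unip p q :: 'f mat set)"
    by (rule finite_subset[OF order.trans[OF upper_unip_GL] finite_carrier_mat[of "p + q" "p + q"]])
      (auto simp: GL_carrier)
  have add: "\<psi>0 (x + y) = \<psi>0 x * \<psi>0 y" and zero: "\<psi>0 0 = 1" for x y
    using \<psi>0 by (auto simp: nontrivial_additive_character_def)
  show "upper_char \<psi>0 d p (A \<otimes>\<^bsub>GL (p + q)\<^esub> B) = upper_char \<psi>0 d p A * upper_char \<psi>0 d p B"
    if AB: "A \<in> upper_unip p q" "B \<in> upper_unip p q" for A B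
  proof -
    obtain X Y where X: "X \<in> carrier_mat p q" "A = four_block_mat (1\<^sub>m p) X (0\<^sub>m q p) (1\<^sub>m q)"
      and Y: "Y \<in> carrier_mat p q" "B = four_block_mat (1\<^sub>m p) Y (0\<^sub>m q p) (1\<^sub>m q)"
      using AB unfolding upper_unip_def by blast
    have "(\<Sum>i<p - d. (X + Y) $$ (d + i, i)) = (\<Sum>i<p - d. X $$ (d + i, i)) + (\<Sum>i<p - d. Y $$ (d + i, i))"
      using X Y d by (subst sum.distrib[symmetric], intro sum.cong) auto
    then show ?thesis
      using X Y d by (simp add: upper_unip_mult upper_char_block add)
  qed
  have "\<psi>0 x * \<psi>0 (- x) = 1" for x using add[of x "- x"] zero by simp
  then show "upper_char \<psi>0 d p A \<noteq> 0" for A unfolding upper_char_def by (metis mult_zero_left zero_neq_one)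
qed

lemma mat_trace_comm:
  fixes A B :: "'f::comm_ring_1 mat"
  assumes A: "A \<in> carrier_mat m n" and B: "B \<in> carrier_mat n m"
  shows "mat_trace (A * B) = mat_trace (B * A)"
proof -
  have "mat_trace (A * B) = (\<Sum>i<m. \<Sum>j<n. A $$ (i, j) * B $$ (j, i))"
    using A by (auto simp: mat_trace_def mult_index[OF A B] intro!: sum.cong)
  also have "\<dots> = (\<Sum>j<n. \<Sum>i<m. B $$ (j, i) * A $$ (i, j))"
    by (subst sum.swap) (simp add: mult.commute)
  also have "\<dots> = mat_trace (B * A)"
    using B by (auto simp: mat_trace_def mult_index[OF B A] intro!: sum.cong)
  finally show ?thesis .
qed

text \<open>The matrix \<open>J\<close> for which the partial trace of \<open>X\<close> in \<open>upper_char\<close> is the trace of \<open>J X\<close>.\<close>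

definition shift_mat :: "nat \<Rightarrow> nat \<Rightarrow> nat \<Rightarrow> 'f::field mat" where
  "shift_mat d p q = mat q p (\<lambda>(i, j). if i < p - d \<and> j = d + i then 1 else 0)"

lemma shift_mat_trace:
  assumes X: "X \<in> carrier_mat p q" and d: "d \<le> p" "p - d \<le> q"
  shows "mat_trace (shift_mat d p q * X) = (\<Sum>i<p - d. X $$ (d + i, i :: nat))"
proof -
  have J: "shift_mat d p q \<in> carrier_mat q p" by (simp add: shift_mat_def)
  have "(shift_mat d p q * X) $$ (i, i) = (if i < p - d then X $$ (d + i, i) else 0)" if i: "i < q" for i
  proof -
    have "(shift_mat d p q * X) $$ (i, i) =
        (\<Sum>t<p. if t = d + i then (if i < p - d then X $$ (t, i) else 0) else 0)"
      unfolding mult_index[OF J X i i] using i by (intro sum.cong) (auto simp: shift_mat_def)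
    also have "\<dots> = (if i < p - d then X $$ (d + i, i) else 0)" by (subst sum.delta) auto
    finally show ?thesis .
  qed
  then have "mat_trace (shift_mat d p q * X) = (\<Sum>i<q. if i < p - d then X $$ (d + i, i) else 0)"
    using carrier_matD(1)[OF J] by (auto simp: mat_trace_def intro!: sum.cong)
  also have "\<dots> = (\<Sum>i<p - d. X $$ (d + i, i))"
    using d by (intro sum.mono_neutral_cong_right) auto
  finally show ?thesis .
qed

text \<open>Conjugation by \<open>g\<close> replaces \<open>X\<close> by \<open>X' = A X B\<inverse>\<close>. If \<open>J A = B J\<close>, then \<open>J X' = B (J X) B\<inverse>\<close> has the
  same trace as \<open>J X\<close>.\<close>

lemma upper_unip_normalizes:
  fixes \<psi>0 :: "'f::{field, finite} \<Rightarrow> complex"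
  assumes d: "d \<le> p" "p - d \<le> q"
    and A: "A \<in> carrier (GL p)" and C: "C \<in> carrier_mat p q" and B: "B \<in> carrier (GL q)"
    and J: "shift_mat d p q * A = B * shift_mat d p q"
  shows "normalizes (GL (p + q)) (upper_unip p q) (upper_char \<psi>0 d p) (four_block_mat A C (0\<^sub>m q p) B)"
proof -
  interpret group "GL (p + q) :: 'f mat monoid" by (rule GL_group)
  let ?g = "four_block_mat A C (0\<^sub>m q p) B" and ?J = "shift_mat d p q :: 'f mat"
  obtain B' where B': "B' \<in> carrier_mat q q" "B' * B = 1\<^sub>m q"
    using GL_inverse[OF B] unfolding GL_carrier by metis
  have Ac: "A \<in> carrier_mat p p" and Bc: "B \<in> carrier_mat q q" using A B by (auto simp: GL_carrier)
  have Jc: "?J \<in> carrier_mat q p" by (simp add: shift_mat_def)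
  have "det ?g = det A * det B" by (rule det_four_block_mat_lower_left_zero[OF Ac C _ Bc]) simp
  then have g: "?g \<in> carrier (GL (p + q))" using A B C by (auto simp: GL_carrier)
  show ?thesis
    unfolding normalizes_def
  proof (intro conjI ballI)
    fix u :: "'f mat" assume u: "u \<in> upper_unip p q"
    then obtain X where X: "X \<in> carrier_mat p q" "u = four_block_mat (1\<^sub>m p) X (0\<^sub>m q p) (1\<^sub>m q)"
      unfolding upper_unip_def by blast
    define X' where "X' = A * X * B'"
    have X': "X' \<in> carrier_mat p q" unfolding X'_def using Ac X B' by auto
    define u' where "u' = four_block_mat (1\<^sub>m p) X' (0\<^sub>m q p) (1\<^sub>m q)"
    have XB: "X' * B = A * X"
      unfolding X'_def using Ac X(1) B' Bc assoc_mult_mat[of "A * X" p q B' q B q] by simp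
    have "u' * ?g = four_block_mat A (C + X' * B) (0\<^sub>m q p) B"
      unfolding u'_def using X' Ac Bc C by (subst mult_four_block_mat[of _ p p _ q _ q _ _ p _ q]) auto
    also have "\<dots> = four_block_mat A (A * X + C) (0\<^sub>m q p) B"
      unfolding XB using Ac X C by (subst comm_add_mat[of C p q "A * X"]) auto
    also have "\<dots> = ?g * u"
      unfolding X(2) using X Ac Bc C by (subst mult_four_block_mat[of _ p p _ q _ q _ _ p _ q]) auto
    finally have e: "u' * ?g = ?g * u" .
    have uG: "u \<in> carrier (GL (p + q))" "u' \<in> carrier (GL (p + q))" "u' \<in> upper_unip p q"
      using upper_unip_GL u X' unfolding u'_def upper_unip_def by blast+
    have eq: "?g \<otimes>\<^bsub>GL (p + q)\<^esub> u \<otimes>\<^bsub>GL (p + q)\<^esub> inv\<^bsub>GL (p + q)\<^esub> ?g = u'"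
      using inv_solve_right[of u' "?g * u" ?g] uG g e GL_mult_closed[OF g uG(1)] by simp
    have "?J * X' = ?J * (A * X) * B'"
      unfolding X'_def using Jc Ac X(1) B'(1) by (intro assoc_mult_mat[symmetric]) auto
    also have "?J * (A * X) = B * ?J * X"
      unfolding J[symmetric] using Jc Ac X(1) by (intro assoc_mult_mat[symmetric]) auto
    also have "\<dots> = B * (?J * X)" using Jc Bc X(1) by (intro assoc_mult_mat) auto
    also have "\<dots> * B' = B * (?J * X * B')" using Jc Bc X(1) B'(1) by (intro assoc_mult_mat) auto
    finally have "mat_trace (?J * X') = mat_trace (B * (?J * X * B'))" by simp
    also have "\<dots> = mat_trace ((?J * X * B') * B)"
      by (rule mat_trace_comm[OF Bc]) (use Jc X B' in auto)
    also have "(?J * X * B') * B = ?J * X"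
      using Jc X(1) B' Bc assoc_mult_mat[of "?J * X" q q B' q B q] by simp
    finally have "upper_char \<psi>0 d p u' = upper_char \<psi>0 d p u"
      unfolding u'_def X(2) using X X' d by (simp add: upper_char_block shift_mat_trace)
    then show "?g \<otimes>\<^bsub>GL (p + q)\<^esub> u \<otimes>\<^bsub>GL (p + q)\<^esub> inv\<^bsub>GL (p + q)\<^esub> ?g \<in> upper_unip p q"
      "upper_char \<psi>0 d p (?g \<otimes>\<^bsub>GL (p + q)\<^esub> u \<otimes>\<^bsub>GL (p + q)\<^esub> inv\<^bsub>GL (p + q)\<^esub> ?g) = upper_char \<psi>0 d p u"
      unfolding eq using uG by auto
  qed (rule g)
qed

section \<open>Permutation matrices\<close>

definition perm_mat :: "nat \<Rightarrow> (nat \<Rightarrow> nat) \<Rightarrow> 'f::field mat" where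
  "perm_mat m \<sigma> = mat m m (\<lambda>(i, j). if \<sigma> i = j then 1 else 0)"

lemma perm_mat_mult:
  assumes M: "M \<in> carrier_mat m l" and \<sigma>: "\<And>i. i < m \<Longrightarrow> \<sigma> i < m"
  shows "perm_mat m \<sigma> * M = mat m l (\<lambda>(i, j). M $$ (\<sigma> i, j))"
proof (rule eq_matI)
  have P: "perm_mat m \<sigma> \<in> carrier_mat m m" by (simp add: perm_mat_def)
  fix i j assume "i < dim_row (mat m l (\<lambda>(i, j). M $$ (\<sigma> i, j)))" "j < dim_col (mat m l (\<lambda>(i, j). M $$ (\<sigma> i, j)))"
  then have ij: "i < m" "j < l" by auto
  have "(perm_mat m \<sigma> * M) $$ (i, j) = (\<Sum>t<m. if t = \<sigma> i then M $$ (t, j) else 0)"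
    unfolding mult_index[OF P M ij] using ij by (intro sum.cong) (auto simp: perm_mat_def)
  also have "\<dots> = M $$ (\<sigma> i, j)" using \<sigma>[OF ij(1)] by simp
  finally show "(perm_mat m \<sigma> * M) $$ (i, j) = mat m l (\<lambda>(i, j). M $$ (\<sigma> i, j)) $$ (i, j)" using ij by simp
qed (use M in \<open>auto simp: perm_mat_def\<close>)

lemma mult_perm_mat_transpose:
  assumes M: "M \<in> carrier_mat l m" and \<sigma>: "\<And>i. i < m \<Longrightarrow> \<sigma> i < m"
  shows "M * transpose_mat (perm_mat m \<sigma>) = mat l m (\<lambda>(i, j). M $$ (i, \<sigma> j))"
proof (rule eq_matI)
  have P: "transpose_mat (perm_mat m \<sigma>) \<in> carrier_mat m m" by (simp add: perm_mat_def)
  fix i j assume "i < dim_row (mat l m (\<lambda>(i, j). M $$ (i, \<sigma> j)))" "j < dim_col (mat l m (\<lambda>(i, j). M $$ (i, \<sigma> j)))"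
  then have ij: "i < l" "j < m" by auto
  have "(M * transpose_mat (perm_mat m \<sigma>)) $$ (i, j) = (\<Sum>t<m. if t = \<sigma> j then M $$ (i, t) else 0)"
    unfolding mult_index[OF M P ij] using ij by (intro sum.cong) (auto simp: perm_mat_def)
  also have "\<dots> = M $$ (i, \<sigma> j)" using \<sigma>[OF ij(2)] by simp
  finally show "(M * transpose_mat (perm_mat m \<sigma>)) $$ (i, j) = mat l m (\<lambda>(i, j). M $$ (i, \<sigma> j)) $$ (i, j)"
    using ij by simp
qed (use M in \<open>auto simp: perm_mat_def\<close>)

lemma perm_mat_inverse:
  assumes \<sigma>: "\<And>i. i < m \<Longrightarrow> \<sigma> i < m" and inj: "inj_on \<sigma> {..<m}"
  shows "perm_mat m \<sigma> \<in> carrier (GL m :: 'f::field mat monoid)"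
    "inv\<^bsub>GL m\<^esub> (perm_mat m \<sigma> :: 'f mat) = transpose_mat (perm_mat m \<sigma>)"
proof -
  let ?P = "perm_mat m \<sigma> :: 'f mat"
  have P: "?P \<in> carrier_mat m m" by (simp add: perm_mat_def)
  have PT: "transpose_mat ?P \<in> carrier_mat m m" by (simp add: perm_mat_def)
  have "?P * transpose_mat ?P = mat m m (\<lambda>(i, j). ?P $$ (i, \<sigma> j))"
    by (rule mult_perm_mat_transpose[OF P]) (rule \<sigma>)
  also have "\<dots> = 1\<^sub>m m"
    using \<sigma> by (intro eq_matI) (simp_all add: perm_mat_def inj_on_eq_iff[OF inj])
  finally have 1: "?P * transpose_mat ?P = 1\<^sub>m m" .
  then have "det ?P * det (transpose_mat ?P) = 1" using det_mult[OF P PT] by simp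
  then show G: "?P \<in> carrier (GL m)" using P by (auto simp: GL_carrier)
  show "inv\<^bsub>GL m\<^esub> ?P = transpose_mat ?P"
    by (rule GL_inv_eqI[OF G PT mat_mult_left_right_inverse[OF P PT 1]])
qed

lemma perm_mat_conj:
  assumes M: "M \<in> carrier_mat m m" and \<sigma>: "\<And>i. i < m \<Longrightarrow> \<sigma> i < m" "\<And>i. i < m \<Longrightarrow> \<sigma>' i < m"
    and inj: "inj_on \<sigma>' {..<m}"
  shows "perm_mat m \<sigma> * M * inv\<^bsub>GL m\<^esub> (perm_mat m \<sigma>') = mat m m (\<lambda>(i, j). M $$ (\<sigma> i, \<sigma>' j))"
proof -
  have "inv\<^bsub>GL m\<^esub> (perm_mat m \<sigma>' :: 'a mat) = transpose_mat (perm_mat m \<sigma>')"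
    by (rule perm_mat_inverse(2)[OF _ inj]) (rule \<sigma>(2))
  moreover have "perm_mat m \<sigma> * M = mat m m (\<lambda>(i, j). M $$ (\<sigma> i, j))"
    by (rule perm_mat_mult[OF M]) (rule \<sigma>(1))
  moreover have "mat m m (\<lambda>(i, j). M $$ (\<sigma> i, j)) * transpose_mat (perm_mat m \<sigma>') =
      mat m m (\<lambda>(i, j). mat m m (\<lambda>(i, j). M $$ (\<sigma> i, j)) $$ (i, \<sigma>' j))"
    by (rule mult_perm_mat_transpose) (simp_all add: \<sigma>(2))
  moreover have "\<dots> = mat m m (\<lambda>(i, j). M $$ (\<sigma> i, \<sigma>' j))"
    by (rule eq_matI) (auto simp: \<sigma>)
  ultimately show ?thesis by simp
qed

section \<open>Rank normal form\<close>

lemma block_upper_GL: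
  assumes "A \<in> carrier (GL p)" "C \<in> carrier_mat p q" "B \<in> carrier (GL q)"
  shows "four_block_mat A C (0\<^sub>m q p) B \<in> carrier (GL (p + q) :: 'f::field mat monoid)"
  using assms det_four_block_mat_lower_left_zero[of A p C q "0\<^sub>m q p" B] by (auto simp: GL_carrier)

lemma block_lower_GL:
  assumes "A \<in> carrier (GL p)" "C \<in> carrier_mat q p" "B \<in> carrier (GL q)"
  shows "four_block_mat A (0\<^sub>m p q) C B \<in> carrier (GL (p + q) :: 'f::field mat monoid)"
  using assms det_four_block_mat_upper_right_zero[of A p "0\<^sub>m p q" q C B] by (auto simp: GL_carrier)

lemma one_GL: "1\<^sub>m n \<in> carrier (GL n :: 'f::field mat monoid)"
  by (simp add: GL_carrier)

text \<open>Permuting rows and columns moves a nonzero entry to the upper left corner; one step of elimination on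
  rows and on columns clears its row and column.\<close>

lemma pivot:
  fixes U :: "'f::field mat"
  assumes U: "U \<in> carrier_mat (Suc s) (Suc n)" and ij: "i < Suc s" "j < Suc n" and nz: "U $$ (i, j) \<noteq> 0"
  obtains D E R where "D \<in> carrier (GL (Suc s))" "E \<in> carrier (GL (Suc n))" "R \<in> carrier_mat s n"
    "D * U * E = four_block_mat (1\<^sub>m 1) (0\<^sub>m 1 n) (0\<^sub>m s 1) R"
proof -
  define P :: "'f mat" where "P = perm_mat (Suc s) (Transposition.transpose 0 i)"
  define Q :: "'f mat" where "Q = perm_mat (Suc n) (Transposition.transpose 0 j)"
  have t: "Transposition.transpose 0 i x < Suc m" if "x < Suc m" "i < Suc m" for i x m
    using that by (auto simp: Transposition.transpose_def)
  have P: "P \<in> carrier (GL (Suc s))" unfolding P_def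
    by (rule perm_mat_inverse(1)) (use t ij in auto)
  have QT: "transpose_mat Q \<in> carrier (GL (Suc n))"
  proof -
    have "Q \<in> carrier (GL (Suc n))" unfolding Q_def
      by (rule perm_mat_inverse(1)) (use t ij in auto)
    then show ?thesis by (auto simp: GL_carrier det_transpose)
  qed
  define M where "M = P * U * transpose_mat Q"
  have Pc: "P \<in> carrier_mat (Suc s) (Suc s)" and Qc: "transpose_mat Q \<in> carrier_mat (Suc n) (Suc n)"
    using P QT by (auto simp: GL_carrier)
  have Mc: "M \<in> carrier_mat (Suc s) (Suc n)" using Pc U Qc by (auto simp: M_def)
  have "P * U = mat (Suc s) (Suc n) (\<lambda>(x, y). U $$ (Transposition.transpose 0 i x, y))"
    unfolding P_def by (rule perm_mat_mult[OF U]) (use t ij in auto)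
  then have "M = mat (Suc s) (Suc n) (\<lambda>(x, y). (P * U) $$ (x, Transposition.transpose 0 j y))"
    unfolding M_def Q_def by (intro mult_perm_mat_transpose) (use t ij in auto)
  then have M00: "M $$ (0, 0) \<noteq> 0"
    using nz ij \<open>P * U = _\<close> by simp
  define a where "a = M $$ (0, 0)"
  define \<alpha> \<beta> \<gamma> \<delta> where "\<alpha> = mat 1 1 (\<lambda>_. a)" and "\<beta> = mat 1 n (\<lambda>(x, y). M $$ (0, Suc y))"
    and "\<gamma> = mat s 1 (\<lambda>(x, y). M $$ (Suc x, 0))" and "\<delta> = mat s n (\<lambda>(x, y). M $$ (Suc x, Suc y))"
  have M: "M = four_block_mat \<alpha> \<beta> \<gamma> \<delta>"
    by (rule eq_matI) (use Mc in \<open>auto simp: \<alpha>_def \<beta>_def \<gamma>_def \<delta>_def a_def not_less_eq less_Suc_eq_0_disj\<close>)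
  have c: "\<alpha> \<in> carrier_mat 1 1" "\<beta> \<in> carrier_mat 1 n" "\<gamma> \<in> carrier_mat s 1" "\<delta> \<in> carrier_mat s n"
    by (auto simp: \<alpha>_def \<beta>_def \<gamma>_def \<delta>_def)
  define \<alpha>' where "\<alpha>' = (mat 1 1 (\<lambda>_. inverse a) :: 'f mat)"
  have \<alpha>': "\<alpha>' \<in> carrier (GL 1)"
    using M00 by (auto simp: \<alpha>'_def GL_carrier det_single a_def)
  have \<alpha>'c: "\<alpha>' \<in> carrier_mat 1 1" by (simp add: \<alpha>'_def)
  have aa: "\<alpha>' * \<alpha> = 1\<^sub>m 1"
    using M00 by (intro eq_matI) (auto simp: \<alpha>'_def \<alpha>_def a_def scalar_prod_def)
  define D where "D = four_block_mat \<alpha>' (0\<^sub>m 1 s) (- (\<gamma> * \<alpha>')) (1\<^sub>m s)"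
  define E where "E = four_block_mat (1\<^sub>m 1) (- (\<alpha>' * \<beta>)) (0\<^sub>m n 1) (1\<^sub>m n)"
  have gc: "- (\<gamma> * \<alpha>') \<in> carrier_mat s 1" and bc: "\<alpha>' * \<beta> \<in> carrier_mat 1 n" "- (\<alpha>' * \<beta>) \<in> carrier_mat 1 n"
    using c \<alpha>'c by auto
  have D: "D \<in> carrier (GL (Suc s))" unfolding D_def
    using block_lower_GL[OF \<alpha>' gc one_GL] by simp
  have E: "E \<in> carrier (GL (Suc n))" unfolding E_def
    using block_upper_GL[OF one_GL bc(2) one_GL] by simp
  define R where "R = - (\<gamma> * \<alpha>') * \<beta> + \<delta>"
  have R: "R \<in> carrier_mat s n" unfolding R_def using gc c by auto
  have z: "- (\<gamma> * \<alpha>') * \<alpha> + \<gamma> = 0\<^sub>m s 1"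
  proof -
    have "- (\<gamma> * \<alpha>') * \<alpha> = - (\<gamma> * (\<alpha>' * \<alpha>))"
      using c \<alpha>'c by (simp add: assoc_mult_mat[of \<gamma> s 1 \<alpha>' 1 \<alpha> 1])
    then show ?thesis using c by (simp add: aa uminus_l_inv_mat)
  qed
  have "D * M = four_block_mat (1\<^sub>m 1) (\<alpha>' * \<beta>) (0\<^sub>m s 1) R"
    unfolding D_def M R_def
    using c \<alpha>'c gc by (subst mult_four_block_mat[of _ 1 1 _ s _ s _ _ 1 _ n]) (auto simp: aa z)
  moreover have "four_block_mat (1\<^sub>m 1) B (0\<^sub>m s 1) R * four_block_mat (1\<^sub>m 1) (- B) (0\<^sub>m n 1) (1\<^sub>m n) =
      four_block_mat (1\<^sub>m 1) (0\<^sub>m 1 n) (0\<^sub>m s 1) R" if "B \<in> carrier_mat 1 n" for B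
    using that R uminus_l_inv_mat[OF that]
    by (subst mult_four_block_mat[of _ 1 1 _ n _ s _ _ 1 _ n]) (auto simp: left_mult_zero_mat' right_mult_zero_mat')
  ultimately have "D * M * E = four_block_mat (1\<^sub>m 1) (0\<^sub>m 1 n) (0\<^sub>m s 1) R"
    unfolding E_def using bc(1) by simp
  moreover have "D * M * E = (D * P) * U * (transpose_mat Q * E)"
  proof -
    have Dc: "D \<in> carrier_mat (Suc s) (Suc s)" and Ec: "E \<in> carrier_mat (Suc n) (Suc n)"
      using D E by (auto simp: GL_carrier)
    have "(D * P) * U * (transpose_mat Q * E) = (D * P) * U * transpose_mat Q * E"
      using Dc Pc U Qc Ec by (intro assoc_mult_mat[symmetric]) auto
    also have "(D * P) * U * transpose_mat Q = (D * P) * (U * transpose_mat Q)"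
      using Dc Pc U Qc by (intro assoc_mult_mat) auto
    also have "\<dots> = D * (P * (U * transpose_mat Q))"
      using Dc Pc U Qc by (intro assoc_mult_mat) auto
    also have "P * (U * transpose_mat Q) = M"
      unfolding M_def using Pc U Qc by (intro assoc_mult_mat[symmetric]) auto
    finally show ?thesis by simp
  qed
  ultimately show thesis
    using that[OF GL_mult_closed[OF D P] GL_mult_closed[OF QT E] R] by simp
qed

definition rank_form :: "nat \<Rightarrow> nat \<Rightarrow> nat \<Rightarrow> 'f::zero_neq_one mat" where
  "rank_form m s n = mat s n (\<lambda>(i, j). if i = j \<and> i < m then 1 else 0)"

lemma rank_normal_form:
  fixes U :: "'f::field mat"
  assumes "U \<in> carrier_mat s n"
  obtains D E m where "D \<in> carrier (GL s)" "E \<in> carrier (GL n)" "m \<le> s" "m \<le> n"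
    "D * U * E = rank_form m s n"
proof -
  have "\<exists>D E m. D \<in> carrier (GL s) \<and> E \<in> carrier (GL n) \<and> m \<le> s \<and> m \<le> n \<and> D * U * E = rank_form m s n"
    using assms
  proof (induction s arbitrary: n U)
    case 0
    then show ?case
      by (intro exI[of _ "1\<^sub>m 0"] exI[of _ "1\<^sub>m n"] exI[of _ 0])
        (auto simp: one_GL rank_form_def intro!: eq_matI)
  next
    case (Suc s)
    show ?case
    proof (cases "\<exists>i<Suc s. \<exists>j<n. U $$ (i, j) \<noteq> 0")
      case False
      then have "1\<^sub>m (Suc s) * U * 1\<^sub>m n = rank_form 0 (Suc s) n"
        using Suc.prems by (intro eq_matI) (auto simp: rank_form_def)
      then show ?thesis using one_GL by blast
    next
      case True
      then obtain i j where ij: "i < Suc s" "j < n" "U $$ (i, j) \<noteq> 0" by blast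
      then obtain n' where n: "n = Suc n'" by (cases n) auto
      obtain D E R where 1: "D \<in> carrier (GL (Suc s))" "E \<in> carrier (GL n)" "R \<in> carrier_mat s n'"
        "D * U * E = four_block_mat (1\<^sub>m 1) (0\<^sub>m 1 n') (0\<^sub>m s 1) R"
        using pivot[of U s n' i j] Suc.prems ij unfolding n by metis
      obtain D' E' m where 2: "D' \<in> carrier (GL s)" "E' \<in> carrier (GL n')" "m \<le> s" "m \<le> n'"
        "D' * R * E' = rank_form m s n'"
        using Suc.IH[OF 1(3)] by blast
      define D2 where "D2 = four_block_mat (1\<^sub>m 1) (0\<^sub>m 1 s) (0\<^sub>m s 1) D'"
      define E2 where "E2 = four_block_mat (1\<^sub>m 1) (0\<^sub>m 1 n') (0\<^sub>m n' 1) E'"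
      have G: "D2 \<in> carrier (GL (Suc s))" "E2 \<in> carrier (GL n)"
        using block_upper_GL[OF one_GL zero_carrier_mat 2(1), of 1] block_upper_GL[OF one_GL zero_carrier_mat 2(2), of 1]
        by (simp_all add: D2_def E2_def n)
      note c = 1(1,2)[unfolded GL_carrier] G[unfolded GL_carrier] 2(1,2)[unfolded GL_carrier]
      have "D2 * (D * U * E) = four_block_mat (1\<^sub>m 1) (0\<^sub>m 1 n') (0\<^sub>m s 1) (D' * R)"
        unfolding 1(4) D2_def using c 1(3)
        by (subst mult_four_block_mat[of _ 1 1 _ s _ s _ _ 1 _ n']) auto
      then have "D2 * (D * U * E) * E2 = four_block_mat (1\<^sub>m 1) (0\<^sub>m 1 n') (0\<^sub>m s 1) (rank_form m s n')"
        unfolding 2(5)[symmetric] E2_def using c 1(3)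
        by (subst \<open>D2 * (D * U * E) = _\<close>, subst mult_four_block_mat[of _ 1 1 _ n' _ s _ _ 1 _ n']) auto
      also have "\<dots> = rank_form (Suc m) (Suc s) n"
        using 2(3,4) by (intro eq_matI) (auto simp: rank_form_def n)
      finally have e: "D2 * (D * U * E) * E2 = rank_form (Suc m) (Suc s) n" .
      have "(D2 * D) * U * (E * E2) = (D2 * D) * U * E * E2"
        using c Suc.prems by (intro assoc_mult_mat[symmetric]) auto
      also have "(D2 * D) * U * E = D2 * D * (U * E)" using c Suc.prems by (intro assoc_mult_mat) auto
      also have "\<dots> = D2 * (D * (U * E))" using c Suc.prems by (intro assoc_mult_mat) auto
      also have "D * (U * E) = D * U * E" using c Suc.prems by (intro assoc_mult_mat[symmetric]) auto
      finally have "(D2 * D) * U * (E * E2) = rank_form (Suc m) (Suc s) n" unfolding e .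
      then show ?thesis
        using GL_mult_closed[OF G(1) 1(1)] GL_mult_closed[OF 1(2) G(2)] 2(3,4) n
        by (intro exI[of _ "D2 * D"] exI[of _ "E * E2"] exI[of _ "Suc m"]) auto
    qed
  qed
  then show thesis using that by blast
qed

text \<open>The same with the identity block moved to the right end.\<close>

lemma rank_normal_form_right:
  fixes U :: "'f::field mat"
  assumes U: "U \<in> carrier_mat s n"
  obtains D E m where "D \<in> carrier (GL s)" "E \<in> carrier (GL n)" "m \<le> s" "m \<le> n"
    "D * U * E = four_block_mat (0\<^sub>m m (n - m)) (1\<^sub>m m) (0\<^sub>m (s - m) (n - m)) (0\<^sub>m (s - m) m)"
proof -
  obtain D E m where 1: "D \<in> carrier (GL s)" "E \<in> carrier (GL n)" "m \<le> s" "m \<le> n"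
    "D * U * E = rank_form m s n" by (rule rank_normal_form[OF U])
  define \<sigma> where "\<sigma> j = (if j < n - m then m + j else j - (n - m))" for j
  have \<sigma>: "\<sigma> j < n" if "j < n" for j using that 1(4) by (auto simp: \<sigma>_def)
  have inj: "inj_on \<sigma> {..<n}" by (auto simp: inj_on_def \<sigma>_def split: if_splits)
  let ?P = "perm_mat n \<sigma> :: 'f mat"
  have P: "transpose_mat ?P \<in> carrier (GL n)"
    using perm_mat_inverse(1)[of n \<sigma>] \<sigma> inj by (auto simp: GL_carrier det_transpose)
  note c = 1(1,2)[unfolded GL_carrier] P[unfolded GL_carrier]
  have "D * U * (E * transpose_mat ?P) = D * U * E * transpose_mat ?P"
    using c U by (intro assoc_mult_mat[symmetric]) auto
  also have "\<dots> = mat s n (\<lambda>(i, j). rank_form m s n $$ (i, \<sigma> j))"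
    unfolding 1(5) by (rule mult_perm_mat_transpose) (auto simp: \<sigma> rank_form_def)
  also have "\<dots> = four_block_mat (0\<^sub>m m (n - m)) (1\<^sub>m m) (0\<^sub>m (s - m) (n - m)) (0\<^sub>m (s - m) m)"
    using 1(3,4) by (intro eq_matI) (auto simp: rank_form_def \<sigma>_def)
  finally show thesis using that[OF 1(1) GL_mult_closed[OF 1(2) P] 1(3,4)] by blast
qed

section \<open>Representatives of the double cosets\<close>

text \<open>A coset of \<open>P\<^bsub>r,s\<^esub>\<close> in \<open>G\<^bsub>2n\<^esub>\<close> is the span \<open>S\<close> of the last \<open>s\<close> rows. Split each half of the
  coordinates into blocks of sizes \<open>k\<close>, \<open>r - 2 k\<close>, \<open>n + k - r\<close>, called \<open>u\<^sub>1, u\<^sub>2, u\<^sub>3\<close> in the first half and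
  \<open>v\<^sub>1, v\<^sub>2, v\<^sub>3\<close> in the second. The representative \<open>w\<^sub>k\<close> lists the unit vectors in the order
  \<open>u\<^sub>1, v\<^sub>1, v\<^sub>2\<close> and then \<open>u\<^sub>2, u\<^sub>3, v\<^sub>3\<close>; the latter span \<open>S\<close>. This order makes the Levi blocks of the
  conjugates by \<open>w\<^sub>k\<close> equal to the matrices in \<open>\<tau>\<^sub>k\<close>.\<close>

definition rep_index :: "nat \<Rightarrow> nat \<Rightarrow> nat \<Rightarrow> nat \<Rightarrow> nat" where
  "rep_index n r k i =
     (if i < k then i else if i < r then n + i - k else if i < r + n - k then k + i - r else i)"

definition rep_mat :: "nat \<Rightarrow> nat \<Rightarrow> nat \<Rightarrow> 'f::field mat" where
  "rep_mat n r k = perm_mat (2 * n) (rep_index n r k)"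

lemma rep_index_less: "r \<le> n + k \<Longrightarrow> 2 * k \<le> r \<Longrightarrow> i < 2 * n \<Longrightarrow> rep_index n r k i < 2 * n"
  by (auto simp: rep_index_def)

lemma rep_index_inj: "r \<le> n + k \<Longrightarrow> 2 * k \<le> r \<Longrightarrow> inj_on (rep_index n r k) {..<2 * n}"
  by (auto simp: inj_on_def rep_index_def split: if_splits)

lemma rep_mat_GL:
  assumes "r \<le> n + k" "2 * k \<le> r" shows "rep_mat n r k \<in> carrier (GL (2 * n) :: 'f::field mat monoid)"
  unfolding rep_mat_def by (rule perm_mat_inverse(1)[OF _ rep_index_inj[OF assms]]) (rule rep_index_less[OF assms])

lemma N_unip_eq: "N_unip n = upper_unip n n"
  by (auto simp: N_unip_def upper_unip_def)

lemma \<psi>N_eq: "\<psi>N \<psi>0 n = upper_char \<psi>0 0 n"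
  by (auto simp: \<psi>N_def upper_char_def mat_trace_def get_block_def fun_eq_iff)

lemma diag_embed_GL: "h \<in> carrier (GL n) \<Longrightarrow> diag_embed n h \<in> carrier (GL (2 * n) :: 'f::field mat monoid)"
  using block_upper_GL[of h n "0\<^sub>m n n" n h] by (simp add: diag_embed_def mult_2)

lemma diag_embed_mult:
  assumes "g \<in> carrier_mat n n" "h \<in> carrier_mat n n"
  shows "diag_embed n g * diag_embed n h = diag_embed n (g * h :: 'f::field mat)"
  unfolding diag_embed_def using assms
  by (subst mult_four_block_mat[of _ n n _ n _ n _ _ n _ n]) auto

lemma diag_embed_subgroup:
  assumes S: "S \<subseteq> carrier (GL n :: 'f::{field, finite} mat monoid)" "1\<^sub>m n \<in> S"
    and closed: "\<And>x y. x \<in> S \<Longrightarrow> y \<in> S \<Longrightarrow> x * y \<in> S"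
  shows "subgroup (diag_embed n ` S) (GL (2 * n))"
proof (rule GL_subgroupI)
  show "diag_embed n ` S \<subseteq> carrier (GL (2 * n))" using S diag_embed_GL by blast
  have "diag_embed n (1\<^sub>m n :: 'f mat) = 1\<^sub>m (2 * n)" by (simp add: diag_embed_def mult_2)
  then show "1\<^sub>m (2 * n) \<in> diag_embed n ` S" using S(2) by (metis imageI)
  fix x y assume "x \<in> diag_embed n ` S" "y \<in> diag_embed n ` S"
  then obtain g h where "g \<in> S" "h \<in> S" "x = diag_embed n g" "y = diag_embed n h" by blast
  moreover from this have "g \<in> carrier_mat n n" "h \<in> carrier_mat n n" using S by (auto simp: GL_carrier)
  ultimately show "x * y \<in> diag_embed n ` S" using closed by (auto simp: diag_embed_mult)
qed

lemma diag_embed_normalizes: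
  fixes \<psi>0 :: "'f::{field, finite} \<Rightarrow> complex"
  assumes h: "h \<in> carrier (GL n)"
  shows "normalizes (GL (2 * n)) (N_unip n) (\<psi>N \<psi>0 n) (diag_embed n h)"
proof -
  have "shift_mat 0 n n = (1\<^sub>m n :: 'f mat)" by (rule eq_matI) (auto simp: shift_mat_def)
  then show ?thesis
    unfolding N_unip_eq \<psi>N_eq diag_embed_def mult_2 using h
    by (intro upper_unip_normalizes) (auto simp: GL_carrier)
qed

text \<open>The coset of a matrix modulo \<open>P\<^bsub>r,s\<^esub>\<close> on the left depends only on its last \<open>s\<close> rows.\<close>

lemma bottom_rows_coset:
  fixes z w :: "'f::field mat"
  assumes z: "z \<in> carrier (GL (r + s))" and w: "w \<in> carrier (GL (r + s))"
    and eq: "\<forall>i j. r \<le> i \<longrightarrow> i < r + s \<longrightarrow> j < r + s \<longrightarrow> z $$ (i, j) = w $$ (i, j)"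
  obtains p where "p \<in> parabolic [r, s]" "z = p * w"
proof -
  obtain v where v: "v \<in> carrier (GL (r + s))" "w * v = 1\<^sub>m (r + s)" "v * w = 1\<^sub>m (r + s)"
    by (rule GL_inverse[OF w])
  note c = z[unfolded GL_carrier] w[unfolded GL_carrier] v(1)[unfolded GL_carrier]
  have "lower_zero r (z * v)"
    unfolding lower_zero_def
  proof (intro allI impI)
    fix i j assume "i < dim_row (z * v)" "j < dim_col (z * v)" and ij: "r \<le> i" "j < r"
    then have ij': "i < r + s" "j < r + s" using c by auto
    have "(z * v) $$ (i, j) = (\<Sum>t<r + s. w $$ (i, t) * v $$ (t, j))"
      using c ij ij' eq by (subst mult_index[of _ "r + s" "r + s" _ "r + s"]) auto
    also have "\<dots> = (w * v) $$ (i, j)"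
      using c ij' by (subst mult_index[of w "r + s" "r + s" _ "r + s"]) auto
    finally show "(z * v) $$ (i, j) = 0" using v(2) ij ij' by simp
  qed
  then have "z * v \<in> parabolic [r, s]" using GL_mult_closed[OF z v(1)] by (simp add: parabolic_two)
  moreover have "z = z * v * w" using c v(3) assoc_mult_mat[of z "r + s" "r + s" v "r + s" w "r + s"]
    right_mult_one_mat[of z "r + s" "r + s"] by simp
  ultimately show thesis by (rule that)
qed

text \<open>For the span \<open>S\<close> of the rows of \<open>(U, V)\<close>, the vector \<open>(0, t V)\<close> lies in \<open>S\<close> and \<open>c\<close> is orthogonal to
  the projection of \<open>S\<close> to the first half. The element \<open>u = 1 + (c; 0) (0, t V)\<close> of \<open>N\<close> therefore acts
  trivially on \<open>S\<close> and modulo \<open>S\<close>; explicitly \<open>x\<close> conjugates it to \<open>1 + x (c; 0) (0, t)\<close>.\<close>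

lemma trivial_conjugate:
  fixes x :: "'f::field mat"
  assumes x: "x \<in> carrier (GL (2 * n))" and rs: "r + s = 2 * n"
    and X: "x = four_block_mat X1 X2 U V" "X1 \<in> carrier_mat r n" "X2 \<in> carrier_mat r n"
      "U \<in> carrier_mat s n" "V \<in> carrier_mat s n"
    and c: "c \<in> carrier_mat n 1" "U * c = 0\<^sub>m s 1" and t: "t \<in> carrier_mat 1 s" "t * U = 0\<^sub>m 1 n"
    and \<psi>: "\<psi>0 ((t * V * c) $$ (0, 0)) \<noteq> 1"
  shows "\<exists>u\<in>N_unip n. \<exists>B\<in>carrier_mat r s.
    x * u * inv\<^bsub>GL (2 * n)\<^esub> x = four_block_mat (1\<^sub>m r) B (0\<^sub>m s r) (1\<^sub>m s) \<and> \<psi>N \<psi>0 n u \<noteq> 1"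
proof -
  interpret group "GL (2 * n) :: 'f mat monoid" by (rule GL_group)
  define Z where "Z = c * (t * V)"
  have Z: "Z \<in> carrier_mat n n" using c t X by (auto simp: Z_def)
  define u where "u = four_block_mat (1\<^sub>m n) Z (0\<^sub>m n n) (1\<^sub>m n)"
  define B where "B = X1 * c * t"
  have B: "B \<in> carrier_mat r s" using X c t by (auto simp: B_def)
  define g where "g = four_block_mat (1\<^sub>m r) B (0\<^sub>m s r) (1\<^sub>m s)"
  have uN: "u \<in> N_unip n" unfolding u_def N_unip_def using Z by blast
  have uG: "u \<in> carrier (GL (2 * n))" using uN upper_unip_GL[of n n] by (auto simp: N_unip_eq mult_2)
  have gG: "g \<in> carrier (GL (2 * n))"
    unfolding g_def using block_upper_GL[OF one_GL B one_GL] rs by simp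
  have BU: "B * U = 0\<^sub>m r n"
  proof -
    have "B * U = X1 * c * (t * U)" unfolding B_def using X c t by (intro assoc_mult_mat) auto
    then show ?thesis using X c t by simp
  qed
  have UZ: "U * Z = 0\<^sub>m s n"
  proof -
    have "U * Z = U * c * (t * V)" unfolding Z_def using X c t by (intro assoc_mult_mat[symmetric]) auto
    then show ?thesis using X c t by simp
  qed
  have XZ: "X1 * Z = B * V"
  proof -
    have "X1 * Z = X1 * c * (t * V)" unfolding Z_def using X c t by (intro assoc_mult_mat[symmetric]) auto
    also have "\<dots> = B * V" unfolding B_def using X c t by (intro assoc_mult_mat[symmetric]) auto
    finally show ?thesis .
  qed
  have "g * x = four_block_mat X1 (X2 + B * V) U V"
    unfolding g_def X(1) using X B BU
    by (subst mult_four_block_mat[of _ r r _ s _ s _ _ n _ n]) auto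
  also have "\<dots> = four_block_mat X1 (B * V + X2) U V"
    using X B by (subst comm_add_mat[of X2 r n "B * V"]) auto
  also have "\<dots> = x * u"
    unfolding u_def X(1) using X Z XZ UZ B
    by (subst mult_four_block_mat[of _ r n _ n _ s _ _ n _ n]) auto
  finally have e: "g * x = x * u" .
  have "x * u * inv\<^bsub>GL (2 * n)\<^esub> x = g"
    using inv_solve_right[of g "x * u" x] x uG gG e GL_mult_closed[OF x uG] by simp
  moreover have "\<psi>N \<psi>0 n u \<noteq> 1"
  proof -
    have "\<psi>N \<psi>0 n u = \<psi>0 (mat_trace Z)"
      unfolding \<psi>N_def u_def using get_block_two[OF one_carrier_mat Z zero_carrier_mat one_carrier_mat] by simp
    also have "mat_trace Z = mat_trace (t * V * c)"
      unfolding Z_def by (rule mat_trace_comm[of _ n 1]) (use X c t in auto)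
    also have "\<dots> = (t * V * c) $$ (0, 0)" using t by (simp add: mat_trace_def)
    finally show ?thesis using \<psi> by simp
  qed
  ultimately show ?thesis using uN B g_def by blast
qed

text \<open>Let \<open>A\<close> be the projection of \<open>S\<close> to the first half and \<open>B\<close> the space of all \<open>v\<close> with \<open>(0, v) \<in> S\<close>. The
  hypothesis \<open>orth\<close> says that \<open>B \<subseteq> A\<close>. Then row operations inside the last \<open>s\<close> rows, the diagonal \<open>GL n\<close>
  and \<open>N\<close> bring these rows to those of a representative: the first rank normal form makes \<open>A\<close> a coordinate
  subspace, the second does the same for \<open>B\<close> inside \<open>A\<close>, and \<open>Z\<close> clears the second half of the rows that project onto \<open>A\<close>.\<close>

lemma reduction_to_representative:
  fixes x :: "'f::field mat"
  assumes x: "x \<in> carrier (GL (2 * n))" and rs: "r + s = 2 * n"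
    and X: "x = four_block_mat X1 X2 U V" "X1 \<in> carrier_mat r n" "X2 \<in> carrier_mat r n"
      "U \<in> carrier_mat s n" "V \<in> carrier_mat s n"
    and orth: "\<forall>c\<in>carrier_mat n 1. \<forall>t\<in>carrier_mat 1 s. U * c = 0\<^sub>m s 1 \<longrightarrow>
      t * U = 0\<^sub>m 1 n \<longrightarrow> (t * V * c) $$ (0, 0) = 0"
  obtains k D h Z where "r \<le> n + k" "2 * k \<le> r" "D \<in> carrier (GL s)" "h \<in> carrier (GL n)"
    "Z \<in> carrier_mat n n"
    "\<And>i j. i < s \<Longrightarrow> j < n \<Longrightarrow> (D * U * h) $$ (i, j) = rep_mat n r k $$ (r + i, j)"
    "\<And>i j. i < s \<Longrightarrow> j < n \<Longrightarrow> (D * U * h * Z + D * V * h) $$ (i, j) = rep_mat n r k $$ (r + i, n + j)"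
proof -
  obtain D E m where DE: "D \<in> carrier (GL s)" "E \<in> carrier (GL n)" "m \<le> s" "m \<le> n"
    "D * U * E = four_block_mat (0\<^sub>m m (n - m)) (1\<^sub>m m) (0\<^sub>m (s - m) (n - m)) (0\<^sub>m (s - m) m)"
    by (rule rank_normal_form_right[OF X(4)])
  define k where "k = n - m"
  have n: "n = k + m" using DE(4) by (simp add: k_def)
  have s: "s = m + (s - m)" using DE(3) by simp
  obtain q where q: "s = m + q" using s by blast
  have F: "D * U * E = four_block_mat (0\<^sub>m m k) (1\<^sub>m m) (0\<^sub>m q k) (0\<^sub>m q m)"
    using DE(5) by (simp add: k_def q)
  obtain D' where D': "D' \<in> carrier (GL s)" "D * D' = 1\<^sub>m s" "D' * D = 1\<^sub>m s" by (rule GL_inverse[OF DE(1)])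
  obtain E' where E': "E' \<in> carrier (GL n)" "E * E' = 1\<^sub>m n" "E' * E = 1\<^sub>m n" by (rule GL_inverse[OF DE(2)])
  note c = DE(1,2)[unfolded GL_carrier] D'(1)[unfolded GL_carrier] E'(1)[unfolded GL_carrier]
  have DUE: "D * U * E \<in> carrier_mat s n" and DVE: "D * V * E \<in> carrier_mat s n" using c X by auto
  have DU: "D * U \<in> carrier_mat s n" and UE: "U * E \<in> carrier_mat s n" using c X by auto
  have V0: "(D * V * E) $$ (i, j) = 0" if i: "m \<le> i" "i < s" and j: "j < k" for i j
  proof -
    \<comment> \<open>Unit vectors: they turn \<open>orth\<close> into a statement on a single entry.\<close>
    define t0 c0 where "t0 = mat 1 s (\<lambda>(_, y). if y = i then 1 else (0::'f))"
      and "c0 = mat n 1 (\<lambda>(y, _). if y = j then 1 else (0::'f))"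
    have t0: "t0 \<in> carrier_mat 1 s" and c0: "c0 \<in> carrier_mat n 1" by (simp_all add: t0_def c0_def)
    have jn: "j < n" using j n by simp
    have pick_row: "(t0 * M) $$ (0, y) = M $$ (i, y)" if "M \<in> carrier_mat s l" "y < l" for M l y
    proof -
      have "(t0 * M) $$ (0, y) = (\<Sum>z<s. if z = i then M $$ (z, y) else 0)"
        using that i by (subst mult_index[OF t0 that(1) _ that(2)], simp, intro sum.cong) (auto simp: t0_def)
      then show ?thesis using i by simp
    qed
    have pick_col: "(M * c0) $$ (y, 0) = M $$ (y, j)" if "M \<in> carrier_mat l n" "y < l" for M l y
    proof -
      have "(M * c0) $$ (y, 0) = (\<Sum>z<n. if z = j then M $$ (y, z) else 0)"
        using that by (subst mult_index[OF that(1) c0 that(2)], simp, intro sum.cong) (auto simp: c0_def)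
      then show ?thesis using jn by simp
    qed
    have z1: "t0 * (D * U * E) = 0\<^sub>m 1 n"
    proof (rule eq_matI)
      fix a b assume "a < dim_row (0\<^sub>m 1 n :: 'f mat)" "b < dim_col (0\<^sub>m 1 n :: 'f mat)"
      then have "a = 0" "b < n" by auto
      then show "(t0 * (D * U * E)) $$ (a, b) = 0\<^sub>m 1 n $$ (a, b)"
        using pick_row[OF DUE, of b] i unfolding F by (simp add: n q)
    qed (use t0 DUE in auto)
    have z2: "(D * U * E) * c0 = 0\<^sub>m s 1"
    proof (rule eq_matI)
      fix a b assume "a < dim_row (0\<^sub>m s 1 :: 'f mat)" "b < dim_col (0\<^sub>m s 1 :: 'f mat)"
      then have "b = 0" "a < s" by auto
      then show "(D * U * E * c0) $$ (a, b) = 0\<^sub>m s 1 $$ (a, b)"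
        using pick_col[OF DUE, of a] j unfolding F by (simp add: n q)
    qed (use c0 DUE in auto)
    have "t0 * D * U = 0\<^sub>m 1 n"
    proof -
      have "t0 * D * U = t0 * (D * U)" using t0 c X by (intro assoc_mult_mat) auto
      also have "D * U = D * U * E * E'"
        using c E'(2) assoc_mult_mat[OF DU, of E n E' n] right_mult_one_mat[OF DU] by simp
      also have "t0 * \<dots> = t0 * (D * U * E) * E'" using t0 c X DUE by (intro assoc_mult_mat[symmetric]) auto
      finally show ?thesis using z1 c by auto
    qed
    moreover have "U * (E * c0) = 0\<^sub>m s 1"
    proof -
      have "U * (E * c0) = U * E * c0" using c0 c X by (intro assoc_mult_mat[symmetric]) auto
      also have "U * E = D' * (D * (U * E))"
        using c D'(3) assoc_mult_mat[of D' s s D s "U * E" n] UE left_mult_one_mat[OF UE] by simp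
      also have "D * (U * E) = D * U * E" using c X by (intro assoc_mult_mat[symmetric]) auto
      also have "D' * \<dots> * c0 = D' * (D * U * E * c0)" using c0 c X DUE by (intro assoc_mult_mat) auto
      finally show ?thesis using z2 c by auto
    qed
    ultimately have "(t0 * D * V * (E * c0)) $$ (0, 0) = 0"
      using t0 c0 c by (intro orth[rule_format]) auto
    also have "t0 * D * V * (E * c0) = t0 * (D * V * E) * c0"
    proof -
      have 1: "t0 * D * V * (E * c0) = t0 * D * V * E * c0"
        using t0 c0 c X by (intro assoc_mult_mat[symmetric]) auto
      have 2: "t0 * D * V = t0 * (D * V)" using t0 c X by (intro assoc_mult_mat) auto
      have 3: "t0 * (D * V) * E = t0 * (D * V * E)" using t0 c X by (intro assoc_mult_mat) auto
      show ?thesis unfolding 1 unfolding 2 3 ..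
    qed
    also have "(t0 * (D * V * E) * c0) $$ (0, 0) = (D * V * E) $$ (i, j)"
      using pick_col[of "t0 * (D * V * E)" 1 0] pick_row[OF DVE jn] t0 DVE by simp
    finally show ?thesis .
  qed
  define Va Vb V2 where "Va = mat m k (\<lambda>(i, j). (D * V * E) $$ (i, j))"
    and "Vb = mat m m (\<lambda>(i, j). (D * V * E) $$ (i, k + j))"
    and "V2 = mat q m (\<lambda>(i, j). (D * V * E) $$ (m + i, k + j))"
  have Vc: "Va \<in> carrier_mat m k" "Vb \<in> carrier_mat m m" "V2 \<in> carrier_mat q m"
    by (simp_all add: Va_def Vb_def V2_def)
  have VE: "D * V * E = four_block_mat Va Vb (0\<^sub>m q k) V2"
    by (rule eq_matI) (use DVE V0 in \<open>auto simp: Va_def Vb_def V2_def n q\<close>)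
  obtain D2 E2 l where 2: "D2 \<in> carrier (GL q)" "E2 \<in> carrier (GL m)" "l \<le> q" "l \<le> m"
    "D2 * V2 * E2 = four_block_mat (0\<^sub>m l (m - l)) (1\<^sub>m l) (0\<^sub>m (q - l) (m - l)) (0\<^sub>m (q - l) l)"
    by (rule rank_normal_form_right[OF Vc(3)])
  obtain E2' where E2': "E2' \<in> carrier (GL m)" "E2 * E2' = 1\<^sub>m m" "E2' * E2 = 1\<^sub>m m" by (rule GL_inverse[OF 2(2)])
  note c2 = 2(1,2)[unfolded GL_carrier] E2'(1)[unfolded GL_carrier]
  define DD where "DD = four_block_mat E2' (0\<^sub>m m q) (0\<^sub>m q m) D2"
  define EE where "EE = four_block_mat (1\<^sub>m k) (0\<^sub>m k m) (0\<^sub>m m k) E2"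
  have DD: "DD \<in> carrier (GL s)" and EE: "EE \<in> carrier (GL n)"
    unfolding DD_def EE_def n q using block_upper_GL zero_carrier_mat E2'(1) 2(1,2) one_GL by blast+
  note c3 = DD[unfolded GL_carrier] EE[unfolded GL_carrier]
  define h where "h = E * EE"
  define D3 where "D3 = DD * D"
  have h: "h \<in> carrier (GL n)" and D3: "D3 \<in> carrier (GL s)"
    unfolding h_def D3_def using GL_mult_closed DE DD EE by auto
  have push: "D3 * M * h = DD * (D * M * E) * EE" if M: "M \<in> carrier_mat s n" for M
  proof -
    have "D3 * M * h = DD * D * M * E * EE"
      unfolding D3_def h_def using M c c3 by (intro assoc_mult_mat[symmetric]) auto
    also have "DD * D * M = DD * (D * M)" using M c c3 by (intro assoc_mult_mat) auto
    also have "\<dots> * E = DD * (D * M * E)" using M c c3 by (intro assoc_mult_mat) auto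
    finally show ?thesis .
  qed
  have U3: "D3 * U * h = four_block_mat (0\<^sub>m m k) (1\<^sub>m m) (0\<^sub>m q k) (0\<^sub>m q m)"
  proof -
    have "DD * (D * U * E) = four_block_mat (0\<^sub>m m k) E2' (0\<^sub>m q k) (0\<^sub>m q m)"
      unfolding F DD_def using c2 by (subst mult_four_block_mat[of _ m m _ q _ q _ _ k _ m]) auto
    moreover have "\<dots> * EE = four_block_mat (0\<^sub>m m k) (1\<^sub>m m) (0\<^sub>m q k) (0\<^sub>m q m)"
      unfolding EE_def using c2 E2' by (subst mult_four_block_mat[of _ m k _ m _ q _ _ k _ m]) auto
    ultimately show ?thesis using push[OF X(4)] by simp
  qed
  define W1 W2 where "W1 = E2' * Va" and "W2 = E2' * Vb * E2"
  have Wc: "W1 \<in> carrier_mat m k" "W2 \<in> carrier_mat m m" using c2 Vc by (auto simp: W1_def W2_def)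
  have V3: "D3 * V * h = four_block_mat W1 W2 (0\<^sub>m q k) (D2 * V2 * E2)"
  proof -
    have "DD * (D * V * E) = four_block_mat (E2' * Va) (E2' * Vb) (0\<^sub>m q k) (D2 * V2)"
      unfolding VE DD_def using c2 Vc by (subst mult_four_block_mat[of _ m m _ q _ q _ _ k _ m]) auto
    moreover have "\<dots> * EE = four_block_mat W1 W2 (0\<^sub>m q k) (D2 * V2 * E2)"
      unfolding EE_def W1_def W2_def using c2 Vc
      by (subst mult_four_block_mat[of _ m k _ m _ q _ _ k _ m]) auto
    ultimately show ?thesis using push[OF X(5)] by simp
  qed
  have UVc: "D3 * U * h \<in> carrier_mat s n" "D3 * V * h \<in> carrier_mat s n"
    using D3 h X by (auto simp: GL_carrier)
  \<comment> \<open>A zero row below would contradict the invertibility of \<open>x\<close>.\<close>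
  have lq: "l = q"
  proof -
    have U0: "(D3 * U * h) $$ (a, b) = 0" if "m + l \<le> a" "a < s" "b < n" for a b
      unfolding U3 using that n q by simp
    have V0': "(D3 * V * h) $$ (a, b) = 0" if "m + l \<le> a" "a < s" "b < n" for a b
      unfolding V3 2(5) using that n q 2(3,4) carrier_matD[OF Wc(1)] by (simp, linarith)
    define y where "y = four_block_mat (1\<^sub>m r) (0\<^sub>m r s) (0\<^sub>m s r) D3 * x * diag_embed n h"
    have "y \<in> carrier (GL (2 * n))"
      unfolding y_def using block_upper_GL[OF one_GL zero_carrier_mat D3, of r] x diag_embed_GL[OF h] rs
      by (intro GL_mult_closed) auto
    moreover have "y = four_block_mat (X1 * h) (X2 * h) (D3 * U * h) (D3 * V * h)"
    proof -
      have "four_block_mat (1\<^sub>m r) (0\<^sub>m r s) (0\<^sub>m s r) D3 * x = four_block_mat X1 X2 (D3 * U) (D3 * V)"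
        unfolding X(1) using X D3 by (subst mult_four_block_mat[of _ r r _ s _ s _ _ n _ n]) (auto simp: GL_carrier)
      moreover have "\<dots> * diag_embed n h = four_block_mat (X1 * h) (X2 * h) (D3 * U * h) (D3 * V * h)"
        unfolding diag_embed_def using X D3 h
        by (subst mult_four_block_mat[of _ r n _ n _ s _ _ n _ n]) (auto simp: GL_carrier)
      ultimately show ?thesis unfolding y_def by simp
    qed
    moreover have "y $$ (i, j) = 0" if i: "i < 2 * n" "r + m + l \<le> i" and j: "j < 2 * n" for i j
    proof -
      have ii: "i - r < s" "m + l \<le> i - r" "\<not> i < r" using i rs by auto
      have cc: "X1 * h \<in> carrier_mat r n" using X(2) h by (auto simp: GL_carrier)
      have "y $$ (i, j) = (if j < n then (D3 * U * h) $$ (i - r, j) else (D3 * V * h) $$ (i - r, j - n))"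
        unfolding \<open>y = four_block_mat _ _ _ _\<close>
        using ii i j carrier_matD[OF cc] carrier_matD[OF UVc(2)] rs by (subst index_mat_four_block) auto
      then show "y $$ (i, j) = 0"
        using U0[of "i - r" j] V0'[of "i - r" "j - n"] ii j by (cases "j < n") auto
    qed
    ultimately have "2 * n \<le> r + m + l"
      using 2(3) rs q by (intro zero_block_bound[of y "2 * n" "r + m + l" "2 * n"]) auto
    then show "l = q" using 2(3) rs q by simp
  qed
  have qm: "q \<le> m" using lq 2(4) by simp
  have V2': "D2 * V2 * E2 = mat q m (\<lambda>(i, j). if j = m - q + i then 1 else 0)"
    unfolding 2(5) lq using qm by (intro eq_matI) auto
  define Z where "Z = four_block_mat (0\<^sub>m k k) (0\<^sub>m k m) (- W1) (- W2)"
  have Zc: "Z \<in> carrier_mat n n" unfolding Z_def n using Wc by auto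
  have "D3 * U * h * Z = four_block_mat (- W1) (- W2) (0\<^sub>m q k) (0\<^sub>m q m)"
    unfolding U3 Z_def using Wc by (subst mult_four_block_mat[of _ m k _ m _ q _ _ k _ m]) auto
  moreover have "four_block_mat (- W1) (- W2) (0\<^sub>m q k) (0\<^sub>m q m) + D3 * V * h =
      four_block_mat (0\<^sub>m m k) (0\<^sub>m m m) (0\<^sub>m q k) (D2 * V2 * E2)"
    unfolding V3 using Wc c2 Vc by (intro eq_matI) auto
  ultimately have V4: "D3 * U * h * Z + D3 * V * h =
      four_block_mat (0\<^sub>m m k) (0\<^sub>m m m) (0\<^sub>m q k) (D2 * V2 * E2)" by simp
  have k: "r \<le> n + k" "2 * k \<le> r" using rs qm n q by auto
  have rep: "rep_mat n r k $$ (r + i, j) = (if rep_index n r k (r + i) = j then 1 else 0)"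
    if "i < s" "j < 2 * n" for i j
    using that rs unfolding rep_mat_def perm_mat_def by simp
  show thesis
  proof (rule that[OF k D3 h Zc])
    fix i j assume ij: "i < s" "j < n"
    show "(D3 * U * h) $$ (i, j) = rep_mat n r k $$ (r + i, j)"
      unfolding U3 using ij k rs rep[of i j] by (auto simp: n q rep_index_def)
    show "(D3 * U * h * Z + D3 * V * h) $$ (i, j) = rep_mat n r k $$ (r + i, n + j)"
      unfolding V4 V2' using ij k rs rep[of i "n + j"] qm by (auto simp: n q rep_index_def)
  qed
qed

lemma (in group) solve_double_coset:
  assumes c: "d \<in> carrier G" "x \<in> carrier G" "g \<in> carrier G" "u \<in> carrier G" "p \<in> carrier G" "w \<in> carrier G"
    and e: "d \<otimes> x \<otimes> g \<otimes> u = p \<otimes> w"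
  shows "x = inv d \<otimes> p \<otimes> w \<otimes> inv g \<otimes> (g \<otimes> inv u \<otimes> inv g)"
proof -
  have "inv g \<otimes> (g \<otimes> (inv u \<otimes> inv g)) = inv u \<otimes> inv g" using c by (simp add: m_assoc[symmetric])
  then have "inv d \<otimes> p \<otimes> w \<otimes> inv g \<otimes> (g \<otimes> inv u \<otimes> inv g) = inv d \<otimes> (p \<otimes> w) \<otimes> (inv u \<otimes> inv g)"
    using c by (simp add: m_assoc)
  also have "\<dots> = x" unfolding e[symmetric] using c by (simp add: m_assoc) (simp add: m_assoc[symmetric])
  finally show ?thesis by simp
qed

text \<open>Either some vector of \<open>B\<close> lies outside \<open>A\<close>, and the scalar in \<open>trivial_conjugate\<close> can be adjusted so
  that \<open>\<psi> u \<noteq> 1\<close>, or \<open>B \<subseteq> A\<close> and \<open>x\<close> lies in the double coset of a representative.\<close>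

lemma double_coset_cover:
  fixes \<psi>0 :: "'f::{field, finite} \<Rightarrow> complex"
  assumes x: "x \<in> carrier (GL (2 * n))" and rs: "r + s = 2 * n" and \<psi>0: "nontrivial_additive_character \<psi>0"
  shows "(\<exists>k. r \<le> n + k \<and> 2 * k \<le> r \<and> (\<exists>p\<in>parabolic [r, s]. \<exists>h\<in>carrier (GL n). \<exists>u\<in>N_unip n.
      x = p * rep_mat n r k * diag_embed n h * u)) \<or>
    (\<exists>u\<in>N_unip n. \<exists>B\<in>carrier_mat r s.
      x * u * inv\<^bsub>GL (2 * n)\<^esub> x = four_block_mat (1\<^sub>m r) B (0\<^sub>m s r) (1\<^sub>m s) \<and> \<psi>N \<psi>0 n u \<noteq> 1)"
proof -
  interpret group "GL (2 * n) :: 'f mat monoid" by (rule GL_group)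
  have xc: "x \<in> carrier_mat (r + s) (n + n)" using x rs by (auto simp: GL_carrier mult_2)
  define X1 X2 U V where "X1 = mat r n (\<lambda>(i, j). x $$ (i, j))" and "X2 = mat r n (\<lambda>(i, j). x $$ (i, n + j))"
    and "U = mat s n (\<lambda>(i, j). x $$ (r + i, j))" and "V = mat s n (\<lambda>(i, j). x $$ (r + i, n + j))"
  have X: "x = four_block_mat X1 X2 U V"
    by (rule eq_matI) (use xc in \<open>auto simp: X1_def X2_def U_def V_def\<close>)
  have Xc: "X1 \<in> carrier_mat r n" "X2 \<in> carrier_mat r n" "U \<in> carrier_mat s n" "V \<in> carrier_mat s n"
    by (simp_all add: X1_def X2_def U_def V_def)
  show ?thesis
  proof (cases "\<exists>c t. c \<in> carrier_mat n 1 \<and> t \<in> carrier_mat 1 s \<and> U * c = 0\<^sub>m s 1 \<and>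
      t * U = 0\<^sub>m 1 n \<and> (t * V * c) $$ (0, 0) \<noteq> 0")
    case True
    then obtain c t where ct: "c \<in> carrier_mat n 1" "t \<in> carrier_mat 1 s" "U * c = 0\<^sub>m s 1"
      "t * U = 0\<^sub>m 1 n" "(t * V * c) $$ (0, 0) \<noteq> 0" by blast
    obtain y where y: "\<psi>0 y \<noteq> 1" using \<psi>0 by (auto simp: nontrivial_additive_character_def)
    define a where "a = y / (t * V * c) $$ (0, 0)"
    have "(t * V * (a \<cdot>\<^sub>m c)) $$ (0, 0) = y"
      using ct Xc by (subst mult_smult_distrib[of _ 1 n _ 1]) (auto simp: a_def)
    moreover have "U * (a \<cdot>\<^sub>m c) = 0\<^sub>m s 1"
      using ct Xc by (subst mult_smult_distrib[of _ s n _ 1]) auto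
    ultimately show ?thesis
      using trivial_conjugate[OF x rs X Xc, of "a \<cdot>\<^sub>m c" t \<psi>0] ct y by auto
  next
    case False
    then have orth: "\<forall>c\<in>carrier_mat n 1. \<forall>t\<in>carrier_mat 1 s. U * c = 0\<^sub>m s 1 \<longrightarrow>
        t * U = 0\<^sub>m 1 n \<longrightarrow> (t * V * c) $$ (0, 0) = 0" by blast
    obtain k D g Z where k: "r \<le> n + k" "2 * k \<le> r" and D: "D \<in> carrier (GL s)" and g: "g \<in> carrier (GL n)"
      and Z: "Z \<in> carrier_mat n n"
      and rows: "\<And>i j. i < s \<Longrightarrow> j < n \<Longrightarrow> (D * U * g) $$ (i, j) = rep_mat n r k $$ (r + i, j)"
        "\<And>i j. i < s \<Longrightarrow> j < n \<Longrightarrow> (D * U * g * Z + D * V * g) $$ (i, j) = rep_mat n r k $$ (r + i, n + j)"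
      using reduction_to_representative[OF x rs X Xc orth] by blast
    define d where "d = four_block_mat (1\<^sub>m r) (0\<^sub>m r s) (0\<^sub>m s r) D"
    define u where "u = four_block_mat (1\<^sub>m n) Z (0\<^sub>m n n) (1\<^sub>m n)"
    have uN: "u \<in> N_unip n" unfolding u_def N_unip_def using Z by blast
    have dG: "d \<in> carrier (GL (2 * n))"
      unfolding d_def using block_upper_GL[OF one_GL zero_carrier_mat D, of r] rs by simp
    have dP: "d \<in> parabolic [r, s]"
      using dG D rs by (auto simp: parabolic_two lower_zero_def d_def GL_carrier)
    have gG: "diag_embed n g \<in> carrier (GL (2 * n))" by (rule diag_embed_GL[OF g])
    have uG: "u \<in> carrier (GL (2 * n))" using uN upper_unip_GL[of n n] by (auto simp: N_unip_eq mult_2)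
    define z where "z = d * x * diag_embed n g * u"
    have zG: "z \<in> carrier (GL (2 * n))" unfolding z_def using dG x gG uG by (intro GL_mult_closed)
    note c = D[unfolded GL_carrier] g[unfolded GL_carrier]
    have z: "z = four_block_mat (X1 * g) (X1 * g * Z + X2 * g) (D * U * g) (D * U * g * Z + D * V * g)"
    proof -
      have "d * x = four_block_mat X1 X2 (D * U) (D * V)"
        unfolding X d_def using Xc c by (subst mult_four_block_mat[of _ r r _ s _ s _ _ n _ n]) auto
      moreover have "\<dots> * diag_embed n g = four_block_mat (X1 * g) (X2 * g) (D * U * g) (D * V * g)"
        unfolding diag_embed_def using Xc c by (subst mult_four_block_mat[of _ r n _ n _ s _ _ n _ n]) auto
      moreover have "\<dots> * u = four_block_mat (X1 * g) (X1 * g * Z + X2 * g) (D * U * g) (D * U * g * Z + D * V * g)"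
        unfolding u_def using Xc c Z by (subst mult_four_block_mat[of _ r n _ n _ s _ _ n _ n]) auto
      ultimately show ?thesis unfolding z_def by simp
    qed
    have wG: "rep_mat n r k \<in> carrier (GL (2 * n) :: 'f mat monoid)" by (rule rep_mat_GL[OF k])
    have "z $$ (i, j) = rep_mat n r k $$ (i, j)" if ij: "r \<le> i" "i < r + s" "j < r + s" for i j
    proof -
      have cc: "X1 * g \<in> carrier_mat r n" "D * U * g * Z + D * V * g \<in> carrier_mat s n" using Xc c Z by auto
      have "z $$ (i, j) = (if j < n then (D * U * g) $$ (i - r, j) else (D * U * g * Z + D * V * g) $$ (i - r, j - n))"
        unfolding z using ij rs cc Xc c Z by (subst index_mat_four_block) auto
      then show ?thesis using rows[of "i - r" j] rows[of "i - r" "j - n"] ij rs by auto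
    qed
    then have "\<forall>i j. r \<le> i \<longrightarrow> i < r + s \<longrightarrow> j < r + s \<longrightarrow> z $$ (i, j) = rep_mat n r k $$ (i, j)" by blast
    from bottom_rows_coset[OF zG[folded rs] wG[folded rs] this]
    obtain p where p: "p \<in> parabolic [r, s]" "z = p * rep_mat n r k" .
    have pG: "p \<in> carrier (GL (2 * n))" using p(1) rs by (auto simp: parabolic_two)
    let ?g = "diag_embed n g" and ?w = "rep_mat n r k :: 'f mat"
    let ?inv = "\<lambda>y. inv\<^bsub>GL (2 * n)\<^esub> y"
    have N: "subgroup (N_unip n) (GL (2 * n) :: 'f mat monoid)"
      using upper_unip_finite_character[OF \<psi>0, of 0 n n] by (simp add: finite_character_def N_unip_eq mult_2)
    have P: "subgroup (parabolic [r, s]) (GL (2 * n) :: 'f mat monoid)"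
      using subgroup_lower_zero[of "2 * n" r r] rs by (simp add: parabolic_two)
    obtain g' where g': "g' \<in> carrier (GL n)" "g * g' = 1\<^sub>m n" "g' * g = 1\<^sub>m n" by (rule GL_inverse[OF g])
    have ig: "?inv ?g = diag_embed n g'"
      using g' c diag_embed_GL[OF g'(1)] diag_embed_mult[of g' n g]
      by (intro GL_inv_eqI[OF gG]) (auto simp: GL_carrier diag_embed_def mult_2)
    define v where "v = ?g * ?inv u * ?inv ?g"
    have iu: "?inv u \<in> N_unip n" by (rule subgroup.m_inv_closed[OF N uN])
    have vN: "v \<in> N_unip n"
      using diag_embed_normalizes[OF g, of \<psi>0] iu by (auto simp: normalizes_def v_def)
    define p' where "p' = ?inv d * p"
    have p': "p' \<in> parabolic [r, s]"
      unfolding p'_def using subgroup.m_closed[OF P subgroup.m_inv_closed[OF P dP] p(1)] by simp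
    have "x = p' * ?w * diag_embed n g' * v"
      using solve_double_coset[of d x ?g u p ?w] dG x gG uG pG wG p(2)
      by (simp add: z_def p'_def v_def ig)
    then show ?thesis using k p' g'(1) vN by blast
  qed
qed

section \<open>The Levi blocks of the conjugates\<close>

lemma get_block_two_index:
  "get_block [p, q] 0 0 M = mat p p (\<lambda>(i, j). M $$ (i, j))"
  "get_block [p, q] 1 1 M = mat q q (\<lambda>(i, j). M $$ (p + i, p + j))"
  by (auto simp: get_block_def)

lemma nine_block_mat_eq:
  assumes "A \<in> carrier_mat a a" "B \<in> carrier_mat a b" "C \<in> carrier_mat a c"
    "D \<in> carrier_mat b a" "E \<in> carrier_mat b b" "F \<in> carrier_mat b c"
    "G \<in> carrier_mat c a" "H \<in> carrier_mat c b" "K \<in> carrier_mat c c"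
  shows "nine_block_mat A B C D E F G H K = mat (a + b + c) (a + b + c) (\<lambda>(i, j).
    if i < a then if j < a then A $$ (i, j) else if j < a + b then B $$ (i, j - a) else C $$ (i, j - a - b)
    else if i < a + b then
      if j < a then D $$ (i - a, j) else if j < a + b then E $$ (i - a, j - a) else F $$ (i - a, j - a - b)
    else if j < a then G $$ (i - a - b, j) else if j < a + b then H $$ (i - a - b, j - a)
      else K $$ (i - a - b, j - a - b))"
proof -
  note d = assms[THEN carrier_matD(1)] assms[THEN carrier_matD(2)]
  show ?thesis
    unfolding nine_block_mat_def append_cols_def append_rows_def
    by (intro eq_matI) (simp_all add: d less_diff_conv2)
qed

lemma N1_eq:
  assumes k: "2 * k \<le> r" shows "N1 r k = upper_unip k (r - k)"
proof -
  have e: "nine_block_mat (1\<^sub>m k) x y (0\<^sub>m k k) (1\<^sub>m k) (0\<^sub>m k (r - 2 * k))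
       (0\<^sub>m (r - 2 * k) k) (0\<^sub>m (r - 2 * k) k) (1\<^sub>m (r - 2 * k)) =
      four_block_mat (1\<^sub>m k) (append_cols x y) (0\<^sub>m (r - k) k) (1\<^sub>m (r - k) :: 'a mat)"
    if "x \<in> carrier_mat k k" "y \<in> carrier_mat k (r - 2 * k)" for x y
    using that k by (subst nine_block_mat_eq[of _ k _ k _ "r - 2 * k"])
      (auto simp: append_cols_def intro!: eq_matI)
  have c: "append_cols x y \<in> carrier_mat k (r - k)"
    if "x \<in> carrier_mat k k" "y \<in> carrier_mat k (r - 2 * k)" for x y :: "'a mat"
    using that k by (auto simp: append_cols_def)
  have s: "\<exists>x\<in>carrier_mat k k. \<exists>y\<in>carrier_mat k (r - 2 * k). X = append_cols x y"
    if X: "X \<in> carrier_mat k (r - k)" for X :: "'a mat"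
    by (rule bexI[of _ "mat k k (\<lambda>(i, j). X $$ (i, j))"],
        rule bexI[of _ "mat k (r - 2 * k) (\<lambda>(i, j). X $$ (i, k + j))"])
      (use X k in \<open>auto simp: append_cols_def intro!: eq_matI\<close>)
  show ?thesis
  proof (intro equalityI subsetI)
    fix u :: "'a mat" assume "u \<in> N1 r k"
    then obtain x y where "x \<in> carrier_mat k k" "y \<in> carrier_mat k (r - 2 * k)"
      "u = four_block_mat (1\<^sub>m k) (append_cols x y) (0\<^sub>m (r - k) k) (1\<^sub>m (r - k))"
      unfolding N1_def using e by auto
    then show "u \<in> upper_unip k (r - k)" unfolding upper_unip_def using c by blast
  next
    fix u :: "'a mat" assume "u \<in> upper_unip k (r - k)"
    then obtain X where X: "X \<in> carrier_mat k (r - k)" "u = four_block_mat (1\<^sub>m k) X (0\<^sub>m (r - k) k) (1\<^sub>m (r - k))"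
      unfolding upper_unip_def by blast
    obtain x y where xy: "x \<in> carrier_mat k k" "y \<in> carrier_mat k (r - 2 * k)" "X = append_cols x y"
      using s[OF X(1)] by blast
    show "u \<in> N1 r k" unfolding N1_def mem_Collect_eq X(2) xy(3) e[OF xy(1,2), symmetric] using xy(1,2) by blast
  qed
qed

lemma N2_eq:
  assumes k: "2 * k \<le> r" "r \<le> n + k" shows "N2 n r k = upper_unip (n - k) (n + k - r)"
proof -
  define a m where "a = r - 2 * k" and "m = n + k - r"
  have nk: "n - k = a + m" using k by (simp add: a_def m_def)
  define join where "join w z = mat (a + m) m (\<lambda>(i, j). if i < a then w $$ (i, j) else z $$ (i - a, j) :: 'a)" for w z
  have e: "nine_block_mat (1\<^sub>m a) (0\<^sub>m a m) w (0\<^sub>m m a) (1\<^sub>m m) z (0\<^sub>m m a) (0\<^sub>m m m) (1\<^sub>m m) =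
      four_block_mat (1\<^sub>m (a + m)) (join w z) (0\<^sub>m m (a + m)) (1\<^sub>m m :: 'a mat)"
    if "w \<in> carrier_mat a m" "z \<in> carrier_mat m m" for w z
    using that by (subst nine_block_mat_eq[of _ a _ m _ m]) (auto simp: join_def intro!: eq_matI)
  have c: "join w z \<in> carrier_mat (a + m) m" for w z by (simp add: join_def)
  have s: "\<exists>w\<in>carrier_mat a m. \<exists>z\<in>carrier_mat m m. X = join w z" if X: "X \<in> carrier_mat (a + m) m" for X
    by (rule bexI[of _ "mat a m (\<lambda>(i, j). X $$ (i, j))"], rule bexI[of _ "mat m m (\<lambda>(i, j). X $$ (a + i, j))"])
      (use X in \<open>auto simp: join_def intro!: eq_matI\<close>)
  show ?thesis
    unfolding nk a_def[symmetric] m_def[symmetric] N2_def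
  proof (intro equalityI subsetI)
    fix u :: "'a mat" assume "u \<in> {nine_block_mat (1\<^sub>m a) (0\<^sub>m a m) w (0\<^sub>m m a) (1\<^sub>m m) z (0\<^sub>m m a) (0\<^sub>m m m) (1\<^sub>m m)
      |w z. w \<in> carrier_mat a m \<and> z \<in> carrier_mat m m}"
    then obtain w z where "u = four_block_mat (1\<^sub>m (a + m)) (join w z) (0\<^sub>m m (a + m)) (1\<^sub>m m)"
      using e by auto
    then show "u \<in> upper_unip (a + m) m" unfolding upper_unip_def using c by blast
  next
    fix u :: "'a mat" assume "u \<in> upper_unip (a + m) m"
    then obtain X where X: "X \<in> carrier_mat (a + m) m" "u = four_block_mat (1\<^sub>m (a + m)) X (0\<^sub>m m (a + m)) (1\<^sub>m m)"
      unfolding upper_unip_def by blast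
    obtain w z where wz: "w \<in> carrier_mat a m" "z \<in> carrier_mat m m" "X = join w z" using s[OF X(1)] by blast
    show "u \<in> {nine_block_mat (1\<^sub>m a) (0\<^sub>m a m) w (0\<^sub>m m a) (1\<^sub>m m) z (0\<^sub>m m a) (0\<^sub>m m m) (1\<^sub>m m)
      |w z. w \<in> carrier_mat a m \<and> z \<in> carrier_mat m m}"
      unfolding mem_Collect_eq X(2) wz(3) e[OF wz(1,2), symmetric] using wz(1,2) by blast
  qed
qed

lemma \<psi>1_eq: "\<psi>1 \<psi>0 r k = upper_char \<psi>0 0 k"
  by (auto simp: \<psi>1_def upper_char_def mat_trace_def get_block_def fun_eq_iff)

lemma \<psi>2_eq:
  assumes k: "2 * k \<le> r" "r \<le> n + k" shows "\<psi>2 \<psi>0 n r k = upper_char \<psi>0 (r - 2 * k) (n - k)"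
proof -
  obtain a m where r: "r = 2 * k + a" and n: "n = k + a + m"
    by (rule that[of "r - 2 * k" "n + k - r"]) (use k in auto)
  have s: "r - 2 * k = a" "n + k - r = m" "n - k = a + m" "r - k = k + a" by (simp_all add: r n)
  show ?thesis
    unfolding \<psi>2_def upper_char_def s
    by (simp add: mat_trace_def get_block_def fun_eq_iff numeral_2_eq_2 add.assoc)
qed

lemma \<tau>_arg1_eq:
  assumes k: "2 * k \<le> r" "r \<le> n + k" and h: "h \<in> carrier_mat n n" "lower_zero k h"
  shows "\<tau>_arg1 n r k h = four_block_mat (mat k k (\<lambda>(i, j). h $$ (i, j))) (0\<^sub>m k (r - k))
    (0\<^sub>m (r - k) k) (mat (r - k) (r - k) (\<lambda>(i, j). h $$ (i, j)))"
  unfolding \<tau>_arg1_def Let_def using k h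
  by (subst nine_block_mat_eq[of _ k _ k _ "r - 2 * k"])
    (auto simp: get_block_def P_sizes_def lower_zero_def intro!: eq_matI)

lemma \<tau>_arg2_eq:
  assumes k: "2 * k \<le> r" "r \<le> n + k" and h: "h \<in> carrier_mat n n" "lower_zero (r - k) h"
  shows "\<tau>_arg2 n r k h = four_block_mat (mat (n - k) (n - k) (\<lambda>(i, j). h $$ (k + i, k + j)))
    (0\<^sub>m (n - k) (n + k - r)) (0\<^sub>m (n + k - r) (n - k))
    (mat (n + k - r) (n + k - r) (\<lambda>(i, j). h $$ (r - k + i, r - k + j)))"
proof -
  obtain a m where r: "r = 2 * k + a" and n: "n = k + a + m"
    by (rule that[of "r - 2 * k" "n + k - r"]) (use k in auto)
  have s: "r - 2 * k = a" "n + k - r = m" "n - k = a + m" "r - k = k + a" by (simp_all add: r n)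
  have z: "h $$ (i, j) = 0" if "i < n" "k + a \<le> i" "j < k + a" for i j
    using h that by (auto simp: lower_zero_def s(4) n)
  show ?thesis
    unfolding \<tau>_arg2_def Let_def s P_sizes_def
    by (subst nine_block_mat_eq[of _ a _ m _ m])
      (auto simp: get_block_def numeral_2_eq_2 z n add_ac intro!: eq_matI)
qed

abbreviation rep_conj :: "nat \<Rightarrow> nat \<Rightarrow> nat \<Rightarrow> 'f::field mat \<Rightarrow> 'f mat" where
  "rep_conj n r k M \<equiv> rep_mat n r k * M * inv\<^bsub>GL (2 * n)\<^esub> (rep_mat n r k)"

lemma rep_mat_conj:
  assumes "r \<le> n + k" "2 * k \<le> r" "r \<le> n + k'" "2 * k' \<le> r" and M: "M \<in> carrier_mat (2 * n) (2 * n)"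
  shows "rep_mat n r k * M * inv\<^bsub>GL (2 * n)\<^esub> (rep_mat n r k' :: 'f::field mat) =
    mat (2 * n) (2 * n) (\<lambda>(i, j). M $$ (rep_index n r k i, rep_index n r k' j))"
  unfolding rep_mat_def
  by (rule perm_mat_conj[OF M _ _ rep_index_inj[OF assms(3,4)]]) (auto intro: rep_index_less assms)

lemma conj_diag_embed:
  fixes h :: "'f::field mat"
  assumes k: "r \<le> n + k" "2 * k \<le> r" and rs: "r + s = 2 * n"
    and h: "h \<in> carrier_mat n n" "lower_zero k h" "lower_zero (r - k) h"
  defines "M \<equiv> rep_conj n r k (diag_embed n h)"
  shows "lower_zero r M" "get_block [r, s] 0 0 M = \<tau>_arg1 n r k h" "get_block [r, s] 1 1 M = \<tau>_arg2 n r k h"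
proof -
  have d: "diag_embed n h \<in> carrier_mat (2 * n) (2 * n)" using h by (auto simp: diag_embed_def mult_2)
  have M: "M = mat (2 * n) (2 * n) (\<lambda>(i, j). diag_embed n h $$ (rep_index n r k i, rep_index n r k j))"
    unfolding M_def by (rule rep_mat_conj[OF k k d])
  have D: "diag_embed n h $$ (i, j) = (if i < n then if j < n then h $$ (i, j) else 0
      else if j < n then 0 else h $$ (i - n, j - n))" if "i < 2 * n" "j < 2 * n" for i j
    using that h by (auto simp: diag_embed_def)
  have M': "M $$ (i, j) = (if rep_index n r k i < n then if rep_index n r k j < n
      then h $$ (rep_index n r k i, rep_index n r k j) else 0 else if rep_index n r k j < n then 0
      else h $$ (rep_index n r k i - n, rep_index n r k j - n))" if "i < 2 * n" "j < 2 * n" for i j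
    unfolding M using that D rep_index_less[OF k] by simp
  have Mc: "M \<in> carrier_mat (2 * n) (2 * n)" unfolding M by simp
  have z: "h $$ (i, j) = 0" if "i < n" "j < n" "k \<le> i \<and> j < k \<or> r - k \<le> i \<and> j < r - k" for i j
    using that h by (auto simp: lower_zero_def)
  obtain a m where r: "r = 2 * k + a" and n: "n = k + a + m"
    by (rule that[of "r - 2 * k" "n + k - r"]) (use k in auto)
  have e: "r - 2 * k = a" "n + k - r = m" "n - k = a + m" "r - k = k + a" by (simp_all add: r n)
  have ss: "s = a + 2 * m" using rs by (simp add: r n)
  have I: "rep_index n r k i = (if i < k then i else if i < 2 * k + a then a + m + i
      else if i < 2 * (k + a) + m then i - (k + a) else i)" for i
    by (auto simp: rep_index_def r n)
  note z' = z[unfolded e n] and M2 = M'[unfolded I]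
  show "lower_zero r M"
    unfolding lower_zero_def carrier_matD[OF Mc]
  proof (intro allI impI)
    fix i j assume ij: "i < 2 * n" "j < 2 * n" "r \<le> i" "j < r"
    then show "M $$ (i, j) = 0"
      unfolding M2[OF ij(1,2)] by (auto simp: r n intro!: z')
  qed
  show "get_block [r, s] 0 0 M = \<tau>_arg1 n r k h"
    unfolding \<tau>_arg1_eq[OF k(2,1) h(1,2)] get_block_two_index e
    by (intro eq_matI) (auto simp: M2 r n z')
  show "get_block [r, s] 1 1 M = \<tau>_arg2 n r k h"
    unfolding \<tau>_arg2_eq[OF k(2,1) h(1,3)] get_block_two_index e
    by (intro eq_matI) (auto simp: M2 r n ss z')
qed

lemma conj_unipotent:
  fixes X :: "'f::field mat"
  assumes k: "r \<le> n + k" "2 * k \<le> r" and rs: "r + s = 2 * n" and X: "X \<in> carrier_mat n n"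
  defines "M \<equiv> rep_conj n r k (four_block_mat (1\<^sub>m n) X (0\<^sub>m n n) (1\<^sub>m n))"
  shows "lower_zero r M \<longleftrightarrow> (\<forall>i<n. \<forall>j<r - k. k \<le> i \<longrightarrow> X $$ (i, j) = 0)"
    "get_block [r, s] 0 0 M = four_block_mat (1\<^sub>m k) (mat k (r - k) (\<lambda>(i, j). X $$ (i, j))) (0\<^sub>m (r - k) k) (1\<^sub>m (r - k))"
    "get_block [r, s] 1 1 M = four_block_mat (1\<^sub>m (n - k)) (mat (n - k) (n + k - r) (\<lambda>(i, j). X $$ (k + i, r - k + j)))
      (0\<^sub>m (n + k - r) (n - k)) (1\<^sub>m (n + k - r))"
proof -
  let ?u = "four_block_mat (1\<^sub>m n) X (0\<^sub>m n n) (1\<^sub>m n)"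
  have d: "?u \<in> carrier_mat (2 * n) (2 * n)" using X by (auto simp: mult_2)
  have M: "M = mat (2 * n) (2 * n) (\<lambda>(i, j). ?u $$ (rep_index n r k i, rep_index n r k j))"
    unfolding M_def by (rule rep_mat_conj[OF k k d])
  have D: "?u $$ (i, j) = (if i < n \<and> n \<le> j then X $$ (i, j - n) else if i = j then 1 else 0)"
    if "i < 2 * n" "j < 2 * n" for i j
    using that X by auto
  have M': "M $$ (i, j) = (if rep_index n r k i < n \<and> n \<le> rep_index n r k j
      then X $$ (rep_index n r k i, rep_index n r k j - n) else if i = j then 1 else 0)"
    if "i < 2 * n" "j < 2 * n" for i j
  proof -
    have "M $$ (i, j) = ?u $$ (rep_index n r k i, rep_index n r k j)"
      unfolding M using that by (simp del: index_mat_four_block)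
    then show ?thesis
      unfolding D[OF rep_index_less[OF k that(1)] rep_index_less[OF k that(2)]]
      using inj_on_eq_iff[OF rep_index_inj[OF k], of i j] that by auto
  qed
  have Mc: "M \<in> carrier_mat (2 * n) (2 * n)" unfolding M by simp
  show "lower_zero r M \<longleftrightarrow> (\<forall>i<n. \<forall>j<r - k. k \<le> i \<longrightarrow> X $$ (i, j) = 0)"
  proof
    assume L: "lower_zero r M"
    have "X $$ (i, j) = 0" if "i < n" "j < r - k" "k \<le> i" for i j
    proof -
      have "M $$ (r + i - k, k + j) = 0" using L Mc that k rs by (auto simp: lower_zero_def)
      moreover have "rep_index n r k (r + i - k) = i" "rep_index n r k (k + j) = n + j"
        using that k by (auto simp: rep_index_def)
      ultimately show ?thesis using M'[of "r + i - k" "k + j"] that k rs by auto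
    qed
    then show "\<forall>i<n. \<forall>j<r - k. k \<le> i \<longrightarrow> X $$ (i, j) = 0" by blast
  next
    assume z: "\<forall>i<n. \<forall>j<r - k. k \<le> i \<longrightarrow> X $$ (i, j) = 0"
    show "lower_zero r M"
      unfolding lower_zero_def
    proof (intro allI impI)
      fix i j assume "i < dim_row M" "j < dim_col M" and ij: "r \<le> i" "j < r"
      then have b: "i < 2 * n" "j < 2 * n" using Mc by auto
      have "X $$ (rep_index n r k i, rep_index n r k j - n) = 0"
        if "rep_index n r k i < n" "n \<le> rep_index n r k j"
        using that ij b k by (intro z[rule_format]) (auto simp: rep_index_def split: if_splits)
      then show "M $$ (i, j) = 0" using M'[OF b] ij by auto
    qed
  qed
  obtain a m where r: "r = 2 * k + a" and n: "n = k + a + m"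
    by (rule that[of "r - 2 * k" "n + k - r"]) (use k in auto)
  have e: "r - 2 * k = a" "n + k - r = m" "n - k = a + m" "r - k = k + a" by (simp_all add: r n)
  have ss: "s = a + 2 * m" using rs by (simp add: r n)
  have I: "rep_index n r k i = (if i < k then i else if i < 2 * k + a then a + m + i
      else if i < 2 * (k + a) + m then i - (k + a) else i)" for i
    by (auto simp: rep_index_def r n)
  show "get_block [r, s] 0 0 M = four_block_mat (1\<^sub>m k) (mat k (r - k) (\<lambda>(i, j). X $$ (i, j))) (0\<^sub>m (r - k) k) (1\<^sub>m (r - k))"
    unfolding get_block_two_index e
    by (intro eq_matI) (auto simp: M'[unfolded I] r n)
  show "get_block [r, s] 1 1 M = four_block_mat (1\<^sub>m (n - k)) (mat (n - k) (n + k - r) (\<lambda>(i, j). X $$ (k + i, r - k + j)))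
      (0\<^sub>m (n + k - r) (n - k)) (1\<^sub>m (n + k - r))"
    unfolding get_block_two_index e
    by (intro eq_matI) (auto simp: M'[unfolded I] r n ss)
qed

text \<open>The conjugate lies in \<open>P\<close> only if \<open>h\<close> has two zero blocks, in the rows from \<open>k\<close> and columns below \<open>k'\<close>
  and in the rows from \<open>r - k\<close> and columns below \<open>r - k'\<close>. By invertibility these force \<open>k' \<le> k\<close> and
  \<open>k \<le> k'\<close>, and then say that \<open>h\<close> is block triangular.\<close>

lemma conj_disjoint:
  fixes h :: "'f::field mat"
  assumes k: "r \<le> n + k" "2 * k \<le> r" and k': "r \<le> n + k'" "2 * k' \<le> r"
    and h: "h \<in> carrier (GL n)" and u: "u \<in> N_unip n"
    and P: "lower_zero r (rep_mat n r k * (diag_embed n h * u) * inv\<^bsub>GL (2 * n)\<^esub> (rep_mat n r k'))"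
  shows "k = k'" "h \<in> parabolic (P_sizes n r k)"
proof -
  obtain X where X: "X \<in> carrier_mat n n" "u = four_block_mat (1\<^sub>m n) X (0\<^sub>m n n) (1\<^sub>m n)"
    using u by (auto simp: N_unip_def)
  have hc: "h \<in> carrier_mat n n" using h by (simp add: GL_carrier)
  have e: "diag_embed n h * u = four_block_mat h (h * X) (0\<^sub>m n n) h"
    unfolding X(2) diag_embed_def using hc X(1) by (subst mult_four_block_mat[of _ n n _ n _ n _ _ n _ n]) auto
  have c: "diag_embed n h * u \<in> carrier_mat (2 * n) (2 * n)" unfolding e using hc X by (auto simp: mult_2)
  have P': "(diag_embed n h * u) $$ (rep_index n r k i, rep_index n r k' j) = 0"
    if "r \<le> i" "i < 2 * n" "j < r" "j < 2 * n" for i j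
    using P that unfolding rep_mat_conj[OF k k' c] lower_zero_def by auto
  have 1: "h $$ (a, b) = 0" if "a < n" "k \<le> a" "b < k'" for a b
  proof -
    have "rep_index n r k (r + a - k) = a" "rep_index n r k' b = b" using that k k' by (auto simp: rep_index_def)
    then show ?thesis using P'[of "r + a - k" b] that k k' hc unfolding e by auto
  qed
  have 2: "h $$ (a, b) = 0" if "a < n" "r - k \<le> a" "b < r - k'" for a b
  proof -
    have "rep_index n r k (n + a) = n + a" "rep_index n r k' (k' + b) = n + b"
      using that k k' by (auto simp: rep_index_def)
    then show ?thesis using P'[of "n + a" "k' + b"] that k k' hc unfolding e by auto
  qed
  have "k' \<le> k" by (rule zero_block_bound[OF h 1]) (use k k' in auto)
  moreover have "r - k' \<le> r - k" by (rule zero_block_bound[OF h 2]) (use k k' in auto)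
  ultimately show kk: "k = k'" using k k' by linarith
  show "h \<in> parabolic (P_sizes n r k)"
    unfolding parabolic_three[OF k(2,1)] using h hc 1 2 by (auto simp: lower_zero_def kk)
qed

section \<open>Characters and stabilizers at the representatives\<close>

lemma mult_shift_mat:
  assumes A: "A \<in> carrier_mat p p" and B: "B \<in> carrier_mat q q" and ij: "i < q" "j < p" and d: "d \<le> p" "p - d \<le> q"
  shows "(shift_mat d p q * A) $$ (i, j) = (if i < p - d then A $$ (d + i, j) else 0)"
    "(B * shift_mat d p q) $$ (i, j) = (if d \<le> j then B $$ (i, j - d) else 0 :: 'f::field)"
proof -
  have J: "shift_mat d p q \<in> carrier_mat q p" by (simp add: shift_mat_def)
  have "(shift_mat d p q * A) $$ (i, j) = (\<Sum>t<p. if t = d + i then (if i < p - d then A $$ (t, j) else 0) else 0)"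
    unfolding mult_index[OF J A ij] using ij by (intro sum.cong) (auto simp: shift_mat_def)
  also have "\<dots> = (if i < p - d then A $$ (d + i, j) else 0)" by (subst sum.delta) auto
  finally show "(shift_mat d p q * A) $$ (i, j) = (if i < p - d then A $$ (d + i, j) else 0)" .
  have "(B * shift_mat d p q) $$ (i, j) = (\<Sum>t<q. if t = j - d then (if d \<le> j then B $$ (i, t) else 0) else 0)"
    unfolding mult_index[OF B J ij] using ij by (intro sum.cong) (auto simp: shift_mat_def)
  also have "\<dots> = (if d \<le> j then B $$ (i, j - d) else 0)" using ij d by (subst sum.delta) auto
  finally show "(B * shift_mat d p q) $$ (i, j) = (if d \<le> j then B $$ (i, j - d) else 0)" .
qed

lemma block_diag_GL_D:
  assumes "four_block_mat A (0\<^sub>m p q) (0\<^sub>m q p) B \<in> carrier (GL (p + q) :: 'f::field mat monoid)"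
    "A \<in> carrier_mat p p" "B \<in> carrier_mat q q"
  shows "A \<in> carrier (GL p)" "B \<in> carrier (GL q)"
  using assms det_four_block_mat_lower_left_zero[of A p "0\<^sub>m p q" q "0\<^sub>m q p" B] by (auto simp: GL_carrier)

text \<open>Both arguments of \<open>\<tau>\<^sub>k\<close> are block diagonal, with blocks cut out of \<open>h\<close>. The condition \<open>J A = B J\<close> of
  \<open>upper_unip_normalizes\<close> holds because \<open>h\<close> is block triangular.\<close>

lemma \<tau>_args_normalize:
  fixes h :: "'f::{field, finite} mat"
  assumes k: "r \<le> n + k" "2 * k \<le> r" and rs: "r + s = 2 * n" and h: "h \<in> parabolic (P_sizes n r k)"
  shows "normalizes (GL r) (N1 r k) (\<psi>1 \<psi>0 r k) (\<tau>_arg1 n r k h)"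
    "normalizes (GL s) (N2 n r k) (\<psi>2 \<psi>0 n r k) (\<tau>_arg2 n r k h)"
    "rep_conj n r k (diag_embed n h) \<in> parabolic [r, s]"
proof -
  have hG: "h \<in> carrier (GL n)" and h': "h \<in> carrier_mat n n" "lower_zero k h" "lower_zero (r - k) h"
    using h by (auto simp: parabolic_three[OF k(2,1)] GL_carrier)
  let ?M = "rep_conj n r k (diag_embed n h)"
  note M = conj_diag_embed[OF k rs h']
  interpret group "GL (2 * n) :: 'f mat monoid" by (rule GL_group)
  have "?M \<in> carrier (GL (2 * n))"
    using rep_mat_GL[OF k] diag_embed_GL[OF hG] by (intro GL_mult_closed) auto
  then show P: "?M \<in> parabolic [r, s]" using M(1) rs by (simp add: parabolic_two)
  have "(get_block [r, s] 0 0 ?M, get_block [r, s] 1 1 ?M) \<in> carrier (GL r \<times>\<times> (GL s :: 'f mat monoid))"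
    using diagonal_blocks_hom[of r s] P by (auto simp: hom_def)
  then have G: "\<tau>_arg1 n r k h \<in> carrier (GL r)" "\<tau>_arg2 n r k h \<in> carrier (GL s)"
    unfolding M(2,3) by auto
  obtain a m where r: "r = 2 * k + a" and n: "n = k + a + m"
    by (rule that[of "r - 2 * k" "n + k - r"]) (use k in auto)
  have e: "r - 2 * k = a" "n + k - r = m" "n - k = a + m" "r - k = k + a" by (simp_all add: r n)
  have ss: "s = a + m + m" and rr: "r = k + (k + a)" using rs by (simp_all add: r n)
  have z: "h $$ (i, j) = 0" if "i < n" "j < n" "k \<le> i \<and> j < k \<or> k + a \<le> i \<and> j < k + a" for i j
    using that h' by (auto simp: lower_zero_def e)
  define A where "A = mat k k (\<lambda>(i, j). h $$ (i, j))"
  define B where "B = mat (k + a) (k + a) (\<lambda>(i, j). h $$ (i, j))"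
  define C where "C = mat (a + m) (a + m) (\<lambda>(i, j). h $$ (k + i, k + j))"
  define D where "D = mat m m (\<lambda>(i, j). h $$ (k + a + i, k + a + j))"
  have c: "A \<in> carrier_mat k k" "B \<in> carrier_mat (k + a) (k + a)" "C \<in> carrier_mat (a + m) (a + m)"
    "D \<in> carrier_mat m m" by (simp_all add: A_def B_def C_def D_def)
  have 1: "\<tau>_arg1 n r k h = four_block_mat A (0\<^sub>m k (k + a)) (0\<^sub>m (k + a) k) B"
    unfolding \<tau>_arg1_eq[OF k(2,1) h'(1,2)] e A_def B_def ..
  have 2: "\<tau>_arg2 n r k h = four_block_mat C (0\<^sub>m (a + m) m) (0\<^sub>m m (a + m)) D"
    unfolding \<tau>_arg2_eq[OF k(2,1) h'(1,3)] e C_def D_def ..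
  note AB = block_diag_GL_D[OF G(1)[unfolded 1, unfolded rr] c(1,2)]
  note CD = block_diag_GL_D[OF G(2)[unfolded 2, unfolded ss] c(3,4)]
  have J1: "shift_mat 0 k (k + a) * A = B * shift_mat 0 k (k + a)"
  proof (rule eq_matI)
    fix i j assume "i < dim_row (B * shift_mat 0 k (k + a))" "j < dim_col (B * shift_mat 0 k (k + a))"
    then have ij: "i < k + a" "j < k" using c by (auto simp: shift_mat_def)
    show "(shift_mat 0 k (k + a) * A) $$ (i, j) = (B * shift_mat 0 k (k + a)) $$ (i, j)"
      unfolding mult_shift_mat[OF c(1,2) ij le0 order.trans[OF diff_le_self le_add1]]
      using ij by (auto simp: A_def B_def n intro!: z)
  qed (use c in \<open>auto simp: shift_mat_def\<close>)
  have J2: "shift_mat a (a + m) m * C = D * shift_mat a (a + m) m"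
  proof (rule eq_matI)
    fix i j assume "i < dim_row (D * shift_mat a (a + m) m)" "j < dim_col (D * shift_mat a (a + m) m)"
    then have ij: "i < m" "j < a + m" using c by (auto simp: shift_mat_def)
    have d: "a \<le> a + m" "a + m - a \<le> m" by auto
    show "(shift_mat a (a + m) m * C) $$ (i, j) = (D * shift_mat a (a + m) m) $$ (i, j)"
      unfolding mult_shift_mat[OF c(3,4) ij d]
      using ij by (auto simp: C_def D_def n add_ac intro!: z)
  qed (use c in \<open>auto simp: shift_mat_def\<close>)
  show "normalizes (GL r) (N1 r k) (\<psi>1 \<psi>0 r k) (\<tau>_arg1 n r k h)"
    using upper_unip_normalizes[OF _ _ AB(1) zero_carrier_mat AB(2) J1, of \<psi>0]
    unfolding N1_eq[OF k(2)] \<psi>1_eq e 1 by (simp add: rr)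
  show "normalizes (GL s) (N2 n r k) (\<psi>2 \<psi>0 n r k) (\<tau>_arg2 n r k h)"
    using upper_unip_normalizes[OF _ _ CD(1) zero_carrier_mat CD(2) J2, of \<psi>0]
    unfolding N2_eq[OF k(2,1)] \<psi>2_eq[OF k(2,1)] e 2 by (simp add: ss)
qed

lemma N12_finite_character:
  fixes \<psi>0 :: "'f::{field, finite} \<Rightarrow> complex"
  assumes k: "r \<le> n + k" "2 * k \<le> r" and rs: "r + s = 2 * n" and \<psi>0: "nontrivial_additive_character \<psi>0"
  shows "finite_character (GL r) (N1 r k) (\<psi>1 \<psi>0 r k)" "finite_character (GL s) (N2 n r k) (\<psi>2 \<psi>0 n r k)"
proof -
  have "finite_character (GL (k + (r - k))) (upper_unip k (r - k)) (upper_char \<psi>0 0 k)"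
    by (rule upper_unip_finite_character[OF \<psi>0]) (use k in auto)
  then show "finite_character (GL r) (N1 r k) (\<psi>1 \<psi>0 r k)"
    unfolding N1_eq[OF k(2)] \<psi>1_eq using k by simp
  have "finite_character (GL (n - k + (n + k - r))) (upper_unip (n - k) (n + k - r)) (upper_char \<psi>0 (r - 2 * k) (n - k))"
    by (rule upper_unip_finite_character[OF \<psi>0]) (use k in auto)
  moreover have "n - k + (n + k - r) = s" using k rs by auto
  ultimately show "finite_character (GL s) (N2 n r k) (\<psi>2 \<psi>0 n r k)"
    unfolding N2_eq[OF k(2,1)] \<psi>2_eq[OF k(2,1)] by simp
qed

text \<open>The conjugate of \<open>1 + X\<close> lies in \<open>P\<close> when the rows of \<open>X\<close> from \<open>k\<close> vanish in the columns below
  \<open>r - k\<close>. What is left of \<open>X\<close> are two independent blocks, which are those of \<open>N1\<close> and \<open>N2\<close>, and the diagonal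
  of \<open>X\<close> outside these blocks vanishes, so that the traces add up.\<close>

lemma conj_N_blocks:
  fixes \<psi>0 :: "'f::{field, finite} \<Rightarrow> complex"
  assumes k: "r \<le> n + k" "2 * k \<le> r" and rs: "r + s = 2 * n" and \<psi>0: "nontrivial_additive_character \<psi>0"
  defines "M \<equiv> rep_conj n r k"
  shows "u \<in> N_unip n \<Longrightarrow> M u \<in> parabolic [r, s] \<Longrightarrow>
      get_block [r, s] 0 0 (M u) \<in> N1 r k \<and> get_block [r, s] 1 1 (M u) \<in> N2 n r k \<and>
      \<psi>N \<psi>0 n u = \<psi>1 \<psi>0 r k (get_block [r, s] 0 0 (M u)) * \<psi>2 \<psi>0 n r k (get_block [r, s] 1 1 (M u))"
    and "u1 \<in> N1 r k \<Longrightarrow> u2 \<in> N2 n r k \<Longrightarrow> \<exists>u\<in>N_unip n. M u \<in> parabolic [r, s] \<and>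
      get_block [r, s] 0 0 (M u) = u1 \<and> get_block [r, s] 1 1 (M u) = u2"
proof -
  interpret group "GL (2 * n) :: 'f mat monoid" by (rule GL_group)
  obtain a m where r: "r = 2 * k + a" and n: "n = k + a + m"
    by (rule that[of "r - 2 * k" "n + k - r"]) (use k in auto)
  have e: "r - 2 * k = a" "n + k - r = m" "n - k = a + m" "r - k = k + a" by (simp_all add: r n)
  have add: "\<psi>0 (x + y) = \<psi>0 x * \<psi>0 y" for x y
    using \<psi>0 by (auto simp: nontrivial_additive_character_def)
  {
    assume u: "u \<in> N_unip n" and P: "M u \<in> parabolic [r, s]"
    obtain X where X: "X \<in> carrier_mat n n" "u = four_block_mat (1\<^sub>m n) X (0\<^sub>m n n) (1\<^sub>m n)"
      using u by (auto simp: N_unip_def)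
    have Mu: "M u = rep_conj n r k u" by (simp add: M_def)
    note B = conj_unipotent[OF k rs X(1), folded X(2), folded Mu, unfolded e]
    have L: "\<forall>i<n. \<forall>j<k + a. k \<le> i \<longrightarrow> X $$ (i, j) = 0"
      using P B(1) by (simp add: parabolic_two)
    let ?X1 = "mat k (k + a) (\<lambda>(i, j). X $$ (i, j))" and ?X2 = "mat (a + m) m (\<lambda>(i, j). X $$ (k + i, k + a + j))"
    have c: "?X1 \<in> carrier_mat k (k + a)" "?X2 \<in> carrier_mat (a + m) m" by simp_all
    have "\<psi>N \<psi>0 n u = \<psi>0 (\<Sum>i<n. X $$ (i, i))"
      unfolding \<psi>N_eq X(2) using upper_char_block[OF X(1), of 0 \<psi>0] by simp
    also have "(\<Sum>i<n. X $$ (i, i)) = (\<Sum>i<k. X $$ (i, i)) + (\<Sum>i<m. X $$ (k + a + i, k + a + i))"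
    proof -
      have "(\<Sum>i<n. X $$ (i, i)) = (\<Sum>i<k. X $$ (i, i)) + (\<Sum>i\<in>{k..<n}. X $$ (i, i))"
        using sum.atLeastLessThan_concat[of 0 k n "\<lambda>i. X $$ (i, i)"] by (simp add: n lessThan_atLeast0)
      also have "(\<Sum>i\<in>{k..<n}. X $$ (i, i)) = (\<Sum>i\<in>{k + a..<n}. X $$ (i, i))"
        using L by (intro sum.mono_neutral_right) (auto simp: n)
      also have "\<dots> = (\<Sum>i<m. X $$ (k + a + i, k + a + i))"
        using sum.shift_bounds_nat_ivl[of "\<lambda>i. X $$ (i, i)" 0 "k + a" m] by (simp add: n lessThan_atLeast0 add_ac)
      finally show ?thesis .
    qed
    also have "\<psi>0 \<dots> = upper_char \<psi>0 0 k (get_block [r, s] 0 0 (M u)) * upper_char \<psi>0 a (a + m) (get_block [r, s] 1 1 (M u))"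
      unfolding B(2,3) add using upper_char_block[OF c(1), of 0 \<psi>0] upper_char_block[OF c(2), of a \<psi>0]
      by (simp add: add_ac)
    finally show "get_block [r, s] 0 0 (M u) \<in> N1 r k \<and> get_block [r, s] 1 1 (M u) \<in> N2 n r k \<and>
      \<psi>N \<psi>0 n u = \<psi>1 \<psi>0 r k (get_block [r, s] 0 0 (M u)) * \<psi>2 \<psi>0 n r k (get_block [r, s] 1 1 (M u))"
      unfolding N1_eq[OF k(2)] N2_eq[OF k(2,1)] \<psi>1_eq \<psi>2_eq[OF k(2,1)] e
      unfolding B(2,3) upper_unip_def using c by blast
  }
  {
    assume "u1 \<in> N1 r k" "u2 \<in> N2 n r k"
    then obtain X1 X2 where X1: "X1 \<in> carrier_mat k (k + a)" "u1 = four_block_mat (1\<^sub>m k) X1 (0\<^sub>m (k + a) k) (1\<^sub>m (k + a))"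
      and X2: "X2 \<in> carrier_mat (a + m) m" "u2 = four_block_mat (1\<^sub>m (a + m)) X2 (0\<^sub>m m (a + m)) (1\<^sub>m m)"
      unfolding N1_eq[OF k(2)] N2_eq[OF k(2,1)] e upper_unip_def by blast
    define X where "X = mat n n (\<lambda>(i, j). if i < k then if j < k + a then X1 $$ (i, j) else 0
      else if k + a \<le> j then X2 $$ (i - k, j - (k + a)) else 0)"
    have X: "X \<in> carrier_mat n n" by (simp add: X_def)
    let ?u = "four_block_mat (1\<^sub>m n) X (0\<^sub>m n n) (1\<^sub>m n)"
    have u: "?u \<in> N_unip n" unfolding N_unip_def using X by blast
    note B = conj_unipotent[OF k rs X, unfolded e]
    have uG: "?u \<in> carrier (GL (2 * n))" using u upper_unip_GL[of n n] by (auto simp: N_unip_eq mult_2)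
    have "M ?u \<in> carrier (GL (2 * n))"
      unfolding M_def using rep_mat_GL[OF k] uG by (intro GL_mult_closed) auto
    moreover have "lower_zero r (M ?u)" unfolding M_def B(1) by (auto simp: X_def n)
    ultimately have P: "M ?u \<in> parabolic [r, s]" using rs by (simp add: parabolic_two)
    have "mat k (k + a) (\<lambda>(i, j). X $$ (i, j)) = X1" "mat (a + m) m (\<lambda>(i, j). X $$ (k + i, k + a + j)) = X2"
      using X1(1) X2(1) by (auto simp: X_def n intro!: eq_matI)
    then have "get_block [r, s] 0 0 (M ?u) = u1" "get_block [r, s] 1 1 (M ?u) = u2"
      unfolding M_def B(2,3) X1(2) X2(2) by simp_all
    with u P show "\<exists>u\<in>N_unip n. M u \<in> parabolic [r, s] \<and>
      get_block [r, s] 0 0 (M u) = u1 \<and> get_block [r, s] 1 1 (M u) = u2" by blast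
  }
qed

section \<open>The decomposition\<close>

theorem theorem4p17:
  fixes \<psi>0 :: "'f::{field, finite} \<Rightarrow> complex"
    and n r :: nat
    and \<rho>1 :: "('v, 'f mat) rep"
    and \<rho>2 :: "('w, 'f mat) rep"
  assumes "nontrivial_additive_character \<psi>0"
    and "1 \<le> r" and "r < 2 * n"
    and "fin_dim_representation (GL r) \<rho>1"
    and "fin_dim_representation (GL (2 * n - r)) \<rho>2"
  shows "rep_iso (Delta_GL n)
    (twisted_coinvariants (parabolic_induction r (2 * n - r) \<rho>1 \<rho>2) (N_unip n) (\<psi>N \<psi>0 n))
    (direct_sum_rep {nat (max 0 (int r - int n))..r div 2}
      (\<lambda>k. induced_rep (Delta_GL n) (diag_embed n ` parabolic (P_sizes n r k))
             (\<tau> \<psi>0 n r \<rho>1 \<rho>2 k)))"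
proof -
  define s where "s = 2 * n - r"
  have rs: "r + s = 2 * n" using assms(3) by (simp add: s_def)
  note \<psi>0 = assms(1)
  have R1: "representation (GL r) \<rho>1" and R2: "representation (GL s) \<rho>2"
    using assms(4,5) by (auto simp: fin_dim_representation_def s_def)
  let ?G = "GL (2 * n) :: 'f mat monoid" and ?P = "parabolic [r, s] :: 'f mat set"
  let ?K = "{nat (max 0 (int r - int n))..r div 2}"
  let ?blocks = "\<lambda>p. (get_block [r, s] 0 0 p, get_block [r, s] 1 1 p)"
  let ?T = "tensor_rep \<rho>1 \<rho>2"
  let ?V = "pullback ?blocks ?T"
  let ?C = "\<lambda>k. tensor_rep (twisted_coinvariants \<rho>1 (N1 r k) (\<psi>1 \<psi>0 r k))
    (twisted_coinvariants \<rho>2 (N2 n r k) (\<psi>2 \<psi>0 n r k))"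
  have K: "r \<le> n + k" "2 * k \<le> r" if "k \<in> ?K" for k using that by auto
  have KI: "k \<in> ?K" if "r \<le> n + k" "2 * k \<le> r" for k using that by auto
  have T: "representation (GL r \<times>\<times> GL s) ?T" by (rule representation_tensor[OF R1 R2])
  have P: "subgroup ?P ?G"
    using subgroup_lower_zero[of "2 * n" r r] rs by (simp add: parabolic_two)
  have V: "representation (?G\<lparr>carrier := ?P\<rparr>) ?V"
    using representation_pullback[OF T group.subgroup_imp_group[OF GL_group P]] diagonal_blocks_hom[of r s]
    unfolding rs by blast
  \<comment> \<open>The properties that \<open>tensor_coinvariants\<close> gives for the quotient map at the parameter \<open>k\<close>.\<close>
  define quot where "quot k f \<longleftrightarrow> f \<in> lin ?T (?C k) \<and>
    (\<forall>g h t. normalizes (GL r) (N1 r k) (\<psi>1 \<psi>0 r k) g \<longrightarrow> normalizes (GL s) (N2 n r k) (\<psi>2 \<psi>0 n r k) h \<longrightarrow>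
      t \<in> carrier ?T \<longrightarrow> f (act ?T (g, h) t) = act (?C k) (g, h) (f t)) \<and>
    (\<forall>y\<in>carrier (?C k). \<exists>!t. t \<in> carrier ?T \<and> f t = y \<and>
        (\<forall>u1\<in>N1 r k. \<forall>u2\<in>N2 n r k. act ?T (u1, u2) t = (\<psi>1 \<psi>0 r k u1 * \<psi>2 \<psi>0 n r k u2) \<odot>\<^bsub>?T\<^esub> t))" for k f
  have "\<exists>f. quot k f" if "k \<in> ?K" for k
  proof -
    note f = N12_finite_character[OF K[OF that] rs \<psi>0]
    show ?thesis
      by (rule tensor_coinvariants[OF R1 R2 f], rule exI, unfold quot_def, intro conjI allI impI ballI) assumption+
  qed
  then obtain q where Q: "\<And>k. k \<in> ?K \<Longrightarrow> quot k (q k)" by metis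
  have q: "q k \<in> lin ?T (?C k)" if "k \<in> ?K" for k
    using Q[OF that] unfolding quot_def by (rule conjunct1)
  have q_act: "q k (act ?T (g, h) t) = act (?C k) (g, h) (q k t)"
    if "k \<in> ?K" "normalizes (GL r) (N1 r k) (\<psi>1 \<psi>0 r k) g" "normalizes (GL s) (N2 n r k) (\<psi>2 \<psi>0 n r k) h"
      "t \<in> carrier ?T" for k g h t
    using Q[OF that(1), unfolded quot_def, THEN conjunct2, THEN conjunct1] that(2-4) by simp
  have q_lift: "\<exists>!t. t \<in> carrier ?T \<and> q k t = y \<and>
        (\<forall>u1\<in>N1 r k. \<forall>u2\<in>N2 n r k. act ?T (u1, u2) t = (\<psi>1 \<psi>0 r k u1 * \<psi>2 \<psi>0 n r k u2) \<odot>\<^bsub>?T\<^esub> t)"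
    if "k \<in> ?K" "y \<in> carrier (?C k)" for k y
    by (rule Q[OF that(1), unfolded quot_def, THEN conjunct2, THEN conjunct2, rule_format, OF that(2)])
  \<comment> \<open>By \<open>conj_N_blocks\<close> equivariance under the conjugated part of \<open>N\<close> is equivariance under \<open>N1 \<times> N2\<close>.\<close>
  have eigen_iff: "(\<forall>u\<in>N_unip n. rep_conj n r k u \<in> ?P \<longrightarrow>
        act ?V (rep_conj n r k u) t = \<psi>N \<psi>0 n u \<odot>\<^bsub>?V\<^esub> t) \<longleftrightarrow>
      (\<forall>u1\<in>N1 r k. \<forall>u2\<in>N2 n r k. act ?T (u1, u2) t = (\<psi>1 \<psi>0 r k u1 * \<psi>2 \<psi>0 n r k u2) \<odot>\<^bsub>?T\<^esub> t)"
    (is "?L \<longleftrightarrow> ?R") if k: "k \<in> ?K" for k t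
  proof
    note c = conj_N_blocks[OF K[OF k] rs \<psi>0]
    assume L: ?L
    show ?R
    proof (intro ballI)
      fix u1 u2 :: "'f mat" assume "u1 \<in> N1 r k" "u2 \<in> N2 n r k"
      from c(2)[OF this] obtain u where u: "u \<in> N_unip n"
        "rep_conj n r k u \<in> ?P"
        "get_block [r, s] 0 0 (rep_conj n r k u) = u1"
        "get_block [r, s] 1 1 (rep_conj n r k u) = u2" by blast
      show "act ?T (u1, u2) t = (\<psi>1 \<psi>0 r k u1 * \<psi>2 \<psi>0 n r k u2) \<odot>\<^bsub>?T\<^esub> t"
        using L[rule_format, OF u(1,2)] c(1)[OF u(1,2)] unfolding pullback_simps u(3,4) by simp
    qed
  next
    note c = conj_N_blocks[OF K[OF k] rs \<psi>0]
    assume R: ?R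
    show ?L
    proof (intro ballI impI)
      fix u assume u: "u \<in> N_unip n" "rep_conj n r k u \<in> ?P"
      from c(1)[OF u] R show "act ?V (rep_conj n r k u) t = \<psi>N \<psi>0 n u \<odot>\<^bsub>?V\<^esub> t"
        unfolding pullback_simps by auto
    qed
  qed
  have L: "subgroup (diag_embed n ` parabolic (P_sizes n r k)) ?G"
    "parabolic (P_sizes n r k) \<subseteq> (carrier (GL n) :: 'f mat set)" if k: "k \<in> ?K" for k
  proof -
    have S: "subgroup (parabolic (P_sizes n r k)) (GL n :: 'f mat monoid)"
      unfolding parabolic_three[OF K(2)[OF k] K(1)[OF k]] by (rule subgroup_lower_zero)
    show "parabolic (P_sizes n r k) \<subseteq> (carrier (GL n) :: 'f mat set)" by (rule subgroup.subset[OF S])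
    show "subgroup (diag_embed n ` parabolic (P_sizes n r k)) ?G"
      using subgroup.subset[OF S] subgroup.one_closed[OF S] subgroup.m_closed[OF S]
      by (intro diag_embed_subgroup) auto
  qed
  have block: "get_block [n, n] 0 0 (diag_embed n h) = h" if "h \<in> carrier_mat n n" for h :: "'f mat"
    unfolding diag_embed_def using get_block_two(1)[OF that zero_carrier_mat zero_carrier_mat that] .
  interpret twisted_mackey ?G ?P "N_unip n" "diag_embed n ` carrier (GL n)" "\<psi>N \<psi>0 n" ?V ?K "rep_mat n r"
    "\<lambda>k. diag_embed n ` parabolic (P_sizes n r k)" "\<tau> \<psi>0 n r \<rho>1 \<rho>2" q
  proof (rule twisted_mackey.intro[OF GL_group], rule twisted_mackey_axioms.intro, unfold GL_simps)
    show "subgroup ?P ?G" by (rule P)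
    show "subgroup (diag_embed n ` carrier (GL n)) ?G"
      by (rule diag_embed_subgroup) (auto simp: one_GL GL_mult_closed)
    show "finite_character ?G (N_unip n) (\<psi>N \<psi>0 n)"
      using upper_unip_finite_character[OF \<psi>0, of 0 n n] by (simp add: N_unip_eq \<psi>N_eq mult_2)
    show "normalizes ?G (N_unip n) (\<psi>N \<psi>0 n) h" if "h \<in> diag_embed n ` carrier (GL n)" for h
      using that diag_embed_normalizes by auto
    show "representation (?G\<lparr>carrier := ?P\<rparr>) ?V" by (rule V)
  next
    fix k assume k: "k \<in> ?K"
    note kk = K[OF k]
    show "rep_mat n r k \<in> carrier ?G" by (rule rep_mat_GL[OF kk])
    show "subgroup (diag_embed n ` parabolic (P_sizes n r k)) ?G" by (rule L(1)[OF k])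
    show "diag_embed n ` parabolic (P_sizes n r k) \<subseteq> diag_embed n ` (carrier (GL n) :: 'f mat set)"
      using L(2)[OF k] by blast
    note f = N12_finite_character[OF kk rs \<psi>0]
    have CC: "cspace (?C k)"
      by (rule cspace_tensor[OF coinvariants_facts(1)[OF R1 f(1)] coinvariants_facts(1)[OF R2 f(2)]])
    then show "cspace (\<tau> \<psi>0 n r \<rho>1 \<rho>2 k)" unfolding \<tau>_def by (rule cspace_pullback)
    show "q k \<in> lin ?V (\<tau> \<psi>0 n r \<rho>1 \<rho>2 k)" unfolding \<tau>_def lin_pullback by (rule q[OF k])
    show "\<exists>!v. v \<in> carrier ?V \<and> q k v = y \<and> (\<forall>u\<in>N_unip n. rep_conj n r k u \<in> ?P \<longrightarrow>
        act ?V (rep_conj n r k u) v = \<psi>N \<psi>0 n u \<odot>\<^bsub>?V\<^esub> v)"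
      if "y \<in> carrier (\<tau> \<psi>0 n r \<rho>1 \<rho>2 k)" for y
      unfolding eigen_iff[OF k] using q_lift[OF k, of y] that by (simp add: \<tau>_def)
  next
    fix k k' h u assume k: "k \<in> ?K" "k' \<in> ?K" and h: "h \<in> diag_embed n ` carrier (GL n)" and u: "u \<in> N_unip n"
      and m: "rep_mat n r k * h * u * inv\<^bsub>?G\<^esub> (rep_mat n r k') \<in> ?P"
    obtain g where g: "g \<in> carrier (GL n)" "h = diag_embed n g" using h by blast
    have uG: "u \<in> carrier ?G" using u upper_unip_GL[of n n] by (auto simp: N_unip_eq mult_2)
    have "rep_mat n r k * h * u = rep_mat n r k * (h * u)"
      using rep_mat_GL[OF K[OF k(1)]] diag_embed_GL[OF g(1)] uG unfolding g(2) GL_carrier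
      by (intro assoc_mult_mat) auto
    then have "lower_zero r (rep_mat n r k * (diag_embed n g * u) * inv\<^bsub>?G\<^esub> (rep_mat n r k'))"
      using m by (simp add: parabolic_two g(2))
    from conj_disjoint[OF K[OF k(1)] K[OF k(2)] g(1) u this]
    show "k = k' \<and> h \<in> diag_embed n ` parabolic (P_sizes n r k)" unfolding g(2) by blast
  next
    fix k :: nat and h :: "'f mat" assume k: "k \<in> ?K" and "h \<in> diag_embed n ` parabolic (P_sizes n r k)"
    then obtain g where g: "g \<in> parabolic (P_sizes n r k)" "h = diag_embed n g" by blast
    note norm = \<tau>_args_normalize[OF K[OF k] rs g(1)]
    show "rep_conj n r k h \<in> ?P" unfolding g(2) by (rule norm(3))
    have gc: "g \<in> carrier_mat n n" "lower_zero k g" "lower_zero (r - k) g"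
      using g(1) by (auto simp: parabolic_three[OF K(2)[OF k] K(1)[OF k]] GL_carrier)
    show "q k (act ?V (rep_conj n r k h) v) = act (\<tau> \<psi>0 n r \<rho>1 \<rho>2 k) h (q k v)"
      if "v \<in> carrier ?V" for v
      using q_act[OF k norm(1,2), of v] that
      unfolding pullback_simps g(2) conj_diag_embed(2,3)[OF K[OF k] rs gc] \<tau>_def Let_def block[OF gc(1)] .
  next
    fix x assume x: "x \<in> carrier ?G"
    have triv: "x * u * inv\<^bsub>?G\<^esub> x \<in> ?P \<and> (\<forall>v\<in>carrier ?V. act ?V (x * u * inv\<^bsub>?G\<^esub> x) v = v)"
      if u: "x * u * inv\<^bsub>?G\<^esub> x = four_block_mat (1\<^sub>m r) B (0\<^sub>m s r) (1\<^sub>m s)" and B: "B \<in> carrier_mat r s" for u B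
    proof -
      have "four_block_mat (1\<^sub>m r) B (0\<^sub>m s r) (1\<^sub>m s) \<in> ?P"
        using block_upper_GL[OF one_GL B one_GL] by (auto simp: parabolic_two lower_zero_def)
      moreover have "act ?T (1\<^sub>m r, 1\<^sub>m s) v = v" if "v \<in> carrier ?T" for v
        using representationD(4)[OF T that] by simp
      ultimately show ?thesis
        unfolding u pullback_simps get_block_two[OF one_carrier_mat B zero_carrier_mat one_carrier_mat] by blast
    qed
    show "(\<exists>k\<in>?K. \<exists>p\<in>?P. \<exists>h\<in>diag_embed n ` carrier (GL n). \<exists>u\<in>N_unip n. x = p * rep_mat n r k * h * u) \<or>
        (\<exists>u\<in>N_unip n. x * u * inv\<^bsub>?G\<^esub> x \<in> ?P \<and> \<psi>N \<psi>0 n u \<noteq> 1 \<and>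
          (\<forall>v\<in>carrier ?V. act ?V (x * u * inv\<^bsub>?G\<^esub> x) v = v))"
      using double_coset_cover[OF x rs \<psi>0]
    proof (elim disjE exE conjE bexE)
      fix k p h u assume "r \<le> n + k" "2 * k \<le> r" "p \<in> ?P" "h \<in> carrier (GL n)" "u \<in> N_unip n"
        "x = p * rep_mat n r k * diag_embed n h * u"
      then show ?thesis using KI by blast
    next
      fix u B assume "u \<in> N_unip n" "B \<in> carrier_mat r s"
        "x * u * inv\<^bsub>?G\<^esub> x = four_block_mat (1\<^sub>m r) B (0\<^sub>m s r) (1\<^sub>m s)" "\<psi>N \<psi>0 n u \<noteq> 1"
      then show ?thesis using triv by blast
    qed
  qed
  show ?thesis
    using coinvariants_of_induced unfolding parabolic_induction_def Delta_GL_def s_def[symmetric] rs .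
qed

end
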